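(* (a) Let $E$ be $\mathbb{R}^m$ endowed with an absolute norm such that $n(E)=1$, and let $X_1,\ldots,X_m$ be nonzero Banach spaces. Then $$n\bigl([X_1\oplus\cdots\oplus X_m]_E\bigr)=\min\{n(X_1),\ldots,n(X_m)\}.$$ (b) Let $E$ be a Banach space with a normalized one-unconditional basis, viewed as a linear subspace of $\mathbb{R}^{\mathbb{N}}$ via the basis, having the Radon-Nikodým property and such that $n(E)=1$. Then, for every sequence $\{X_j: j\in\mathbb{N}\}$ of nonzero Banach spaces, $$n\Bigl(\Bigl[\bigoplus_{j\in\mathbb{N}}X_j\Bigr]_E\Bigr)=\inf\{n(X_j): j\in\mathbb{N}\}.$$
   Context: For a Banach space $X$ (real or complex), $S_X$ and $X^*$ denote its unit sphere and dual, and $L(X)$ the bounded linear operators on $X$. Put $\Pi(X)=\{(x,x^* )\in S_X\times S_{X^*}: x^*(x)=1\}$. The numerical radius of $T\in L(X)$ is $v(T)=\sup\{|x^*(Tx)|:(x,x^* )\in\Pi(X)\}$, and the numerical index of $X$ is $n(X)=\inf\{v(T): T\in L(X),\ \|T\|=1\}$. ($n(E)$ is the numerical index of $E$ as a real Banach space.) An absolute norm on a linear subspace $E$ of $\mathbb{R}^\Lambda$ is a complete norm $\|\cdot\|_E$ such that: (a) if $(a_\lambda),(b_\lambda)\in\mathbb{R}^\Lambda$ satisfy $|a_\lambda|=|b_\lambda|$ for all $\lambda$ and $(a_\lambda)\in E$, then $(b_\lambda)\in E$ and $\|(a_\lambda)\|_E=\|(b_\lambda)\|_E$; (b) for every $\lambda\in\Lambda$,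 the characteristic function $\chi_{\{\lambda\}}$ belongs to $E$ and has norm $1$. A real Banach space with a normalized one-unconditional basis is identified, via the coefficients with respect to the basis, with a linear subspace of $\mathbb{R}^{\mathbb{N}}$ with an absolute norm. For a family $\{X_\lambda:\lambda\in\Lambda\}$ of Banach spaces over the same scalar field ($\mathbb{R}$ or $\mathbb{C}$), the $E$-sum is $\bigl[\bigoplus_{\lambda}X_\lambda\bigr]_E=\{(x_\lambda): x_\lambda\in X_\lambda\ \forall\lambda,\ (\|x_\lambda\|)\in E\}$ with norm $\|(x_\lambda)\|=\|(\|x_\lambda\|)\|_E$; for $\Lambda=\{1,\ldots,m\}$ it is written $[X_1\oplus\cdots\oplus X_m]_E$. *)

theory Defs
  imports "HOL-Analysis.Analysis"
begin

(* Banach spaces are given by an explicit carrier: the members of a family (X_i) are different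
   spaces, which the type class banach cannot express for an arbitrary index set.  Nothing is lost
   by letting all the carriers lie in one type 'a, since this type is arbitrary.
   The scalars 'k are real or complex in all uses. *)

record ('k, 'a) nvs =
  vcarrier :: "'a set"
  vadd :: "'a \<Rightarrow> 'a \<Rightarrow> 'a"
  vzero :: "'a"
  vscale :: "'k \<Rightarrow> 'a \<Rightarrow> 'a"
  vnorm :: "'a \<Rightarrow> real"

definition vdist :: "('k::real_normed_field, 'a) nvs \<Rightarrow> 'a \<Rightarrow> 'a \<Rightarrow> real" where
  "vdist X x y = vnorm X (vadd X x (vscale X (- 1) y))"

locale normed_space_on =
  fixes X :: "('k::real_normed_field, 'a) nvs"
  assumes zero_closed: "vzero X \<in> vcarrier X"
    and add_closed: "\<lbrakk>x \<in> vcarrier X; y \<in> vcarrier X\<rbrakk> \<Longrightarrow> vadd X x y \<in> vcarrier X"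
    and scale_closed: "x \<in> vcarrier X \<Longrightarrow> vscale X c x \<in> vcarrier X"
    and add_assoc: "\<lbrakk>x \<in> vcarrier X; y \<in> vcarrier X; z \<in> vcarrier X\<rbrakk>
          \<Longrightarrow> vadd X (vadd X x y) z = vadd X x (vadd X y z)"
    and add_comm: "\<lbrakk>x \<in> vcarrier X; y \<in> vcarrier X\<rbrakk> \<Longrightarrow> vadd X x y = vadd X y x"
    and add_zero: "x \<in> vcarrier X \<Longrightarrow> vadd X x (vzero X) = x"
    and add_neg: "x \<in> vcarrier X \<Longrightarrow> vadd X x (vscale X (- 1) x) = vzero X"
    and scale_add: "\<lbrakk>x \<in> vcarrier X; y \<in> vcarrier X\<rbrakk>
          \<Longrightarrow> vscale X c (vadd X x y) = vadd X (vscale X c x) (vscale X c y)"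
    and add_scale: "x \<in> vcarrier X
          \<Longrightarrow> vscale X (c + d) x = vadd X (vscale X c x) (vscale X d x)"
    and scale_scale: "x \<in> vcarrier X \<Longrightarrow> vscale X c (vscale X d x) = vscale X (c * d) x"
    and scale_one: "x \<in> vcarrier X \<Longrightarrow> vscale X 1 x = x"
    and norm_eq_0: "x \<in> vcarrier X \<Longrightarrow> vnorm X x = 0 \<longleftrightarrow> x = vzero X"
    and norm_scale: "x \<in> vcarrier X \<Longrightarrow> vnorm X (vscale X c x) = norm c * vnorm X x"
    and norm_triangle: "\<lbrakk>x \<in> vcarrier X; y \<in> vcarrier X\<rbrakk>
          \<Longrightarrow> vnorm X (vadd X x y) \<le> vnorm X x + vnorm X y"

locale banach_space_on = normed_space_on +
  assumes complete: "Metric_space.mcomplete (vcarrier X) (vdist X)"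

definition nonzero_space :: "('k, 'a) nvs \<Rightarrow> bool" where
  "nonzero_space X \<longleftrightarrow> vcarrier X \<noteq> {vzero X}"

definition scalar_space :: "('k::real_normed_field, 'k) nvs" where
  "scalar_space = \<lparr>vcarrier = UNIV, vadd = (+), vzero = 0, vscale = (*), vnorm = norm\<rparr>"

definition type_space :: "(real, 'e::real_normed_vector) nvs" where
  "type_space = \<lparr>vcarrier = UNIV, vadd = (+), vzero = 0, vscale = scaleR, vnorm = norm\<rparr>"

(* Operators and functionals are functions on the whole type 'a; their values outside the carrier
   are irrelevant to every notion below. *)

definition bounded_linear_on ::
  "('k::real_normed_field, 'a) nvs \<Rightarrow> ('k, 'b) nvs \<Rightarrow> ('a \<Rightarrow> 'b) \<Rightarrow> bool" where
  "bounded_linear_on X Y T \<longleftrightarrow>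
     (\<forall>x\<in>vcarrier X. T x \<in> vcarrier Y) \<and>
     (\<forall>x\<in>vcarrier X. \<forall>y\<in>vcarrier X. T (vadd X x y) = vadd Y (T x) (T y)) \<and>
     (\<forall>c. \<forall>x\<in>vcarrier X. T (vscale X c x) = vscale Y c (T x)) \<and>
     (\<exists>K. \<forall>x\<in>vcarrier X. vnorm Y (T x) \<le> K * vnorm X x)"

definition op_norm ::
  "('k::real_normed_field, 'a) nvs \<Rightarrow> ('k, 'b) nvs \<Rightarrow> ('a \<Rightarrow> 'b) \<Rightarrow> real" where
  "op_norm X Y T = Sup {vnorm Y (T x) | x. x \<in> vcarrier X \<and> vnorm X x \<le> 1}"

definition numerical_states :: "('k::real_normed_field, 'a) nvs \<Rightarrow> ('a \<times> ('a \<Rightarrow> 'k)) set" where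
  "numerical_states X =
     {(x, f). x \<in> vcarrier X \<and> vnorm X x = 1 \<and>
        bounded_linear_on X scalar_space f \<and> op_norm X scalar_space f = 1 \<and> f x = 1}"

definition numerical_radius :: "('k::real_normed_field, 'a) nvs \<Rightarrow> ('a \<Rightarrow> 'a) \<Rightarrow> real" where
  "numerical_radius X T = Sup {norm (f (T x)) | x f. (x, f) \<in> numerical_states X}"

definition numerical_index :: "('k::real_normed_field, 'a) nvs \<Rightarrow> real" where
  "numerical_index X = Inf {numerical_radius X T | T. bounded_linear_on X X T \<and> op_norm X X T = 1}"

(* The index set of the coordinates is the whole type 'i. *)

definition coord_space :: "('i \<Rightarrow> real) set \<Rightarrow> (('i \<Rightarrow> real) \<Rightarrow> real) \<Rightarrow> (real, 'i \<Rightarrow> real) nvs" where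
  "coord_space E N = \<lparr>vcarrier = E, vadd = (\<lambda>a b i. a i + b i), vzero = (\<lambda>i. 0),
     vscale = (\<lambda>c a i. c * a i), vnorm = N\<rparr>"

definition absolute_norm :: "('i \<Rightarrow> real) set \<Rightarrow> (('i \<Rightarrow> real) \<Rightarrow> real) \<Rightarrow> bool" where
  "absolute_norm E N \<longleftrightarrow>
     banach_space_on (coord_space E N) \<and>
     (\<forall>a b. (\<forall>i. \<bar>a i\<bar> = \<bar>b i\<bar>) \<and> a \<in> E \<longrightarrow> b \<in> E \<and> N a = N b) \<and>
     (\<forall>i. (indicator {i} :: 'i \<Rightarrow> real) \<in> E \<and> N (indicator {i}) = 1)"

definition E_sum ::
  "('i \<Rightarrow> real) set \<Rightarrow> (('i \<Rightarrow> real) \<Rightarrow> real) \<Rightarrow> ('i \<Rightarrow> ('k, 'a) nvs) \<Rightarrow> ('k, 'i \<Rightarrow> 'a) nvs" where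
  "E_sum E N X =
     \<lparr>vcarrier = {x. (\<forall>i. x i \<in> vcarrier (X i)) \<and> (\<lambda>i. vnorm (X i) (x i)) \<in> E},
      vadd = (\<lambda>x y i. vadd (X i) (x i) (y i)),
      vzero = (\<lambda>i. vzero (X i)),
      vscale = (\<lambda>c x i. vscale (X i) c (x i)),
      vnorm = (\<lambda>x. N (\<lambda>i. vnorm (X i) (x i)))\<rparr>"

definition schauder_basis :: "(nat \<Rightarrow> 'e::banach) \<Rightarrow> bool" where
  "schauder_basis e \<longleftrightarrow> (\<forall>x. \<exists>!a. (\<lambda>n. a n *\<^sub>R e n) sums x)"

definition one_unconditional_basis :: "(nat \<Rightarrow> 'e::banach) \<Rightarrow> bool" where
  "one_unconditional_basis e \<longleftrightarrow> schauder_basis e \<and>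
     (\<forall>a \<theta> x. (\<lambda>n. a n *\<^sub>R e n) sums x \<and> (\<forall>n. \<theta> n \<in> {- 1, 1}) \<longrightarrow>
        (\<exists>y. (\<lambda>n. (\<theta> n * a n) *\<^sub>R e n) sums y \<and> norm y = norm x))"

definition coeff_space :: "(nat \<Rightarrow> 'e::banach) \<Rightarrow> (nat \<Rightarrow> real) set" where
  "coeff_space e = {a. summable (\<lambda>n. a n *\<^sub>R e n)}"

definition coeff_norm :: "(nat \<Rightarrow> 'e::banach) \<Rightarrow> (nat \<Rightarrow> real) \<Rightarrow> real" where
  "coeff_norm e a = norm (\<Sum>n. a n *\<^sub>R e n)"

definition vector_measure :: "'w measure \<Rightarrow> ('w set \<Rightarrow> 'e::banach) \<Rightarrow> bool" where
  "vector_measure M G \<longleftrightarrow>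
     (\<forall>A :: nat \<Rightarrow> 'w set. range A \<subseteq> sets M \<and> disjoint_family A
        \<longrightarrow> (\<lambda>n. G (A n)) sums G (\<Union>n. A n))"

definition bounded_variation :: "'w measure \<Rightarrow> ('w set \<Rightarrow> 'e::banach) \<Rightarrow> bool" where
  "bounded_variation M G \<longleftrightarrow>
     (\<exists>C. \<forall>P. finite P \<and> P \<subseteq> sets M \<and> disjoint P \<longrightarrow> (\<Sum>A\<in>P. norm (G A)) \<le> C)"

(* HOL cannot quantify over the type of the points of a measure space inside a definition, so M
   ranges over the finite measures, with any sigma-algebra, on subsets of the reals.  This includes
   Lebesgue measure on [0,1], for which the condition is already equivalent to the condition for
   all finite measure spaces (Diestel and Uhl, Vector Measures, Chapter V).
   The sort second_countable_topology, required by the Bochner integral of the library, means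
   separability, which holds for every Banach space with a Schauder basis. *)

definition radon_nikodym_property :: "'e::{banach, second_countable_topology} itself \<Rightarrow> bool" where
  "radon_nikodym_property _ \<longleftrightarrow>
     (\<forall>(M :: real measure) (G :: real set \<Rightarrow> 'e).
        finite_measure M \<and> vector_measure M G \<and> bounded_variation M G \<and>
        (\<forall>A\<in>null_sets M. G A = 0) \<longrightarrow>
        (\<exists>g. integrable M g \<and> (\<forall>A\<in>sets M. G A = set_lebesgue_integral M A g)))"

end

theory Submission
  imports Defs
begin

text \<open>
  Write \<open>Z\<close> for the \<open>E\<close>-sum of the spaces \<open>X i\<close>.  The estimate \<open>n(Z) \<le> n(X j)\<close> holds for every absolute
  norm: an operator on \<open>X j\<close> is extended by zero to \<open>Z\<close>, and a state of \<open>Z\<close> induces, up to a factor of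
  modulus at most one, a state of \<open>X j\<close> (\<open>state_restricted_to_summand\<close>).

  For the reverse estimate let \<open>T\<close> be an operator of norm one on \<open>Z\<close>.  Suppose that there are
  \<open>z = (x i \<cdot> u i)\<close> with unit vectors \<open>u i\<close> and \<open>x\<close> in the unit ball of \<open>E\<close>, and a functional
  \<open>\<Sum> \<phi> i \<cdot> h i\<close> on \<open>Z\<close> with \<open>\<phi>\<close> in the dual ball of \<open>E\<close> and functionals \<open>h i\<close> of norm one on \<open>X i\<close>, which is almost
  \<open>1\<close> at \<open>T z\<close>.  If moreover \<open>\<bar>\<phi> i0 \<cdot> x i0\<bar>\<close> is almost \<open>1\<close> for one index \<open>i0\<close>, then \<open>\<Sum> \<bar>\<phi> i \<cdot> x i\<bar> \<le> 1\<close>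
  forces the other products to be negligible.  In this case \<open>X i0\<close> can be embedded into \<open>Z\<close> through \<open>z\<close>,
  and \<open>Z\<close> can be folded back onto \<open>X i0\<close>, by contractions that almost preserve duality.  They compress
  \<open>T\<close> to an operator on \<open>X i0\<close> that has almost norm one and whose numerical radius is almost bounded by
  that of \<open>T\<close> (\<open>numerical_radius_lower_estimate\<close>).  It is enough to work with pairs that are
  nearly in duality, because the numerical radius controls these as well
  (\<open>numerical_radius_approximate_states\<close>).

  The index \<open>i0\<close> comes from \<open>n(E) = 1\<close>.  Applied to rank-one operators, this says that every slice of the
  ball of \<open>E\<close> and every weak-star slice of the dual ball contain a point and a functional with
  \<open>\<bar>f x\<bar> = 1\<close> (\<open>numerical_index_1_slices_in_duality\<close>).  If \<open>x\<close> lies in a slice of small diameter, then so do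
  its sign changes, and one gets a functional that is almost unimodular at all sign changes of \<open>x\<close>.  Flipping
  the signs one by one shows that a single coordinate carries almost the whole value
  (\<open>concentrated_functional\<close>).

  What remains is to find \<open>x\<close> in slices of small diameter with \<open>\<parallel>T z\<parallel>\<close> almost one, that is, the dentability of
  the ball of \<open>E\<close>.  In finite dimensions each slice contains small ones, by an elementary argument on
  near-maxima of a quadratic perturbation (\<open>subslice_with_small_oscillation\<close>).  For a space with an
  unconditional basis and the Radon-Nikodym property, that property is used once: for a sequence \<open>a\<close> with
  bounded partial sums, the measures \<open>A \<mapsto> (a i \<cdot> \<integral>\<^sub>A cos (2 \<pi> i t) dt)\<close> and their sine counterparts have
  densities with coefficients \<open>a i \<cdot> cos (2 \<pi> i t)\<close> and \<open>a i \<cdot> sin (2 \<pi> i t)\<close>, so that \<open>a\<close> itself belongs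
  to the space (\<open>boundedly_complete_coeff\<close>).  Bounded completeness and separability give dentability by
  an argument in the manner of Baire (\<open>boundedly_complete_space.dentable_ball\<close>).
\<close>

section \<open>Norming functionals\<close>

context normed_space_on
begin

lemma scale_0: "x \<in> vcarrier X \<Longrightarrow> vscale X 0 x = vzero X"
  using add_scale[of x 1 "-1"] add_neg[of x] scale_one[of x] by simp

lemma scale_vzero: "vscale X c (vzero X) = vzero X"
  using scale_scale[OF zero_closed, of c 0] scale_0[OF zero_closed] by simp

lemma zero_add: "x \<in> vcarrier X \<Longrightarrow> vadd X (vzero X) x = x"
  using add_comm[OF zero_closed, of x] add_zero[of x] by simp

lemma norm_vzero: "vnorm X (vzero X) = 0"
  using norm_eq_0[OF zero_closed] by simp

lemma norm_nonneg: "x \<in> vcarrier X \<Longrightarrow> 0 \<le> vnorm X x"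
  using norm_triangle[OF _ scale_closed, of x x "-1"] norm_scale[of x "-1"] add_neg[of x] norm_vzero
  by simp

lemma add_interchange:
  assumes "a \<in> vcarrier X" "b \<in> vcarrier X" "c \<in> vcarrier X" "d \<in> vcarrier X"
  shows "vadd X (vadd X a b) (vadd X c d) = vadd X (vadd X a c) (vadd X b d)"
  using assms by (metis add_assoc add_closed add_comm)


end

definition sublinear_on :: "(real, 'a) nvs \<Rightarrow> ('a \<Rightarrow> real) \<Rightarrow> bool" where
  "sublinear_on X p \<longleftrightarrow>
     (\<forall>x\<in>vcarrier X. \<forall>y\<in>vcarrier X. p (vadd X x y) \<le> p x + p y) \<and>
     (\<forall>t\<ge>0. \<forall>x\<in>vcarrier X. p (vscale X t x) = t * p x)"

lemma sublinear_on_neg: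
  fixes X :: "(real, 'a) nvs"
  assumes X: "normed_space_on X" and p: "sublinear_on X p" and x: "x \<in> vcarrier X"
  shows "- p (vscale X (- 1) x) \<le> p x"
proof -
  interpret normed_space_on X by fact
  have "p (vzero X) = 0"
    using p scale_vzero[of 0] zero_closed unfolding sublinear_on_def
    by (metis mult_zero_left order_refl)
  moreover have "p (vadd X x (vscale X (-1) x)) \<le> p x + p (vscale X (-1) x)"
    using p x scale_closed[OF x] unfolding sublinear_on_def by blast
  ultimately show ?thesis using add_neg[OF x] by simp
qed

text \<open>The functional \<open>q x = inf {p (x + t y) - t p y | t \<ge> 0}\<close> does this.  It serves twice: it turns the norm into a
  sublinear functional whose linear minorants are norming at \<open>y\<close>, and it shows that a minimal sublinear
  functional is odd.\<close>

lemma sublinear_lower: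
  fixes X :: "(real, 'a) nvs"
  assumes X: "normed_space_on X" and p: "sublinear_on X p" and y: "y \<in> vcarrier X"
  shows "\<exists>q. sublinear_on X q \<and> (\<forall>x\<in>vcarrier X. q x \<le> p x) \<and> q (vscale X (- 1) y) \<le> - p y"
proof -
  interpret normed_space_on X by fact
  note cl = zero_closed add_closed scale_closed
  have sub: "p (vadd X a b) \<le> p a + p b" if "a \<in> vcarrier X" "b \<in> vcarrier X" for a b
    using p that unfolding sublinear_on_def by blast
  have hom: "p (vscale X t a) = t * p a" if "a \<in> vcarrier X" "0 \<le> t" for a t
    using p that unfolding sublinear_on_def by blast
  define V where "V x = (\<lambda>t. p (vadd X x (vscale X t y)) - t * p y) ` {0..}" for x
  define q where "q x = Inf (V x)" for x
  have low: "- p (vscale X (-1) x) \<le> v" if x: "x \<in> vcarrier X" and v: "v \<in> V x" for x v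
  proof -
    obtain t where t: "t \<ge> 0" "v = p (vadd X x (vscale X t y)) - t * p y"
      using v unfolding V_def by auto
    have "vscale X t y = vadd X (vadd X x (vscale X t y)) (vscale X (-1) x)"
      using x y by (metis add_neg add_assoc add_comm add_zero scale_closed)
    then have "t * p y \<le> p (vadd X x (vscale X t y)) + p (vscale X (-1) x)"
      using sub[of "vadd X x (vscale X t y)" "vscale X (-1) x"] hom[OF y t(1)] x y cl by metis
    then show ?thesis using t by simp
  qed
  have bdd: "bdd_below (V x)" if "x \<in> vcarrier X" for x
    using low[OF that] by (rule bdd_belowI)
  have ne: "V x \<noteq> {}" for x unfolding V_def by auto
  have le: "q x \<le> p (vadd X x (vscale X t y)) - t * p y" if "x \<in> vcarrier X" "t \<ge> 0" for x t
    unfolding q_def using bdd[OF that(1)] that(2) by (intro cInf_lower) (auto simp: V_def)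
  have ge: "c \<le> q x" if "\<And>t. t \<ge> 0 \<Longrightarrow> c \<le> p (vadd X x (vscale X t y)) - t * p y" for x c
    unfolding q_def using ne that by (intro cInf_greatest) (auto simp: V_def)
  have qp: "q x \<le> p x" if "x \<in> vcarrier X" for x
    using le[OF that, of 0] y by (simp add: scale_0 add_zero that)
  have qadd: "q (vadd X a b) \<le> q a + q b" if ab: "a \<in> vcarrier X" "b \<in> vcarrier X" for a b
  proof -
    have "q (vadd X a b) - q b \<le> p (vadd X a (vscale X t y)) - t * p y" if t: "t \<ge> 0" for t
    proof -
      have "q (vadd X a b) - (p (vadd X a (vscale X t y)) - t * p y)
            \<le> p (vadd X b (vscale X s y)) - s * p y" if s: "s \<ge> 0" for s
      proof -
        have "q (vadd X a b) \<le> p (vadd X (vadd X a b) (vscale X (t + s) y)) - (t + s) * p y"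
          using le[of "vadd X a b" "t + s"] ab cl s t by simp
        also have "vadd X (vadd X a b) (vscale X (t + s) y)
            = vadd X (vadd X a (vscale X t y)) (vadd X b (vscale X s y))"
          using ab y cl by (simp add: add_scale add_interchange)
        finally show ?thesis
          using sub[of "vadd X a (vscale X t y)" "vadd X b (vscale X s y)"] ab y cl
          by (simp add: algebra_simps)
      qed
      then have "q (vadd X a b) - (p (vadd X a (vscale X t y)) - t * p y) \<le> q b" by (rule ge)
      then show ?thesis by simp
    qed
    then have "q (vadd X a b) - q b \<le> q a" by (rule ge)
    then show ?thesis by simp
  qed
  have qle: "q (vscale X r a) \<le> r * q a" if r: "r > 0" and a: "a \<in> vcarrier X" for r a
  proof -
    have "q (vscale X r a) / r \<le> p (vadd X a (vscale X t y)) - t * p y" if t: "t \<ge> 0" for t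
    proof -
      have "vadd X (vscale X r a) (vscale X (r * t) y) = vscale X r (vadd X a (vscale X t y))"
        using a y cl by (simp add: scale_add scale_scale)
      then have "q (vscale X r a) \<le> r * p (vadd X a (vscale X t y)) - r * t * p y"
        using le[of "vscale X r a" "r * t"] hom[of "vadd X a (vscale X t y)" r] r t a y cl by simp
      then show ?thesis using r by (simp add: field_simps)
    qed
    then have "q (vscale X r a) / r \<le> q a" by (rule ge)
    then show ?thesis using r by (simp add: field_simps)
  qed
  have qz: "q (vzero X) = 0"
  proof (rule antisym)
    show "q (vzero X) \<le> 0"
      using qp[OF zero_closed] hom[OF zero_closed, of 0] scale_0[OF zero_closed] by simp
    show "0 \<le> q (vzero X)"
      by (rule ge) (use hom[OF y] y in \<open>simp add: zero_add cl\<close>)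
  qed
  have qhom: "q (vscale X r a) = r * q a" if r: "r \<ge> 0" and a: "a \<in> vcarrier X" for r a
  proof (cases "r = 0")
    case True
    then show ?thesis using qz a by (simp add: scale_0)
  next
    case False
    then have r: "r > 0" using r by simp
    have "q (vscale X (1 / r) (vscale X r a)) \<le> (1 / r) * q (vscale X r a)"
      using qle[of "1 / r" "vscale X r a"] r a cl by simp
    then have "q a \<le> (1 / r) * q (vscale X r a)" using r a by (simp add: scale_scale scale_one)
    then have "r * q a \<le> q (vscale X r a)" using r by (simp add: field_simps)
    then show ?thesis using qle[OF r a] by simp
  qed
  have "q (vscale X (-1) y) \<le> - p y"
  proof -
    have "vadd X (vscale X (-1) y) (vscale X 1 y) = vzero X"
      using y by (metis add_neg add_comm scale_closed scale_one)
    then show ?thesis using le[of "vscale X (-1) y" 1] y cl hom[OF zero_closed, of 0]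
      by (simp add: scale_0)
  qed
  then show ?thesis using qp qadd qhom unfolding sublinear_on_def by blast
qed

text \<open>Zorn's lemma applies because the pointwise infimum of a chain is sublinear; it is finite since
  \<open>- p (- x)\<close> is a lower bound at \<open>x\<close>.\<close>

lemma minimal_sublinear:
  fixes X :: "(real, 'a) nvs"
  assumes X: "normed_space_on X" and p: "sublinear_on X p"
  shows "\<exists>m. sublinear_on X m \<and> (\<forall>x\<in>vcarrier X. m x \<le> p x) \<and>
    (\<forall>q. sublinear_on X q \<and> (\<forall>x\<in>vcarrier X. q x \<le> m x) \<longrightarrow> (\<forall>x\<in>vcarrier X. q x = m x))"
proof -
  interpret normed_space_on X by fact
  \<comment> \<open>Values off the carrier are fixed to \<open>0\<close>, to make the pointwise order antisymmetric.\<close>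
  define A where "A = {q. sublinear_on X q \<and> (\<forall>x\<in>vcarrier X. q x \<le> p x) \<and> (\<forall>x. x \<notin> vcarrier X \<longrightarrow> q x = 0)}"
  define P where "P = (\<lambda>q q' :: 'a \<Rightarrow> real. \<forall>x. q' x \<le> q x)"
  define cut where "cut q x = (if x \<in> vcarrier X then q x else 0)" for q :: "'a \<Rightarrow> real" and x
  have cutsub: "sublinear_on X (cut q)" if "sublinear_on X q" for q
    using that unfolding sublinear_on_def cut_def by (simp add: add_closed scale_closed)
  have "\<exists>m\<in>A. \<forall>q\<in>A. P m q \<longrightarrow> q = m"
  proof (rule predicate_Zorn)
    show "partial_order_on A (relation_of P A)"
      unfolding partial_order_on_def preorder_on_def refl_on_def trans_def antisym_def relation_of_def P_def
      by (auto intro: order_trans intro!: ext order.antisym)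
  next
    fix C assume C: "C \<in> Chains (relation_of P A)"
    have CA: "C \<subseteq> A" using C unfolding Chains_def relation_of_def by auto
    have chain: "P a b \<or> P b a" if "a \<in> C" "b \<in> C" for a b
      using C that unfolding Chains_def relation_of_def by auto
    show "\<exists>u\<in>A. \<forall>a\<in>C. P a u"
    proof (cases "C = {}")
      case True
      have "cut p \<in> A" unfolding A_def using cutsub[OF p] by (auto simp: cut_def)
      then show ?thesis using True by auto
    next
      case False
      define u where "u x = (INF c\<in>C. c x)" for x
      have low: "- p (vscale X (-1) x) \<le> c x" if "c \<in> C" "x \<in> vcarrier X" for c x
      proof -
        have "- c (vscale X (-1) x) \<le> c x"
          using sublinear_on_neg[OF X, of c x] that CA unfolding A_def by blast
        moreover have "c (vscale X (-1) x) \<le> p (vscale X (-1) x)"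
          using that CA scale_closed unfolding A_def by blast
        ultimately show ?thesis by simp
      qed
      have bdd: "bdd_below ((\<lambda>c. c x) ` C)" for x
      proof (cases "x \<in> vcarrier X")
        case True
        then show ?thesis using low by (intro bdd_belowI[of _ "- p (vscale X (-1) x)"]) auto
      next
        case False
        have "0 \<le> c x" if "c \<in> C" for c using False CA that unfolding A_def by auto
        then show ?thesis by (rule bdd_belowI2)
      qed
      have le: "u x \<le> c x" if "c \<in> C" for c x
        unfolding u_def using bdd that by (rule cINF_lower)
      have ge: "d \<le> u x" if "\<And>c. c \<in> C \<Longrightarrow> d \<le> c x" for d x
        unfolding u_def using False that by (rule cINF_greatest)
      have Csub: "c (vadd X a b) \<le> c a + c b" if "c \<in> C" "a \<in> vcarrier X" "b \<in> vcarrier X" for a b c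
        using CA that unfolding A_def sublinear_on_def by blast
      have Chom: "c (vscale X t a) = t * c a" if "c \<in> C" "a \<in> vcarrier X" "t \<ge> 0" for a c t
        using CA that unfolding A_def sublinear_on_def by blast
      have "u (vadd X a b) \<le> u a + u b" if ab: "a \<in> vcarrier X" "b \<in> vcarrier X" for a b
      proof -
        have "u (vadd X a b) - u b \<le> c a" if c: "c \<in> C" for c
        proof -
          have "u (vadd X a b) - c a \<le> d b" if d: "d \<in> C" for d
            \<comment> \<open>the smaller of the two chain members serves for both arguments\<close>
            using chain[OF c d] le[OF c, of "vadd X a b"] le[OF d, of "vadd X a b"]
              Csub[OF c ab] Csub[OF d ab] unfolding P_def by (smt (verit))
          then have "u (vadd X a b) - c a \<le> u b" by (rule ge)
          then show ?thesis by simp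
        qed
        then have "u (vadd X a b) - u b \<le> u a" by (rule ge)
        then show ?thesis by simp
      qed
      moreover have "u (vscale X t a) = t * u a" if t: "t \<ge> 0" and a: "a \<in> vcarrier X" for t a
      proof (cases "t = 0")
        case True
        obtain c where "c \<in> C" using False by blast
        have "(\<lambda>c. c (vscale X t a)) ` C = {0}"
          using Chom[OF _ a t] True False by (auto simp: image_def)
        then show ?thesis using True unfolding u_def by simp
      next
        case nz: False
        then have t: "t > 0" using t by simp
        show ?thesis
        proof (rule antisym)
          have "u (vscale X t a) / t \<le> c a" if "c \<in> C" for c
            using le[OF that, of "vscale X t a"] Chom[OF that a, of t] t by (simp add: field_simps)
          then have "u (vscale X t a) / t \<le> u a" by (rule ge)
          then show "u (vscale X t a) \<le> t * u a" using t by (simp add: field_simps)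
          show "t * u a \<le> u (vscale X t a)"
          proof (rule ge)
            fix c assume "c \<in> C"
            then show "t * u a \<le> c (vscale X t a)" using le[of c a] Chom[of c a t] a t by simp
          qed
        qed
      qed
      ultimately have "sublinear_on X u" unfolding sublinear_on_def by blast
      moreover have "u x \<le> p x" if "x \<in> vcarrier X" for x
      proof -
        obtain c where "c \<in> C" using False by blast
        then show ?thesis using le[of c x] CA that unfolding A_def by fastforce
      qed
      moreover have "u x = 0" if "x \<notin> vcarrier X" for x
      proof -
        have "c x = 0" if "c \<in> C" for c using CA that \<open>x \<notin> vcarrier X\<close> unfolding A_def by auto
        then have "(\<lambda>c. c x) ` C = {0}" using False by fastforce
        then show ?thesis unfolding u_def by simp
      qed
      ultimately have "u \<in> A" unfolding A_def by blast
      moreover have "\<forall>a\<in>C. P a u" unfolding P_def using le by blast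
      ultimately show ?thesis by blast
    qed
  qed
  then obtain m where m: "m \<in> A" "\<And>q. q \<in> A \<Longrightarrow> P m q \<Longrightarrow> q = m" by blast
  have "q x = m x" if q: "sublinear_on X q" "\<forall>x\<in>vcarrier X. q x \<le> m x" and x: "x \<in> vcarrier X" for q x
  proof -
    have "cut q \<in> A" using cutsub[OF q(1)] q(2) m(1) unfolding A_def by (fastforce simp: cut_def)
    moreover have "P m (cut q)" using q(2) m(1) unfolding P_def A_def by (auto simp: cut_def)
    ultimately have "cut q = m" by (rule m(2))
    then have "cut q x = m x" by simp
    then show ?thesis using x by (simp add: cut_def)
  qed
  then show ?thesis using m(1) unfolding A_def by blast
qed

text \<open>By \<open>sublinear_lower\<close>, a minimal \<open>m\<close> satisfies \<open>m (- x) \<le> - m x\<close>, hence is odd, and an odd subadditive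
  function is additive.\<close>

lemma minimal_sublinear_linear:
  fixes X :: "(real, 'a) nvs"
  assumes X: "normed_space_on X" and m: "sublinear_on X m"
    and min: "\<forall>q. sublinear_on X q \<and> (\<forall>x\<in>vcarrier X. q x \<le> m x) \<longrightarrow> (\<forall>x\<in>vcarrier X. q x = m x)"
    and x: "x \<in> vcarrier X"
  shows "y \<in> vcarrier X \<Longrightarrow> m (vadd X x y) = m x + m y" and "m (vscale X c x) = c * m x"
proof -
  interpret normed_space_on X by fact
  have hom: "m (vscale X t a) = t * m a" if "a \<in> vcarrier X" "0 \<le> t" for a t
    using m that unfolding sublinear_on_def by blast
  have sub: "m (vadd X a b) \<le> m a + m b" if "a \<in> vcarrier X" "b \<in> vcarrier X" for a b
    using m that unfolding sublinear_on_def by blast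
  have neg: "m (vscale X (-1) a) = - m a" if a: "a \<in> vcarrier X" for a
  proof -
    obtain q where q: "sublinear_on X q" "\<And>x. x \<in> vcarrier X \<Longrightarrow> q x \<le> m x"
      "q (vscale X (-1) a) \<le> - m a"
      using sublinear_lower[OF X m a] by blast
    have "m (vscale X (-1) a) \<le> - m a" using min q scale_closed[OF a] by (metis (no_types))
    moreover have "- m (vscale X (-1) a) \<le> m a" using sublinear_on_neg[OF X m a] .
    ultimately show ?thesis by simp
  qed
  show "m (vadd X x y) = m x + m y" if y: "y \<in> vcarrier X"
  proof -
    have "m (vadd X (vscale X (-1) x) (vscale X (-1) y)) \<le> - m x + - m y"
      using sub[of "vscale X (-1) x" "vscale X (-1) y"] neg[OF x] neg[OF y] x y scale_closed by simp
    moreover have "m (vadd X (vscale X (-1) x) (vscale X (-1) y)) = - m (vadd X x y)"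
      using neg[of "vadd X x y"] x y by (simp add: scale_add add_closed)
    ultimately show ?thesis using sub[OF x y] by simp
  qed
  show "m (vscale X c x) = c * m x"
  proof (cases "c \<ge> 0")
    case True
    then show ?thesis using hom x by simp
  next
    case False
    have "m (vscale X (-1) (vscale X (- c) x)) = - ((- c) * m x)"
      using neg[of "vscale X (- c) x"] hom[of x "- c"] x False scale_closed by simp
    then show ?thesis using x by (simp add: scale_scale)
  qed
qed

definition dual_ball :: "('k::real_normed_field, 'a) nvs \<Rightarrow> ('a \<Rightarrow> 'k) set" where
  "dual_ball X = {f. bounded_linear_on X scalar_space f \<and> (\<forall>x\<in>vcarrier X. norm (f x) \<le> vnorm X x)}"

lemma dual_ball_add: "f \<in> dual_ball X \<Longrightarrow> x \<in> vcarrier X \<Longrightarrow> y \<in> vcarrier X \<Longrightarrow> f (vadd X x y) = f x + f y"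
  unfolding dual_ball_def bounded_linear_on_def scalar_space_def by auto

lemma dual_ball_scale: "f \<in> dual_ball X \<Longrightarrow> x \<in> vcarrier X \<Longrightarrow> f (vscale X c x) = c * f x"
  unfolding dual_ball_def bounded_linear_on_def scalar_space_def by auto

lemma dual_ball_le: "f \<in> dual_ball X \<Longrightarrow> x \<in> vcarrier X \<Longrightarrow> norm (f x) \<le> vnorm X x"
  unfolding dual_ball_def by auto

lemma dual_ballI:
  assumes "\<And>x y. x \<in> vcarrier X \<Longrightarrow> y \<in> vcarrier X \<Longrightarrow> f (vadd X x y) = f x + f y"
    and "\<And>c x. x \<in> vcarrier X \<Longrightarrow> f (vscale X c x) = c * f x"
    and "\<And>x. x \<in> vcarrier X \<Longrightarrow> norm (f x) \<le> vnorm X x"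
  shows "f \<in> dual_ball X"
  unfolding dual_ball_def bounded_linear_on_def scalar_space_def using assms
  by (auto intro!: exI[of _ 1])

definition norming_functionals :: "('k::real_normed_field, 'a) nvs \<Rightarrow> bool" where
  "norming_functionals X \<longleftrightarrow> (\<forall>x\<in>vcarrier X. \<exists>f\<in>dual_ball X. f x = of_real (vnorm X x))"

lemma norming_functionals_real:
  fixes X :: "(real, 'a) nvs"
  assumes X: "normed_space_on X"
  shows "norming_functionals X"
  unfolding norming_functionals_def
proof
  interpret normed_space_on X by fact
  fix x assume x: "x \<in> vcarrier X"
  have N: "sublinear_on X (vnorm X)"
    unfolding sublinear_on_def by (simp add: norm_triangle norm_scale)
  obtain q where q: "sublinear_on X q" "\<And>z. z \<in> vcarrier X \<Longrightarrow> q z \<le> vnorm X z"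
    "q (vscale X (-1) x) \<le> - vnorm X x"
    using sublinear_lower[OF X N x] by blast
  obtain m where m: "sublinear_on X m" "\<And>z. z \<in> vcarrier X \<Longrightarrow> m z \<le> q z"
    and min: "\<forall>q. sublinear_on X q \<and> (\<forall>x\<in>vcarrier X. q x \<le> m x) \<longrightarrow> (\<forall>x\<in>vcarrier X. q x = m x)"
    using minimal_sublinear[OF X q(1)] by blast
  note lin = minimal_sublinear_linear[OF X m(1) min]
  have le: "m z \<le> vnorm X z" if "z \<in> vcarrier X" for z using m(2)[OF that] q(2)[OF that] by simp
  have neg: "m (vscale X (-1) z) = - m z" if "z \<in> vcarrier X" for z using lin(2)[OF that, of "-1"] by simp
  have "\<bar>m z\<bar> \<le> vnorm X z" if "z \<in> vcarrier X" for z
    using le[OF that] le[OF scale_closed[OF that], of "-1"] neg[OF that] norm_scale[OF that, of "-1"] by simp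
  then have "m \<in> dual_ball X" by (intro dual_ballI) (auto simp: lin)
  moreover have "m x = vnorm X x"
    using m(2)[OF scale_closed[OF x], of "-1"] q(3) neg[OF x] le[OF x] by simp
  ultimately show "\<exists>f\<in>dual_ball X. f x = of_real (vnorm X x)" by auto
qed

definition real_restriction :: "('k::real_normed_field, 'a) nvs \<Rightarrow> (real, 'a) nvs" where
  "real_restriction X = \<lparr>vcarrier = vcarrier X, vadd = vadd X, vzero = vzero X,
     vscale = (\<lambda>c. vscale X (of_real c)), vnorm = vnorm X\<rparr>"

lemma real_restriction_sel [simp]:
  "vcarrier (real_restriction X) = vcarrier X" "vadd (real_restriction X) = vadd X"
  "vzero (real_restriction X) = vzero X" "vnorm (real_restriction X) = vnorm X"
  "vscale (real_restriction X) c = vscale X (of_real c)"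
  unfolding real_restriction_def by auto

lemma normed_space_on_real_restriction:
  assumes "normed_space_on X"
  shows "normed_space_on (real_restriction X)"
proof -
  interpret normed_space_on X by fact
  show ?thesis
    by unfold_locales
      (simp_all add: zero_closed add_closed scale_closed add_assoc add_zero add_neg scale_add
        add_scale scale_scale scale_one norm_eq_0 norm_scale norm_triangle, simp add: add_comm)
qed

text \<open>A real functional \<open>r\<close> that norms \<open>x\<close> is the real part of the complex functional
  \<open>r a - \<i> r (\<i> a)\<close>, which has the same norm by a rotation of the argument.\<close>

lemma norming_functionals_complex:
  fixes X :: "(complex, 'a) nvs"
  assumes X: "normed_space_on X"
  shows "norming_functionals X"
  unfolding norming_functionals_def
proof
  interpret normed_space_on X by fact
  fix x assume x: "x \<in> vcarrier X"
  let ?R = "real_restriction X"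
  obtain r where r: "r \<in> dual_ball ?R" "r x = vnorm X x"
    using norming_functionals_real[OF normed_space_on_real_restriction[OF X]] x
    unfolding norming_functionals_def by auto
  have radd: "r (vadd X a b) = r a + r b" if "a \<in> vcarrier X" "b \<in> vcarrier X" for a b
    using dual_ball_add[OF r(1), of a b] that by simp
  have rsc: "r (vscale X (complex_of_real t) a) = t * r a" if "a \<in> vcarrier X" for a t
    using dual_ball_scale[OF r(1), of a t] that by simp
  have rle: "\<bar>r a\<bar> \<le> vnorm X a" if "a \<in> vcarrier X" for a
    using dual_ball_le[OF r(1), of a] that by simp
  define f where "f a = Complex (r a) (- r (vscale X \<i> a))" for a
  have fadd: "f (vadd X a b) = f a + f b" if "a \<in> vcarrier X" "b \<in> vcarrier X" for a b
    unfolding f_def using that by (simp add: radd scale_add scale_closed complex_eq_iff)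
  have rc: "r (vscale X c a) = Re c * r a + Im c * r (vscale X \<i> a)" if a: "a \<in> vcarrier X" for c a
  proof -
    have "vscale X c a = vadd X (vscale X (of_real (Re c)) a) (vscale X (of_real (Im c)) (vscale X \<i> a))"
      using a by (simp add: add_scale[symmetric] scale_scale complex_eq_iff)
        (metis complex_eq mult.commute)
    then show ?thesis using a by (simp add: radd rsc scale_closed)
  qed
  have fsc: "f (vscale X c a) = c * f a" if a: "a \<in> vcarrier X" for c a
  proof -
    have "r (vscale X \<i> (vscale X c a)) = Re (\<i> * c) * r a + Im (\<i> * c) * r (vscale X \<i> a)"
      using a rc[of a "\<i> * c"] by (simp add: scale_scale)
    then show ?thesis unfolding f_def using rc[OF a, of c] by (simp add: complex_eq_iff)
  qed
  have fle: "norm (f a) \<le> vnorm X a" if a: "a \<in> vcarrier X" for a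
  proof (cases "f a = 0")
    case True then show ?thesis using norm_nonneg[OF a] by simp
  next
    case False
    define c where "c = of_real (norm (f a)) / f a"
    have nc: "norm c = 1" unfolding c_def using False by (simp add: norm_divide)
    have "f (vscale X c a) = of_real (norm (f a))"
      using fsc[OF a, of c] False unfolding c_def by simp
    then have "r (vscale X c a) = norm (f a)" unfolding f_def by (simp add: complex_eq_iff)
    then show ?thesis using rle[OF scale_closed[OF a], of c] norm_scale[OF a, of c] nc by simp
  qed
  have "f \<in> dual_ball X" using fadd fsc fle by (rule dual_ballI)
  moreover have "f x = of_real (vnorm X x)"
  proof -
    have "(Re (f x))\<^sup>2 + (Im (f x))\<^sup>2 \<le> (vnorm X x)\<^sup>2"
      using fle[OF x] norm_nonneg[OF x] by (metis cmod_power2 norm_ge_zero power_mono)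
    moreover have "Re (f x) = vnorm X x" using r(2) unfolding f_def by simp
    ultimately show ?thesis by (simp add: complex_eq_iff)
  qed
  ultimately show "\<exists>f\<in>dual_ball X. f x = of_real (vnorm X x)" by blast
qed

section \<open>Numerical radius and numerical index\<close>

context normed_space_on
begin

lemma op_norm_upper:
  assumes "bounded_linear_on X Y T" "x \<in> vcarrier X" "vnorm X x \<le> 1"
  shows "vnorm Y (T x) \<le> op_norm X Y T"
proof -
  obtain K where K: "\<And>x. x \<in> vcarrier X \<Longrightarrow> vnorm Y (T x) \<le> K * vnorm X x"
    using assms(1) unfolding bounded_linear_on_def by blast
  have "vnorm Y (T x) \<le> \<bar>K\<bar>" if x: "x \<in> vcarrier X" "vnorm X x \<le> 1" for x
  proof -
    have "K * vnorm X x \<le> \<bar>K\<bar> * 1"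
      using x norm_nonneg[OF x(1)] by (intro mult_mono) auto
    then show ?thesis using K[OF x(1)] by simp
  qed
  then have "bdd_above {vnorm Y (T x) | x. x \<in> vcarrier X \<and> vnorm X x \<le> 1}"
    by (intro bdd_aboveI[of _ "\<bar>K\<bar>"]) auto
  then show ?thesis unfolding op_norm_def using assms(2,3) by (intro cSup_upper) auto
qed

lemma op_norm_least:
  assumes "\<And>x. x \<in> vcarrier X \<Longrightarrow> vnorm X x \<le> 1 \<Longrightarrow> vnorm Y (T x) \<le> c"
  shows "op_norm X Y T \<le> c"
  unfolding op_norm_def
  using assms zero_closed norm_vzero by (intro cSup_least) force+

lemma op_norm_gt:
  assumes "c < op_norm X Y T"
  shows "\<exists>x\<in>vcarrier X. vnorm X x \<le> 1 \<and> c < vnorm Y (T x)"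
  using op_norm_least[of Y T c] assms by force

lemma op_norm_bound:
  assumes Y: "normed_space_on Y" and T: "bounded_linear_on X Y T" and x: "x \<in> vcarrier X"
  shows "vnorm Y (T x) \<le> op_norm X Y T * vnorm X x"
proof (cases "vnorm X x = 0")
  case True
  obtain K where "vnorm Y (T x) \<le> K * vnorm X x"
    using T x unfolding bounded_linear_on_def by blast
  then show ?thesis using True by simp
next
  case False
  interpret Y: normed_space_on Y by fact
  define r where "r = vnorm X x"
  have r: "r > 0" using False norm_nonneg[OF x] unfolding r_def by simp
  let ?y = "vscale X (of_real (1 / r)) x"
  have "vnorm Y (T ?y) \<le> op_norm X Y T"
    using r x norm_scale[OF x, of "of_real (1 / r)"]
    by (intro op_norm_upper[OF T]) (auto simp: scale_closed r_def norm_divide)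
  moreover have "T ?y = vscale Y (of_real (1 / r)) (T x)" "T x \<in> vcarrier Y"
    using T x unfolding bounded_linear_on_def by auto
  ultimately have "(1 / r) * vnorm Y (T x) \<le> op_norm X Y T"
    using r by (simp add: Y.norm_scale norm_divide)
  then show ?thesis using r unfolding r_def[symmetric] by (simp add: field_simps)
qed

lemma numerical_states_iff:
  "(x, f) \<in> numerical_states X \<longleftrightarrow>
     x \<in> vcarrier X \<and> vnorm X x = 1 \<and> f \<in> dual_ball X \<and> f x = 1"
proof -
  have S: "normed_space_on (scalar_space :: ('k, 'k) nvs)"
    unfolding scalar_space_def
    by unfold_locales (auto simp: algebra_simps norm_mult norm_triangle_ineq)
  have sel: "vnorm (scalar_space :: ('k, 'k) nvs) = norm" unfolding scalar_space_def by simp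
  show ?thesis
  proof
    assume "(x, f) \<in> numerical_states X"
    then have *: "x \<in> vcarrier X" "vnorm X x = 1" "bounded_linear_on X scalar_space f"
      "op_norm X scalar_space f = 1" "f x = 1"
      unfolding numerical_states_def by auto
    have "f \<in> dual_ball X"
      unfolding dual_ball_def using op_norm_bound[OF S *(3)] *(3,4) by (simp add: sel)
    then show "x \<in> vcarrier X \<and> vnorm X x = 1 \<and> f \<in> dual_ball X \<and> f x = 1" using * by simp
  next
    assume *: "x \<in> vcarrier X \<and> vnorm X x = 1 \<and> f \<in> dual_ball X \<and> f x = 1"
    then have b: "bounded_linear_on X scalar_space f" unfolding dual_ball_def by simp
    have "op_norm X scalar_space f \<le> 1"
      using * dual_ball_le[of f X] by (intro op_norm_least) (force simp: sel)
    moreover have "1 \<le> op_norm X scalar_space f"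
      using op_norm_upper[OF b, of x] * by (simp add: sel)
    ultimately show "(x, f) \<in> numerical_states X"
      using * b unfolding numerical_states_def by simp
  qed
qed

lemma exists_unit_vector:
  assumes "nonzero_space X"
  shows "\<exists>u\<in>vcarrier X. vnorm X u = 1"
proof -
  obtain x where x: "x \<in> vcarrier X" "x \<noteq> vzero X"
    using assms zero_closed unfolding nonzero_space_def by blast
  then have "vnorm X x > 0" using norm_nonneg[of x] norm_eq_0[of x] by simp
  then show ?thesis using x(1)
    by (intro bexI[of _ "vscale X (of_real (1 / vnorm X x)) x"])
      (simp_all add: norm_scale scale_closed norm_divide)
qed

lemma exists_polar_unit_vector:
  assumes "nonzero_space X" "x \<in> vcarrier X"
  shows "\<exists>u\<in>vcarrier X. vnorm X u = 1 \<and> x = vscale X (of_real (vnorm X x)) u"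
proof (cases "x = vzero X")
  case True
  then show ?thesis using exists_unit_vector[OF assms(1)] norm_vzero scale_0 by auto
next
  case False
  then have "vnorm X x > 0" using norm_nonneg[of x] norm_eq_0[of x] assms by simp
  then show ?thesis using assms(2)
    by (intro bexI[of _ "vscale X (of_real (1 / vnorm X x)) x"])
      (simp_all add: norm_scale scale_closed norm_divide scale_scale scale_one flip: of_real_mult)
qed

lemma exists_state:
  assumes "norming_functionals X" "u \<in> vcarrier X" "vnorm X u = 1"
  shows "\<exists>f. (u, f) \<in> numerical_states X"
  using assms unfolding norming_functionals_def numerical_states_iff by force

text \<open>The vector \<open>y\<close> is \<open>x\<close> normalized, or an arbitrary unit vector if \<open>x = 0\<close>.\<close>

lemma exists_norming_pair:
  assumes "norming_functionals X" "nonzero_space X" "x \<in> vcarrier X"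
  shows "\<exists>y f. (y, f) \<in> numerical_states X \<and> f x = of_real (vnorm X x)"
proof -
  obtain u where u: "u \<in> vcarrier X" "vnorm X u = 1" "x = vscale X (of_real (vnorm X x)) u"
    using exists_polar_unit_vector[OF assms(2,3)] by blast
  obtain f where f: "(u, f) \<in> numerical_states X" using exists_state[OF assms(1) u(1,2)] by blast
  then have "f (vscale X (of_real (vnorm X x)) u) = of_real (vnorm X x) * f u" "f u = 1"
    using dual_ball_scale[of f X u] numerical_states_iff by auto
  then show ?thesis using f u(3) by auto
qed

lemma numerical_values_le:
  assumes T: "bounded_linear_on X X T" and s: "(x, f) \<in> numerical_states X"
  shows "norm (f (T x)) \<le> op_norm X X T"
proof -
  have s: "x \<in> vcarrier X" "vnorm X x = 1" "f \<in> dual_ball X" using s numerical_states_iff by auto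
  have "T x \<in> vcarrier X" using T s(1) unfolding bounded_linear_on_def by blast
  then show ?thesis using dual_ball_le[OF s(3)] op_norm_upper[OF T s(1)] s(2) by fastforce
qed

lemma numerical_radius_upper:
  assumes T: "bounded_linear_on X X T" and s: "(x, f) \<in> numerical_states X"
  shows "norm (f (T x)) \<le> numerical_radius X T"
  unfolding numerical_radius_def
  using s numerical_values_le[OF T]
  by (intro cSup_upper) (auto intro!: bdd_aboveI[of _ "op_norm X X T"])

lemma numerical_radius_nonneg:
  assumes "nonzero_space X" "norming_functionals X" "bounded_linear_on X X T"
  shows "0 \<le> numerical_radius X T"
  using exists_unit_vector[OF assms(1)] exists_state[OF assms(2)] numerical_radius_upper[OF assms(3)]
  by (meson norm_ge_zero order_trans)

lemma numerical_radius_least: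
  assumes "nonzero_space X" "norming_functionals X"
    and "\<And>x f. (x, f) \<in> numerical_states X \<Longrightarrow> norm (f (T x)) \<le> c"
  shows "numerical_radius X T \<le> c"
proof -
  have "{norm (f (T x)) | x f. (x, f) \<in> numerical_states X} \<noteq> {}"
    using exists_unit_vector[OF assms(1)] exists_state[OF assms(2)] by blast
  then show ?thesis unfolding numerical_radius_def using assms(3) by (intro cSup_least) auto
qed

lemma numerical_index_lower:
  assumes X: "nonzero_space X" "norming_functionals X"
    and T: "bounded_linear_on X X T" "op_norm X X T = 1"
  shows "numerical_index X \<le> numerical_radius X T"
  unfolding numerical_index_def
  using T numerical_radius_nonneg[OF X] by (intro cInf_lower) (auto intro!: bdd_belowI[of _ 0])

lemma numerical_index_greatest:
  assumes X: "nonzero_space X"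
    and c: "\<And>T. bounded_linear_on X X T \<Longrightarrow> op_norm X X T = 1 \<Longrightarrow> c \<le> numerical_radius X T"
  shows "c \<le> numerical_index X"
proof -
  obtain u where u: "u \<in> vcarrier X" "vnorm X u = 1" using exists_unit_vector[OF X] by blast
  have id: "bounded_linear_on X X (\<lambda>x. x)"
    unfolding bounded_linear_on_def by (auto intro!: exI[of _ 1])
  have "op_norm X X (\<lambda>x. x) = 1"
    using op_norm_upper[OF id u(1)] u(2) op_norm_least[of X "\<lambda>x. x" 1] by (simp add: antisym)
  then have "{numerical_radius X T | T. bounded_linear_on X X T \<and> op_norm X X T = 1} \<noteq> {}"
    using id by blast
  then show ?thesis unfolding numerical_index_def using c by (intro cInf_greatest) auto
qed

lemma numerical_index_nonneg:
  assumes X: "nonzero_space X" "norming_functionals X"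
  shows "0 \<le> numerical_index X"
  using numerical_index_greatest[OF X(1)] numerical_radius_nonneg[OF X] by blast

lemma bounded_linear_on_scale:
  assumes "bounded_linear_on X X T"
  shows "bounded_linear_on X X (\<lambda>x. vscale X c (T x))"
proof -
  obtain K where K: "\<forall>x\<in>vcarrier X. vnorm X (T x) \<le> K * vnorm X x"
    using assms unfolding bounded_linear_on_def by blast
  have "\<forall>x\<in>vcarrier X. vnorm X (vscale X c (T x)) \<le> (norm c * K) * vnorm X x"
    using K assms unfolding bounded_linear_on_def
    by (auto simp: norm_scale mult_left_mono mult.assoc)
  then have "\<exists>K. \<forall>x\<in>vcarrier X. vnorm X (vscale X c (T x)) \<le> K * vnorm X x" by blast
  then show ?thesis using assms unfolding bounded_linear_on_def
    by (simp add: scale_closed scale_add scale_scale mult.commute[of c])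
qed

lemma numerical_index_attained:
  assumes X: "nonzero_space X" "norming_functionals X"
    and T: "bounded_linear_on X X T" and pos: "0 < op_norm X X T" and c: "c < numerical_index X"
  shows "\<exists>x f. (x, f) \<in> numerical_states X \<and> c * op_norm X X T < norm (f (T x))"
proof (rule ccontr)
  assume contra: "\<not> ?thesis"
  define K where "K = op_norm X X T"
  define S where "S x = vscale X (of_real (1 / K)) (T x)" for x
  have K: "K > 0" using pos unfolding K_def .
  have Tc: "T x \<in> vcarrier X" if "x \<in> vcarrier X" for x
    using T that unfolding bounded_linear_on_def by blast
  have S: "bounded_linear_on X X S" unfolding S_def by (rule bounded_linear_on_scale[OF T])
  have nS: "vnorm X (S x) = vnorm X (T x) / K" if "x \<in> vcarrier X" for x
    unfolding S_def using Tc[OF that] K by (simp add: norm_scale norm_divide)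
  have "op_norm X X S = 1"
  proof (rule antisym)
    show "op_norm X X S \<le> 1"
      using op_norm_upper[OF T] K by (intro op_norm_least) (simp add: nS K_def)
    have "op_norm X X T \<le> K * op_norm X X S"
      using op_norm_upper[OF S] K by (intro op_norm_least) (simp add: nS field_simps)
    then show "1 \<le> op_norm X X S" using K unfolding K_def by simp
  qed
  then have "numerical_index X \<le> numerical_radius X S" using numerical_index_lower[OF X S] by simp
  also have "numerical_radius X S \<le> c"
  proof (rule numerical_radius_least[OF X])
    fix x f assume s: "(x, f) \<in> numerical_states X"
    then have *: "x \<in> vcarrier X" "f \<in> dual_ball X" using numerical_states_iff by auto
    have "norm (f (T x)) \<le> c * K" using contra s unfolding K_def by force
    then show "norm (f (S x)) \<le> c" unfolding S_def
      using dual_ball_scale[OF *(2) Tc[OF *(1)]] K by (simp add: norm_mult norm_divide field_simps)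
  qed
  finally show False using c by simp
qed

text \<open>Norming functionals show that the numerical radius \<open>v\<close> of \<open>T\<close> bounds \<open>I - \<alpha>T\<close> from below by
  \<open>1 - \<alpha>v\<close>, so that \<open>(1 - \<alpha>v) \<parallel>I + \<alpha>T\<parallel> \<le> \<parallel>I - \<alpha>\<^sup>2T\<^sup>2\<parallel> \<le> 1 + \<alpha>\<^sup>2\<close>.  If \<open>f z\<close> is close to one and \<open>f (T z)\<close> is
  made nonnegative by a rotation of \<open>T\<close>, then \<open>\<parallel>I + \<alpha>T\<parallel>\<close> is at least \<open>1 + \<alpha> \<bar>f (T z)\<bar> - \<eta>\<close>.\<close>

lemma numerical_radius_approximate_states:
  assumes X: "nonzero_space X" "norming_functionals X"
    and T: "bounded_linear_on X X T" "op_norm X X T \<le> 1"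
    and z: "z \<in> vcarrier X" "vnorm X z \<le> 1" and f: "f \<in> dual_ball X"
    and eta: "norm (f z - 1) \<le> \<eta>" and \<alpha>: "0 < \<alpha>" "\<alpha> < 1"
  shows "norm (f (T z)) \<le> (\<alpha> + numerical_radius X T) / (1 - \<alpha> * numerical_radius X T) + \<eta> / \<alpha>"
proof -
  define v where "v = numerical_radius X T"
  have Tc: "T x \<in> vcarrier X" if "x \<in> vcarrier X" for x
    using T that unfolding bounded_linear_on_def by blast
  have Tle: "vnorm X (T x) \<le> vnorm X x" if "x \<in> vcarrier X" for x
    using op_norm_bound[OF normed_space_on_axioms T(1) that]
      mult_right_mono[OF T(2) norm_nonneg[OF that]] by simp
  have v0: "0 \<le> v" unfolding v_def by (rule numerical_radius_nonneg[OF X T(1)])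
  have v1: "v \<le> 1" unfolding v_def
    using numerical_values_le[OF T(1)] T(2) by (intro numerical_radius_least[OF X]) force
  have av: "0 < 1 - \<alpha> * v" using v0 v1 \<alpha> by (smt (verit) mult_left_le)
  have below: "(1 - \<alpha> * v) * vnorm X y \<le> vnorm X (vadd X y (vscale X (- (of_real \<alpha> * c)) (T y)))"
    if y: "y \<in> vcarrier X" and c: "norm c = 1" for y c
  proof -
    obtain u g where u: "(u, g) \<in> numerical_states X" "u \<in> vcarrier X" "y = vscale X (of_real (vnorm X y)) u"
      using exists_polar_unit_vector[OF X(1) y] exists_state[OF X(2)] by blast
    have g: "g \<in> dual_ball X" "g u = 1" using u(1) numerical_states_iff by auto
    have "g (vscale X (of_real (vnorm X y)) u) = of_real (vnorm X y)"
      using dual_ball_scale[OF g(1) u(2), of "of_real (vnorm X y)"] g(2) by simp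
    then have gy: "g y = of_real (vnorm X y)" using u(3) by simp
    have "T (vscale X (of_real (vnorm X y)) u) = vscale X (of_real (vnorm X y)) (T u)"
      using T(1) u(2) unfolding bounded_linear_on_def by blast
    then have Ty: "T y = vscale X (of_real (vnorm X y)) (T u)" using u(3) by simp
    have "g (T y) = of_real (vnorm X y) * g (T u)"
      using dual_ball_scale[OF g(1) Tc[OF u(2)]] Ty by simp
    then have "norm (g (T y)) = vnorm X y * norm (g (T u))"
      using norm_nonneg[OF y] by (simp add: norm_mult)
    also have "\<dots> \<le> vnorm X y * v"
      unfolding v_def using numerical_radius_upper[OF T(1) u(1)] norm_nonneg[OF y] by (rule mult_left_mono)
    finally have gTy: "norm (g (T y)) \<le> vnorm X y * v" .
    let ?w = "vadd X y (vscale X (- (of_real \<alpha> * c)) (T y))"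
    have "g ?w = g y - of_real \<alpha> * c * g (T y)"
      using dual_ball_add[OF g(1) y scale_closed[OF Tc[OF y]]] dual_ball_scale[OF g(1) Tc[OF y]] by simp
    then have "norm (g y) - norm (of_real \<alpha> * c * g (T y)) \<le> norm (g ?w)"
      using norm_triangle_ineq2[of "g y" "of_real \<alpha> * c * g (T y)"] by simp
    moreover have "norm (of_real \<alpha> * c * g (T y)) \<le> \<alpha> * (vnorm X y * v)"
      using gTy c \<alpha> by (simp add: norm_mult)
    moreover have "norm (g y) = vnorm X y" using gy norm_nonneg[OF y] by simp
    moreover have "norm (g ?w) \<le> vnorm X ?w"
      by (intro dual_ball_le[OF g(1)] add_closed y scale_closed Tc)
    moreover have "(1 - \<alpha> * v) * vnorm X y = vnorm X y - \<alpha> * (vnorm X y * v)"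
      by (simp add: algebra_simps)
    ultimately show ?thesis by linarith
  qed
  \<comment> \<open>a rotation of \<open>T\<close> that makes \<open>f (T z)\<close> a nonnegative real\<close>
  define w where "w = norm (f (T z))"
  define c where "c = (if f (T z) = 0 then 1 else of_real w / f (T z))"
  have c: "norm c = 1" "c * f (T z) = of_real w" unfolding c_def w_def by (auto simp: norm_divide)
  let ?a = "of_real \<alpha> * c"
  let ?y = "vadd X z (vscale X ?a (T z))"
  have yc: "?y \<in> vcarrier X" using z(1) Tc scale_closed add_closed by simp
  have Tz2: "T (T z) \<in> vcarrier X" using z(1) Tc by simp
  have "vadd X ?y (vscale X (- ?a) (T ?y)) = vadd X z (vscale X (- (?a * ?a)) (T (T z)))"
  proof -
    have "T ?y = vadd X (T z) (vscale X ?a (T (T z)))"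
      using T(1) z(1) Tc[OF z(1)] scale_closed[OF Tc[OF z(1)]] unfolding bounded_linear_on_def by simp
    then have "vscale X (- ?a) (T ?y) = vadd X (vscale X (- ?a) (T z)) (vscale X (- (?a * ?a)) (T (T z)))"
      using z(1) Tc scale_closed by (simp add: scale_add scale_scale)
    moreover have "vadd X (vscale X ?a (T z)) (vscale X (- ?a) (T z)) = vzero X"
      using add_scale[OF Tc[OF z(1)], of ?a "- ?a"] scale_0[OF Tc[OF z(1)]] by simp
    moreover have "vadd X (vadd X z A) (vadd X B C) = vadd X z (vadd X (vadd X A B) C)"
      if "A \<in> vcarrier X" "B \<in> vcarrier X" "C \<in> vcarrier X" for A B C
      using z(1) that by (simp add: add_assoc add_closed)
    ultimately show ?thesis
      using Tc[OF z(1)] Tz2 by (simp add: scale_closed zero_add)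
  qed
  then have "(1 - \<alpha> * v) * vnorm X ?y \<le> vnorm X (vadd X z (vscale X (- (?a * ?a)) (T (T z))))"
    using below[OF yc c(1)] by simp
  also have "\<dots> \<le> 1 + \<alpha>\<^sup>2"
  proof -
    have "vnorm X (T (T z)) \<le> 1" using Tle[OF Tc[OF z(1)]] Tle[OF z(1)] z(2) by simp
    then have "vnorm X (vscale X (- (?a * ?a)) (T (T z))) \<le> \<alpha>\<^sup>2"
      using Tz2 c \<alpha> by (simp add: norm_scale norm_mult power2_eq_square mult_left_le)
    then show ?thesis using norm_triangle[OF z(1) scale_closed[OF Tz2], of "- (?a * ?a)"] z(2) by simp
  qed
  finally have ny: "vnorm X ?y \<le> (1 + \<alpha>\<^sup>2) / (1 - \<alpha> * v)" using av by (simp add: field_simps)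
  have "f ?y = f z + of_real (\<alpha> * w)"
    using dual_ball_add[OF f z(1) scale_closed[OF Tc[OF z(1)]]] dual_ball_scale[OF f Tc[OF z(1)]] c(2)
    by (simp add: mult.assoc)
  then have "f ?y = of_real (1 + \<alpha> * w) + (f z - 1)" by simp
  moreover have "norm (of_real (1 + \<alpha> * w) :: 'k) = 1 + \<alpha> * w"
    using \<alpha> unfolding w_def by (subst norm_of_real) simp
  ultimately have "1 + \<alpha> * w - \<eta> \<le> norm (f ?y)"
    using norm_diff_ineq[of "of_real (1 + \<alpha> * w)" "f z - 1"] eta by simp
  then have "1 + \<alpha> * w - \<eta> \<le> (1 + \<alpha>\<^sup>2) / (1 - \<alpha> * v)"
    using dual_ball_le[OF f yc] ny by simp
  also have "\<dots> = 1 + \<alpha> * ((\<alpha> + v) / (1 - \<alpha> * v))"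
    using av by (simp add: field_simps power2_eq_square)
  finally have "\<alpha> * w \<le> \<alpha> * ((\<alpha> + v) / (1 - \<alpha> * v)) + \<eta>" by simp
  then have "w \<le> (\<alpha> + v) / (1 - \<alpha> * v) + \<eta> / \<alpha>" using \<alpha>(1) by (simp add: field_simps)
  then show ?thesis unfolding w_def v_def .
qed

end

section \<open>Small slices\<close>

text \<open>Let \<open>p\<close> nearly maximize \<open>R g + 1/2 \<Sum> (\<phi> i)\<^sup>2\<close> over \<open>B\<close>.  The linear functional
  \<open>R g + \<Sum> \<phi> i p \<cdot> \<phi> i\<close> falls short of this function by \<open>1/2 \<Sum> (\<phi> i x)\<^sup>2 - \<Sum> \<phi> i p \<cdot> \<phi> i x\<close>, which
  is up to a constant \<open>1/2 \<Sum> (\<phi> i x - \<phi> i p)\<^sup>2\<close>.  So the points where it is almost as large as at \<open>p\<close> have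
  values \<open>\<phi> i\<close> close to those of \<open>p\<close>.  A large \<open>R\<close> keeps these points inside the given slice.  The set \<open>B\<close>
  will be a unit ball, with coordinates for the \<open>\<phi> i\<close>, or a dual unit ball, with evaluations.\<close>

lemma subslice_with_small_oscillation:
  fixes g :: "'b \<Rightarrow> real" and \<phi> :: "'j \<Rightarrow> 'b \<Rightarrow> real"
  assumes J: "finite J" and w: "w \<in> B" "g w > s" and d: "0 < d"
    and bg: "\<And>x. x \<in> B \<Longrightarrow> g x \<le> K"
    and b\<phi>: "\<And>x i. x \<in> B \<Longrightarrow> i \<in> J \<Longrightarrow> \<bar>\<phi> i x\<bar> \<le> K"
  shows "\<exists>R c s' p. p \<in> B \<and> R * g p + (\<Sum>i\<in>J. c i * \<phi> i p) > s' \<and>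
     (\<forall>x\<in>B. R * g x + (\<Sum>i\<in>J. c i * \<phi> i x) > s' \<longrightarrow> g x > s \<and> (\<forall>i\<in>J. \<bar>\<phi> i x - \<phi> i p\<bar> \<le> d))"
proof -
  define Q where "Q x = (\<Sum>i\<in>J. (\<phi> i x)\<^sup>2)" for x
  define C where "C = real (card J) * K\<^sup>2"
  have Q0: "0 \<le> Q x" for x unfolding Q_def by (intro sum_nonneg) simp
  have QC: "Q x \<le> C" if "x \<in> B" for x
  proof -
    have "(\<phi> i x)\<^sup>2 \<le> K\<^sup>2" if i: "i \<in> J" for i
      using b\<phi>[OF \<open>x \<in> B\<close> i] by (metis abs_ge_zero power2_abs power_mono)
    then show ?thesis unfolding Q_def C_def using sum_bounded_above[of J "\<lambda>i. (\<phi> i x)\<^sup>2" "K\<^sup>2"] by simp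
  qed
  define e where "e = d\<^sup>2 / 4"
  have e: "e > 0" using d unfolding e_def by simp
  define R where "R = (2 * C + 2 * e) / (g w - s) + 1"
  have C0: "0 \<le> C" unfolding C_def by simp
  have R: "R > 0" unfolding R_def using w C0 e by (simp add: add_nonneg_pos)
  have "R * (g w - s) = 2 * C + 2 * e + (g w - s)"
    unfolding R_def using w(2) by (simp only: distrib_right) simp
  then have Rs: "2 * C + 2 * e < R * (g w - s)" using w(2) by simp
  define H where "H x = R * g x + Q x / 2" for x
  have Hb: "H x \<le> R * K + C / 2" if "x \<in> B" for x
    using bg[OF that] QC[OF that] R unfolding H_def by (simp add: add_mono)
  have bdd: "bdd_above (H ` B)" using Hb by (intro bdd_aboveI2)
  have "Sup (H ` B) - e < Sup (H ` B)" using e by simp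
  then obtain p where p: "p \<in> B" "Sup (H ` B) - e < H p"
    using less_cSup_iff[OF _ bdd, of "Sup (H ` B) - e"] w(1) by auto
  have Hp: "H x < H p + e" if "x \<in> B" for x
    using cSup_upper[OF imageI[OF that] bdd] p(2) by simp
  define G where "G x = R * g x + (\<Sum>i\<in>J. \<phi> i p * \<phi> i x)" for x
  have Gp: "G p = R * g p + Q p" unfolding G_def Q_def by (simp add: power2_eq_square)
  have *: "g x > s \<and> (\<forall>i\<in>J. \<bar>\<phi> i x - \<phi> i p\<bar> \<le> d)" if x: "x \<in> B" and Gx: "G x > G p - e" for x
  proof -
    have sq: "(\<Sum>i\<in>J. (\<phi> i x - \<phi> i p)\<^sup>2) = Q x + Q p - 2 * (\<Sum>i\<in>J. \<phi> i p * \<phi> i x)"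
      unfolding Q_def sum_distrib_left sum.distrib[symmetric] sum_subtractf[symmetric]
      by (intro sum.cong) (auto simp: power2_eq_square algebra_simps)
    have "(\<Sum>i\<in>J. (\<phi> i x - \<phi> i p)\<^sup>2) \<le> 4 * e"
      using Gx Hp[OF x] sq Gp unfolding G_def H_def by simp
    then have "(\<phi> i x - \<phi> i p)\<^sup>2 \<le> d\<^sup>2" if "i \<in> J" for i
      using member_le_sum[OF that, of "\<lambda>i. (\<phi> i x - \<phi> i p)\<^sup>2"] J unfolding e_def by simp
    then have 1: "\<forall>i\<in>J. \<bar>\<phi> i x - \<phi> i p\<bar> \<le> d" using d abs_le_square_iff[of _ d] by auto
    have "0 \<le> (\<Sum>i\<in>J. (\<phi> i x - \<phi> i p)\<^sup>2)" by (intro sum_nonneg) simp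
    then have "2 * (\<Sum>i\<in>J. \<phi> i p * \<phi> i x) \<le> Q x + Q p" using sq by simp
    then have "R * g p - R * g x < e + C"
      using Gx Gp QC[OF x] QC[OF p(1)] Q0[of p] unfolding G_def by argo
    moreover have "R * g w - R * g p < e + C / 2"
      using Hp[OF w(1)] QC[OF p(1)] Q0[of w] unfolding H_def by simp
    ultimately have "R * (g w - s) - R * (g x - s) < R * (g w - s)"
      using Rs C0 by (simp add: algebra_simps)
    then have "R * (g x - s) > 0" by simp
    then show ?thesis using 1 R by (simp add: zero_less_mult_iff)
  qed
  show ?thesis
    by (rule exI[of _ R], rule exI[of _ "\<lambda>i. \<phi> i p"], rule exI[of _ "G p - e"], rule exI[of _ p])
      (use * p(1) e in \<open>auto simp: G_def\<close>)
qed

lemma sign_sums_concentrate: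
  fixes t :: "'j \<Rightarrow> real"
  assumes F: "finite F" and c: "c > 0"
    and s: "\<And>\<theta>. (\<forall>i. \<theta> i \<in> {-1, 1}) \<Longrightarrow> c \<le> \<bar>\<Sum>i\<in>F. \<theta> i * t i\<bar>"
  shows "\<exists>i\<in>F. c \<le> \<bar>t i\<bar>"
proof (rule ccontr)
  assume "\<not> ?thesis"
  then have small: "\<bar>t i\<bar> < c" if "i \<in> F" for i using that by force
  \<comment> \<open>Flipping the signs one after the other leads from \<open>\<Sum>\<bar>t i\<bar>\<close> to its negative in steps shorter
    than \<open>2 * c\<close>, so the gap between \<open>- c\<close> and \<open>c\<close> cannot be jumped over.\<close>
  define S where "S A = (\<Sum>i\<in>F. (if i \<in> A then - 1 else 1) * (sgn (t i) * t i))" for A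
  have S: "c \<le> \<bar>S A\<bar>" for A
  proof -
    define \<theta> where "\<theta> i = (if i \<in> A then - 1 else 1) * (if t i < 0 then - 1 else 1 :: real)" for i
    have "S A = (\<Sum>i\<in>F. \<theta> i * t i)"
      unfolding S_def \<theta>_def by (intro sum.cong) (auto simp: sgn_if)
    then show ?thesis using s[of \<theta>] unfolding \<theta>_def by auto
  qed
  have "0 < S A" if "A \<subseteq> F" for A
    using finite_subset[OF that F] that
  proof (induction A rule: finite_induct)
    case empty
    have "0 \<le> S {}" unfolding S_def by (intro sum_nonneg) (simp add: sgn_if)
    then show ?case using S[of "{}"] c by simp
  next
    case (insert a A)
    then have a: "a \<in> F" "a \<notin> A" by auto
    have "S A - S (insert a A) = (\<Sum>i\<in>F. if i = a then 2 * \<bar>t a\<bar> else 0)"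
      unfolding S_def sum_subtractf[symmetric] using a(2)
      by (intro sum.cong) (auto simp: sgn_if)
    then have "S A - S (insert a A) = 2 * \<bar>t a\<bar>" using F a by simp
    then have "S A - S (insert a A) < 2 * c" using small[OF a(1)] by simp
    moreover have "c \<le> S A" using insert S[of A] by simp
    ultimately show ?case using S[of "insert a A"] by simp
  qed
  from this[of F] have "0 < S F" by simp
  moreover have "S F \<le> 0" unfolding S_def by (intro sum_nonpos) (simp add: sgn_if)
  ultimately show False by simp
qed

definition ball_slice :: "(real, 'c) nvs \<Rightarrow> ('c \<Rightarrow> real) \<Rightarrow> real \<Rightarrow> 'c set" where
  "ball_slice X g s = {x \<in> vcarrier X. vnorm X x \<le> 1 \<and> s < g x}"

text \<open>This is the form in which \<open>n(E) = 1\<close> enters the lower estimate.  The levels \<open>s\<close> and \<open>s'\<close> are nonnegative so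
  that neither slice contains zero.\<close>

definition slices_in_duality :: "(real, 'c) nvs \<Rightarrow> bool" where
  "slices_in_duality X \<longleftrightarrow> (\<forall>g v s s'. bounded_linear_on X scalar_space g \<and> 0 \<le> s \<and> 0 \<le> s' \<and>
     ball_slice X g s \<noteq> {} \<and> v \<in> vcarrier X \<and> (\<exists>f\<in>dual_ball X. s' < f v) \<longrightarrow>
     (\<exists>x\<in>ball_slice X g s. \<exists>f\<in>dual_ball X. s' < f v \<and> \<bar>f x\<bar> = 1))"

text \<open>The rank-one operator \<open>x \<mapsto> g x \<cdot> v\<close> has norm \<open>\<parallel>g\<parallel> \<parallel>v\<parallel>\<close>.  If the numerical index is one, some state
  \<open>(x, f)\<close> makes \<open>\<bar>g x\<bar> \<bar>f v\<bar>\<close> almost that large, so both factors are almost maximal; a change of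
  sign of \<open>x\<close> and of \<open>f\<close> moves them into the two slices.\<close>

lemma numerical_index_1_slices_in_duality:
  fixes X :: "(real, 'c) nvs"
  assumes X: "normed_space_on X" "nonzero_space X" and n: "numerical_index X = 1"
  shows "slices_in_duality X"
  unfolding slices_in_duality_def
proof (intro allI impI, elim conjE bexE)
  fix g v s s' f0
  assume g: "bounded_linear_on X scalar_space g" and s: "0 \<le> s" and s': "0 \<le> s'"
    and ne: "ball_slice X g s \<noteq> {}" and v: "v \<in> vcarrier X" and f0: "f0 \<in> dual_ball X" "s' < f0 v"
  obtain x0 where x0: "x0 \<in> vcarrier X" "vnorm X x0 \<le> 1" "s < g x0"
    using ne unfolding ball_slice_def by auto
  interpret normed_space_on X by fact
  have nf: "norming_functionals X" by (rule norming_functionals_real[OF X(1)])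
  have sc: "vnorm (scalar_space :: (real, real) nvs) = abs"
    "vadd (scalar_space :: (real, real) nvs) = (+)" "vscale (scalar_space :: (real, real) nvs) = (*)"
    unfolding scalar_space_def by auto
  have gadd: "g (vadd X a b) = g a + g b" if "a \<in> vcarrier X" "b \<in> vcarrier X" for a b
    using g that unfolding bounded_linear_on_def sc by blast
  have gsc: "g (vscale X c a) = c * g a" if "a \<in> vcarrier X" for a c
    using g that unfolding bounded_linear_on_def sc by blast
  define T where "T x = vscale X (g x) v" for x
  obtain K where K: "\<forall>x\<in>vcarrier X. \<bar>g x\<bar> \<le> K * vnorm X x"
    using g unfolding bounded_linear_on_def sc by blast
  have nT: "vnorm X (T x) = \<bar>g x\<bar> * vnorm X v" for x unfolding T_def using v by (simp add: norm_scale)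
  have "\<forall>x\<in>vcarrier X. vnorm X (T x) \<le> (K * vnorm X v) * vnorm X x"
    using mult_right_mono[OF bspec[OF K] norm_nonneg[OF v]] by (simp add: nT mult.assoc mult.commute[of "vnorm X v"])
  then have "\<exists>K. \<forall>x\<in>vcarrier X. vnorm X (T x) \<le> K * vnorm X x" by blast
  then have T: "bounded_linear_on X X T"
    unfolding bounded_linear_on_def T_def using v
    by (simp add: gadd gsc scale_closed add_scale scale_scale)
  define M where "M = op_norm X scalar_space g"
  have gM: "\<bar>g x\<bar> \<le> M" if "x \<in> vcarrier X" "vnorm X x \<le> 1" for x
    using op_norm_upper[OF g that] unfolding M_def sc .
  have M: "s < M" using gM[OF x0(1,2)] x0(3) by simp
  have nv: "s' < vnorm X v" using dual_ball_le[OF f0(1) v] f0(2) by simp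
  have pos: "0 < M" "0 < vnorm X v" using M nv s s' by auto
  have op: "M * vnorm X v \<le> op_norm X X T"
  proof -
    have "M \<le> op_norm X X T / vnorm X v"
      unfolding M_def
    proof (rule op_norm_least)
      fix x assume "x \<in> vcarrier X" "vnorm X x \<le> 1"
      then have "vnorm X (T x) \<le> op_norm X X T" by (rule op_norm_upper[OF T])
      then show "vnorm scalar_space (g x) \<le> op_norm X X T / vnorm X v"
        using pos by (simp add: nT sc field_simps)
    qed
    then show ?thesis using pos by (simp add: field_simps)
  qed
  \<comment> \<open>The product \<open>\<bar>g x\<bar> \<bar>f v\<bar>\<close> exceeds \<open>c\<close> times its upper bound, hence so does each factor.\<close>
  define c where "c = max (s / M) (s' / vnorm X v)"
  have c: "c < 1" "0 \<le> c" unfolding c_def using M nv pos s s' by (auto simp: le_max_iff_disj)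
  have "0 < op_norm X X T" using op mult_pos_pos[OF pos] by linarith
  then obtain x f where xf: "(x, f) \<in> numerical_states X" "c * op_norm X X T < norm (f (T x))"
    using numerical_index_attained[OF X(2) nf T _ c(1)[folded n]] by blast
  have x: "x \<in> vcarrier X" "vnorm X x = 1" and f: "f \<in> dual_ball X" "f x = 1"
    using xf(1) numerical_states_iff by auto
  have prod: "c * (M * vnorm X v) < \<bar>g x\<bar> * \<bar>f v\<bar>"
    using xf(2) mult_left_mono[OF op c(2)] dual_ball_scale[OF f(1) v] unfolding T_def
    by (simp add: abs_mult)
  have fv: "\<bar>f v\<bar> \<le> vnorm X v" using dual_ball_le[OF f(1) v] by simp
  have gx: "\<bar>g x\<bar> \<le> M" using gM x by simp
  have "s < \<bar>g x\<bar>"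
  proof -
    have "s * vnorm X v \<le> c * (M * vnorm X v)" unfolding c_def using pos by (simp add: field_simps max_def)
    also have "\<dots> < \<bar>g x\<bar> * vnorm X v" using prod mult_left_mono[OF fv, of "\<bar>g x\<bar>"] by simp
    finally show ?thesis using pos by simp
  qed
  moreover have "s' < \<bar>f v\<bar>"
  proof -
    have "M * s' \<le> c * (M * vnorm X v)" unfolding c_def using pos by (simp add: field_simps max_def)
    also have "\<dots> < M * \<bar>f v\<bar>" using prod mult_right_mono[OF gx, of "\<bar>f v\<bar>"] by simp
    finally show ?thesis using pos by simp
  qed
  ultimately have sg: "s < \<bar>g x\<bar>" "s' < \<bar>f v\<bar>" by auto
  define x' where "x' = vscale X (sgn (g x)) x"
  define f' where "f' = (\<lambda>y. sgn (f v) * f y)"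
  have ns: "sgn (g x) \<in> {-1, 1}" "sgn (f v) \<in> {-1, 1}" using sg s s' by (auto simp: sgn_if)
  have "x' \<in> vcarrier X" "vnorm X x' \<le> 1" "g x' = \<bar>g x\<bar>"
    unfolding x'_def using x ns by (auto simp: scale_closed norm_scale gsc sgn_mult_self_eq abs_sgn mult.commute)
  moreover have "f' \<in> dual_ball X"
    unfolding f'_def using ns dual_ball_le[OF f(1)]
    by (intro dual_ballI) (auto simp: dual_ball_add[OF f(1)] dual_ball_scale[OF f(1)])
  moreover have "f' v = \<bar>f v\<bar>" unfolding f'_def by (simp add: abs_sgn mult.commute)
  moreover have "\<bar>f' x'\<bar> = 1"
    unfolding f'_def x'_def using ns f(2) x(1) dual_ball_scale[OF f(1) x(1)] by auto
  ultimately have "x' \<in> ball_slice X g s" "f' \<in> dual_ball X" "s' < f' v \<and> \<bar>f' x'\<bar> = 1"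
    using sg unfolding ball_slice_def by auto
  then show "\<exists>x\<in>ball_slice X g s. \<exists>f\<in>dual_ball X. s' < f v \<and> \<bar>f x\<bar> = 1" by blast
qed

section \<open>Absolute norms\<close>

lemma coord_space_sel [simp]:
  "vcarrier (coord_space E N) = E" "vadd (coord_space E N) = (\<lambda>a b i. a i + b i)"
  "vzero (coord_space E N) = (\<lambda>i. 0)" "vscale (coord_space E N) = (\<lambda>c a i. c * a i)"
  "vnorm (coord_space E N) = N"
  unfolding coord_space_def by auto

lemma scalar_space_sel [simp]:
  "vcarrier scalar_space = UNIV" "vadd scalar_space = (+)" "vscale scalar_space = (*)"
  "vnorm scalar_space = norm"
  unfolding scalar_space_def by auto

definition restr :: "'i set \<Rightarrow> ('i \<Rightarrow> real) \<Rightarrow> 'i \<Rightarrow> real" where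
  "restr F a = (\<lambda>i. if i \<in> F then a i else 0)"

text \<open>Completeness is stated for Cauchy sequences in \<open>E\<close>, because the locale of metric spaces asks for a
  distance that is nonnegative and symmetric on the whole type, whereas \<open>N\<close> is arbitrary outside \<open>E\<close>.\<close>

locale absolute_space =
  fixes E :: "('i \<Rightarrow> real) set" and N :: "('i \<Rightarrow> real) \<Rightarrow> real"
  assumes normed: "normed_space_on (coord_space E N)"
    and sign: "a \<in> E \<Longrightarrow> (\<And>i. \<bar>a i\<bar> = \<bar>b i\<bar>) \<Longrightarrow> b \<in> E"
    and N_sign: "a \<in> E \<Longrightarrow> (\<And>i. \<bar>a i\<bar> = \<bar>b i\<bar>) \<Longrightarrow> N b = N a"
    and indicator: "indicator {i} \<in> E" "N (indicator {i}) = 1"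
    and complete_limit: "(\<And>k. \<sigma> k \<in> E) \<Longrightarrow>
      (\<And>\<epsilon>. \<epsilon> > 0 \<Longrightarrow> \<exists>n0. \<forall>n\<ge>n0. \<forall>m\<ge>n0. N (\<lambda>i. \<sigma> n i - \<sigma> m i) < \<epsilon>) \<Longrightarrow>
      \<exists>a\<in>E. (\<lambda>k. N (\<lambda>i. \<sigma> k i - a i)) \<longlonglongrightarrow> 0"
begin

abbreviation C where "C \<equiv> coord_space E N"

sublocale C: normed_space_on C
  by (rule normed)

lemma zero: "(\<lambda>i. 0) \<in> E"
  and add: "a \<in> E \<Longrightarrow> b \<in> E \<Longrightarrow> (\<lambda>i. a i + b i) \<in> E"
  and scale: "a \<in> E \<Longrightarrow> (\<lambda>i. c * a i) \<in> E"
  and N_scale: "a \<in> E \<Longrightarrow> N (\<lambda>i. c * a i) = \<bar>c\<bar> * N a"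
  and N_triangle: "a \<in> E \<Longrightarrow> b \<in> E \<Longrightarrow> N (\<lambda>i. a i + b i) \<le> N a + N b"
  and N_zero: "N (\<lambda>i. 0) = 0"
  and N_nonneg: "a \<in> E \<Longrightarrow> 0 \<le> N a"
  using C.zero_closed C.add_closed C.scale_closed C.norm_scale C.norm_triangle C.norm_vzero
    C.norm_nonneg by auto

lemma diff: "a \<in> E \<Longrightarrow> b \<in> E \<Longrightarrow> (\<lambda>i. a i - b i) \<in> E"
  using add[of a "\<lambda>i. (-1) * b i"] scale[of b "-1"] by simp

lemma N_diff_commute: "a \<in> E \<Longrightarrow> b \<in> E \<Longrightarrow> N (\<lambda>i. a i - b i) = N (\<lambda>i. b i - a i)"
  using N_scale[OF diff[of a b], of "-1"] by simp

lemma N_triangle_diff: "a \<in> E \<Longrightarrow> b \<in> E \<Longrightarrow> N a \<le> N b + N (\<lambda>i. a i - b i)"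
  using N_triangle[of b "\<lambda>i. a i - b i"] diff[of a b] by simp

text \<open>Flipping all signs but one and averaging isolates the coordinate \<open>i\<close>.\<close>

lemma coordinate_le:
  assumes a: "a \<in> E"
  shows "\<bar>a i\<bar> \<le> N a"
proof -
  define b where "b j = (if j = i then a j else - a j)" for j
  have b: "b \<in> E" "N b = N a"
    using sign[OF a, of b] N_sign[OF a, of b] by (auto simp: b_def)
  have "(\<lambda>j. a j + b j) = (\<lambda>j. (2 * a i) * indicator {i} j)"
    by (auto simp: b_def indicator_def)
  then have "N (\<lambda>j. a j + b j) = 2 * \<bar>a i\<bar>"
    using N_scale[OF indicator(1)[of i], of "2 * a i"] indicator(2)[of i] by simp
  then show ?thesis using N_triangle[OF a b(1)] b(2) by simp
qed

text \<open>A vector dominated by \<open>b\<close> is the sum \<open>\<Sum> t k / 2 ^ (k + 1)\<close> of vectors \<open>t k\<close> that differ from \<open>b\<close> by signs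
  only, and the series converges by completeness: the remainders \<open>r (Suc k) = 2 * r k - t k\<close> stay dominated by \<open>b\<close> if
  \<open>t k\<close> is \<open>b\<close> with the signs of \<open>r k\<close>.\<close>

lemma dominated_mem_and_norm_le:
  assumes b: "b \<in> E" and ab: "\<And>i. \<bar>a i\<bar> \<le> \<bar>b i\<bar>"
  shows "a \<in> E \<and> N a \<le> N b"
proof -
  define step where "step r = (\<lambda>i. 2 * r i - (if 0 \<le> r i then \<bar>b i\<bar> else - \<bar>b i\<bar>))" for r :: "'i \<Rightarrow> real"
  define r where "r k = (step ^^ k) a" for k
  have r0: "r 0 = a" and rS: "r (Suc k) = step (r k)" for k unfolding r_def by auto
  have rb: "\<bar>r k i\<bar> \<le> \<bar>b i\<bar>" for k i
  proof (induction k)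
    case 0 then show ?case using ab by (simp add: r0)
  next
    case (Suc k) then show ?case unfolding rS step_def by auto
  qed
  define x where "x k = (\<lambda>i. a i - r k i / 2 ^ k)" for k
  define t where "t k = (\<lambda>i. if 0 \<le> r k i then \<bar>b i\<bar> else - \<bar>b i\<bar>)" for k
  have t: "t k \<in> E" "N (t k) = N b" for k
    using sign[OF b, of "t k"] N_sign[OF b, of "t k"] unfolding t_def by auto
  have xS: "x (Suc k) = (\<lambda>i. x k i + (1 / 2 ^ Suc k) * t k i)" for k
    unfolding x_def rS step_def t_def by (auto simp: field_simps)
  have x0: "x 0 = (\<lambda>i. 0)" unfolding x_def r0 by simp
  have xE: "x k \<in> E" for k
  proof (induction k)
    case 0 then show ?case using zero by (simp add: x0)
  next
    case (Suc k) then show ?case unfolding xS by (intro add scale t)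
  qed
  have inc: "N (\<lambda>i. x (k + m) i - x k i) \<le> (1 / 2 ^ k - 1 / 2 ^ (k + m)) * N b" for k m
  proof (induction m)
    case 0 then show ?case by (simp add: N_zero)
  next
    case (Suc m)
    have "(\<lambda>i. x (k + Suc m) i - x k i)
        = (\<lambda>i. (x (k + m) i - x k i) + (1 / 2 ^ Suc (k + m)) * t (k + m) i)"
      by (simp add: xS fun_eq_iff)
    then have "N (\<lambda>i. x (k + Suc m) i - x k i)
        \<le> N (\<lambda>i. x (k + m) i - x k i) + N (\<lambda>i. (1 / 2 ^ Suc (k + m)) * t (k + m) i)"
      using N_triangle[OF diff[OF xE xE] scale[OF t(1)]] by metis
    also have "N (\<lambda>i. (1 / 2 ^ Suc (k + m)) * t (k + m) i) = 1 / 2 ^ Suc (k + m) * N b"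
      using N_scale[OF t(1)[of "k + m"], of "1 / 2 ^ Suc (k + m)"] t(2)[of "k + m"] by simp
    finally show ?case using Suc by (simp add: algebra_simps)
  qed
  have inc': "N (\<lambda>i. x n i - x m i) \<le> 1 / 2 ^ k * N b" if "n \<ge> k" "m \<ge> k" for n m k
  proof -
    have *: "N (\<lambda>i. x n i - x m i) \<le> 1 / 2 ^ k * N b" if mn: "m \<le> n" and "m \<ge> k" for n m
    proof -
      have "N (\<lambda>i. x n i - x m i) \<le> (1 / 2 ^ m - 1 / 2 ^ n) * N b"
        using inc[of m "n - m"] mn by simp
      also have "\<dots> \<le> (1 / 2 ^ k) * N b"
        using N_nonneg[OF b] \<open>m \<ge> k\<close>
        by (intro mult_right_mono) (simp_all add: power_increasing field_simps add_increasing)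
      finally show ?thesis .
    qed
    show ?thesis
      using *[of m n] *[of n m] that N_diff_commute[OF xE xE, of n m] by (cases "m \<le> n") auto
  qed
  have "\<exists>n0. \<forall>n\<ge>n0. \<forall>m\<ge>n0. N (\<lambda>i. x n i - x m i) < \<epsilon>" if "\<epsilon> > 0" for \<epsilon>
  proof -
    have "(\<lambda>k. 1 / 2 ^ k * N b) \<longlonglongrightarrow> 0"
      by (intro tendsto_mult_left_zero LIMSEQ_divide_realpow_zero) auto
    then have "\<forall>\<^sub>F k in sequentially. 1 / 2 ^ k * N b < \<epsilon>" using that by (rule order_tendstoD)
    then obtain k where "1 / 2 ^ k * N b < \<epsilon>" using eventually_happens'[OF sequentially_bot] by blast
    then show ?thesis using inc' order.strict_trans1 by blast
  qed
  from complete_limit[OF xE this] obtain c where c: "c \<in> E" "(\<lambda>k. N (\<lambda>i. x k i - c i)) \<longlonglongrightarrow> 0" by blast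
  have "c i = a i" for i
  proof (rule LIMSEQ_unique)
    have "(\<lambda>k. x k i - c i) \<longlonglongrightarrow> 0"
      using c(2) coordinate_le[OF diff[OF xE c(1)], where i = i] by (intro Lim_null_comparison[OF _ c(2)]) auto
    then show "(\<lambda>k. x k i) \<longlonglongrightarrow> c i" by (simp add: LIM_zero_iff)
    have "(\<lambda>k. \<bar>b i\<bar> / 2 ^ k) \<longlonglongrightarrow> 0" by (intro LIMSEQ_divide_realpow_zero) auto
    then have "(\<lambda>k. r k i / 2 ^ k) \<longlonglongrightarrow> 0"
      by (rule Lim_null_comparison[rotated]) (auto simp: rb divide_right_mono)
    from tendsto_diff[OF tendsto_const this, of "a i"] show "(\<lambda>k. x k i) \<longlonglongrightarrow> a i"
      unfolding x_def by simp
  qed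
  then have ca: "c = a" by auto
  have "N a \<le> N b + N (\<lambda>i. x k i - c i)" for k
  proof -
    have "N (x k) \<le> N b"
    proof -
      have "N (x k) \<le> (1 - 1 / 2 ^ k) * N b" using inc[of 0 k] by (simp add: x0)
      also have "\<dots> \<le> N b" using N_nonneg[OF b] by (intro mult_left_le_one_le) auto
      finally show ?thesis .
    qed
    then show ?thesis using N_triangle_diff[OF c(1) xE, of k] N_diff_commute[OF c(1) xE, of k] ca by simp
  qed
  moreover have "(\<lambda>k. N b + N (\<lambda>i. x k i - c i)) \<longlonglongrightarrow> N b + 0" using c(2) by (intro tendsto_intros)
  ultimately have "N a \<le> N b" using LIMSEQ_le_const by fastforce
  then show ?thesis using c(1) ca by simp
qed

lemma solid: "b \<in> E \<Longrightarrow> (\<And>i. \<bar>a i\<bar> \<le> \<bar>b i\<bar>) \<Longrightarrow> a \<in> E"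
  and N_mono: "b \<in> E \<Longrightarrow> (\<And>i. \<bar>a i\<bar> \<le> \<bar>b i\<bar>) \<Longrightarrow> N a \<le> N b"
  using dominated_mem_and_norm_le by blast+

lemma restr_mem: "a \<in> E \<Longrightarrow> restr F a \<in> E"
  and N_restr_le: "a \<in> E \<Longrightarrow> N (restr F a) \<le> N a"
  by (auto intro!: solid[of a] N_mono simp: restr_def)

lemma finite_support:
  assumes "finite F"
  shows "restr F a \<in> E \<and> N (restr F a) \<le> (\<Sum>i\<in>F. \<bar>a i\<bar>)"
  using assms
proof induction
  case empty
  then show ?case using zero N_zero by (simp add: restr_def)
next
  case (insert j F)
  have *: "restr (insert j F) a = (\<lambda>i. restr F a i + a j * indicator {j} i)"
    using insert by (auto simp: restr_def indicator_def)
  have "N (\<lambda>i. a j * indicator {j} i) = \<bar>a j\<bar>"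
    using N_scale[OF indicator(1), of "a j" j] indicator(2)[of j] by simp
  then show ?case
    using insert N_triangle[of "restr F a" "\<lambda>i. a j * indicator {j} i"] scale[OF indicator(1)[of j], of "a j"]
    unfolding * by (simp add: add)
qed

lemma restr_finite_mem: "finite F \<Longrightarrow> restr F a \<in> E"
  using finite_support by blast

lemma dual_add: "f \<in> dual_ball C \<Longrightarrow> a \<in> E \<Longrightarrow> b \<in> E \<Longrightarrow> f (\<lambda>i. a i + b i) = f a + f b"
  using dual_ball_add[of f C a b] by simp

lemma dual_scale: "f \<in> dual_ball C \<Longrightarrow> a \<in> E \<Longrightarrow> f (\<lambda>i. c * a i) = c * f a"
  using dual_ball_scale[of f C a c] by simp

lemma dual_diff: "f \<in> dual_ball C \<Longrightarrow> a \<in> E \<Longrightarrow> b \<in> E \<Longrightarrow> f (\<lambda>i. a i - b i) = f a - f b"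
  using dual_add[of f a "\<lambda>i. (-1) * b i"] dual_scale[of f b "-1"] scale[of b "-1"] by simp

lemma dual_le: "f \<in> dual_ball C \<Longrightarrow> a \<in> E \<Longrightarrow> \<bar>f a\<bar> \<le> N a"
  using dual_ball_le[of f C a] by simp

lemma dual_finite_support:
  assumes f: "f \<in> dual_ball C" and F: "finite F"
  shows "f (restr F a) = (\<Sum>i\<in>F. f (indicator {i}) * a i)"
  using F
proof induction
  case empty
  have "f (\<lambda>i. 0) = 0" using dual_scale[OF f zero, of 0] by simp
  then show ?case by (simp add: restr_def)
next
  case (insert j F)
  have *: "restr (insert j F) a = (\<lambda>i. restr F a i + a j * indicator {j} i)"
    using insert by (auto simp: restr_def indicator_def)
  show ?case
    unfolding * using insert
    by (simp add: dual_add[OF f restr_finite_mem scale[OF indicator(1)]] dual_scale[OF f indicator(1)])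
qed

text \<open>The signs of the coordinates of \<open>a\<close> may be adapted to those of \<open>f\<close>.\<close>

lemma dual_abs_sum_le:
  assumes f: "f \<in> dual_ball C" and F: "finite F" and a: "a \<in> E"
  shows "(\<Sum>i\<in>F. \<bar>f (indicator {i})\<bar> * \<bar>a i\<bar>) \<le> N a"
proof -
  define b where "b i = sgn (f (indicator {i})) * \<bar>a i\<bar>" for i
  have "(\<Sum>i\<in>F. \<bar>f (indicator {i})\<bar> * \<bar>a i\<bar>) = f (restr F b)"
    unfolding dual_finite_support[OF f F] b_def by (intro sum.cong) (auto simp: abs_sgn)
  also have "\<dots> \<le> N (restr F b)" using dual_le[OF f restr_finite_mem[OF F], of b] by simp
  also have "\<dots> \<le> N a" using a by (intro N_mono) (auto simp: restr_def b_def abs_mult abs_sgn_eq)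
  finally show ?thesis .
qed

end

lemma absolute_space_UNIV:
  fixes N :: "('i \<Rightarrow> real) \<Rightarrow> real"
  assumes absolute: "absolute_norm UNIV N"
  shows "absolute_space UNIV N"
proof -
  have banach: "banach_space_on (coord_space UNIV N)"
    and sg: "\<And>a b. \<forall>i. \<bar>a i\<bar> = \<bar>b i\<bar> \<Longrightarrow> N a = N b"
    and ind: "\<And>i. N (indicator {i}) = 1"
    using absolute unfolding absolute_norm_def by auto
  interpret C: normed_space_on "coord_space UNIV N"
    using banach unfolding banach_space_on_def by blast
  have d: "vdist (coord_space UNIV N) a b = N (\<lambda>i. a i - b i)" for a b
    unfolding vdist_def by simp
  interpret M: Metric_space UNIV "vdist (coord_space UNIV N)"
  proof
    show "0 \<le> vdist (coord_space UNIV N) a b" for a b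
      using C.norm_nonneg[of "\<lambda>i. a i - b i"] by (simp add: d)
    show "vdist (coord_space UNIV N) a b = vdist (coord_space UNIV N) b a" for a b
      unfolding d by (intro sg) auto
    show "vdist (coord_space UNIV N) a b = 0 \<longleftrightarrow> a = b" for a b
      using C.norm_eq_0[of "\<lambda>i. a i - b i"] by (auto simp: d fun_eq_iff)
    show "vdist (coord_space UNIV N) a c \<le> vdist (coord_space UNIV N) a b + vdist (coord_space UNIV N) b c"
      for a b c
      using C.norm_triangle[of "\<lambda>i. a i - b i" "\<lambda>i. b i - c i"] by (simp add: d)
  qed
  show ?thesis
  proof
    fix \<sigma> :: "nat \<Rightarrow> 'i \<Rightarrow> real"
    assume "\<And>\<epsilon>. \<epsilon> > 0 \<Longrightarrow> \<exists>n0. \<forall>n\<ge>n0. \<forall>m\<ge>n0. N (\<lambda>i. \<sigma> n i - \<sigma> m i) < \<epsilon>"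
    then have "M.MCauchy \<sigma>" unfolding M.MCauchy_def d by auto
    moreover have "M.mcomplete"
      using banach unfolding banach_space_on_def banach_space_on_axioms_def by simp
    ultimately obtain a where "limitin M.mtopology \<sigma> a sequentially" unfolding M.mcomplete_def by blast
    then show "\<exists>a\<in>UNIV. (\<lambda>k. N (\<lambda>i. \<sigma> k i - a i)) \<longlonglongrightarrow> 0"
      unfolding M.limitin_metric_dist_null d by auto
  qed (use sg ind in auto)
qed

section \<open>Contractions\<close>

definition contraction_on :: "('k::real_normed_field, 'a) nvs \<Rightarrow> ('k, 'b) nvs \<Rightarrow> ('a \<Rightarrow> 'b) \<Rightarrow> bool" where
  "contraction_on X Y T \<longleftrightarrow> bounded_linear_on X Y T \<and> (\<forall>x\<in>vcarrier X. vnorm Y (T x) \<le> vnorm X x)"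

lemma contraction_onI:
  assumes "\<And>x. x \<in> vcarrier X \<Longrightarrow> T x \<in> vcarrier Y"
    and "\<And>x y. x \<in> vcarrier X \<Longrightarrow> y \<in> vcarrier X \<Longrightarrow> T (vadd X x y) = vadd Y (T x) (T y)"
    and "\<And>c x. x \<in> vcarrier X \<Longrightarrow> T (vscale X c x) = vscale Y c (T x)"
    and "\<And>x. x \<in> vcarrier X \<Longrightarrow> vnorm Y (T x) \<le> vnorm X x"
  shows "contraction_on X Y T"
  unfolding contraction_on_def bounded_linear_on_def using assms by (auto intro!: exI[of _ 1])

lemma dual_ball_contraction: "f \<in> dual_ball X \<longleftrightarrow> contraction_on X scalar_space f"
  unfolding dual_ball_def contraction_on_def by simp

lemma contraction_on_closed: "contraction_on X Y T \<Longrightarrow> x \<in> vcarrier X \<Longrightarrow> T x \<in> vcarrier Y"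
  unfolding contraction_on_def bounded_linear_on_def by blast

lemma contraction_on_le: "contraction_on X Y T \<Longrightarrow> x \<in> vcarrier X \<Longrightarrow> vnorm Y (T x) \<le> vnorm X x"
  unfolding contraction_on_def by blast

lemma contraction_on_bounded_linear: "contraction_on X Y T \<Longrightarrow> bounded_linear_on X Y T"
  unfolding contraction_on_def by blast

lemma contraction_on_add: "contraction_on X Y T \<Longrightarrow> x \<in> vcarrier X \<Longrightarrow> y \<in> vcarrier X \<Longrightarrow>
    T (vadd X x y) = vadd Y (T x) (T y)"
  unfolding contraction_on_def bounded_linear_on_def by blast

lemma contraction_on_scale: "contraction_on X Y T \<Longrightarrow> x \<in> vcarrier X \<Longrightarrow>
    T (vscale X c x) = vscale Y c (T x)"
  unfolding contraction_on_def bounded_linear_on_def by blast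

lemma contraction_on_comp:
  assumes S: "contraction_on X Y S" and T: "contraction_on Y W T"
  shows "contraction_on X W (\<lambda>x. T (S x))"
proof (rule contraction_onI)
  fix x assume x: "x \<in> vcarrier X"
  note Sx = contraction_on_closed[OF S x]
  show "T (S x) \<in> vcarrier W" by (rule contraction_on_closed[OF T Sx])
  show "T (S (vscale X c x)) = vscale W c (T (S x))" for c
    by (simp add: contraction_on_scale[OF S x] contraction_on_scale[OF T Sx])
  show "vnorm W (T (S x)) \<le> vnorm X x"
    using contraction_on_le[OF T Sx] contraction_on_le[OF S x] by (rule order_trans)
  show "T (S (vadd X x y)) = vadd W (T (S x)) (T (S y))" if y: "y \<in> vcarrier X" for y
    by (simp add: contraction_on_add[OF S x y] contraction_on_add[OF T Sx contraction_on_closed[OF S y]])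
qed

lemma (in normed_space_on) contraction_onI_op_norm:
  assumes T: "bounded_linear_on X Y T" "op_norm X Y T \<le> 1" and Y: "normed_space_on Y"
  shows "contraction_on X Y T"
  unfolding contraction_on_def
  using T(1) op_norm_bound[OF Y T(1)] mult_right_mono[OF T(2) norm_nonneg] by fastforce

lemma exists_aligning_scalar:
  fixes a b :: "'k::real_normed_field"
  shows "\<exists>c. norm c = 1 \<and> norm (a + c * b) = norm a + norm b"
proof (cases "a = 0 \<or> b = 0")
  case True
  then show ?thesis by (intro exI[of _ 1]) auto
next
  case False
  define c where "c = (a / of_real (norm a)) * (of_real (norm b) / b)"
  have "a + c * b = (a / of_real (norm a)) * of_real (norm a + norm b)"
    unfolding c_def using False by (simp add: field_simps)
  then have "norm (a + c * b) = norm (a / of_real (norm a)) * norm (of_real (norm a + norm b) :: 'k)"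
    by (simp only: norm_mult)
  also have "\<dots> = norm a + norm b" using False by (subst norm_of_real) (simp add: norm_divide)
  finally show ?thesis using False by (intro exI[of _ c]) (simp add: c_def norm_mult norm_divide)
qed

section \<open>Absolute sums\<close>

lemma E_sum_sel [simp]:
  "vcarrier (E_sum E N X) = {x. (\<forall>i. x i \<in> vcarrier (X i)) \<and> (\<lambda>i. vnorm (X i) (x i)) \<in> E}"
  "vadd (E_sum E N X) = (\<lambda>x y i. vadd (X i) (x i) (y i))"
  "vzero (E_sum E N X) = (\<lambda>i. vzero (X i))"
  "vscale (E_sum E N X) = (\<lambda>c x i. vscale (X i) c (x i))"
  "vnorm (E_sum E N X) = (\<lambda>x. N (\<lambda>i. vnorm (X i) (x i)))"
  unfolding E_sum_def by auto

locale absolute_sum = absolute_space E N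
  for E :: "('i \<Rightarrow> real) set" and N :: "('i \<Rightarrow> real) \<Rightarrow> real" +
  fixes X :: "'i \<Rightarrow> ('k::real_normed_field, 'a) nvs"
  assumes summand: "normed_space_on (X i)" and nonzero: "nonzero_space (X i)"
    and norming: "norming_functionals (X i)"
begin

sublocale X: normed_space_on "X i" for i by (rule summand)

abbreviation Z where "Z \<equiv> E_sum E N X"

lemma normed_space_on_E_sum: "normed_space_on Z"
proof
  show "vzero Z \<in> vcarrier Z" using zero by (simp add: X.zero_closed X.norm_vzero)
  fix x assume x: "x \<in> vcarrier Z"
  show "vscale Z c x \<in> vcarrier Z" for c
    using x scale by (simp add: X.scale_closed X.norm_scale)
  show "vadd Z x (vzero Z) = x" using x by (simp add: X.add_zero)
  show "vadd Z x (vscale Z (- 1) x) = vzero Z" using x by (simp add: X.add_neg)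
  show "vscale Z (c + d) x = vadd Z (vscale Z c x) (vscale Z d x)" for c d
    using x by (simp add: X.add_scale)
  show "vscale Z c (vscale Z d x) = vscale Z (c * d) x" for c d using x by (simp add: X.scale_scale)
  show "vscale Z 1 x = x" using x by (simp add: X.scale_one)
  show "vnorm Z x = 0 \<longleftrightarrow> x = vzero Z"
    using x C.norm_eq_0[of "\<lambda>i. vnorm (X i) (x i)"] by (simp add: fun_eq_iff X.norm_eq_0)
  show "vnorm Z (vscale Z c x) = norm c * vnorm Z x" for c
    using x N_scale[of "\<lambda>i. vnorm (X i) (x i)" "norm c"] by (simp add: X.norm_scale)
  fix y assume y: "y \<in> vcarrier Z"
  show "vadd Z x y = vadd Z y x" using x y X.add_comm[of "x _" _ "y _"] by (simp add: fun_eq_iff)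
  show "vscale Z c (vadd Z x y) = vadd Z (vscale Z c x) (vscale Z c y)" for c
    using x y by (simp add: X.scale_add)
  show "vadd Z (vadd Z x y) z = vadd Z x (vadd Z y z)" if "z \<in> vcarrier Z" for z
    using x y that by (simp add: X.add_assoc)
  have le: "\<bar>vnorm (X i) (vadd (X i) (x i) (y i))\<bar> \<le> \<bar>vnorm (X i) (x i) + vnorm (X i) (y i)\<bar>" for i
    using x y X.norm_triangle[of "x i" i "y i"] X.norm_nonneg[OF X.add_closed[of "x i" i "y i"]] by simp
  have E: "(\<lambda>i. vnorm (X i) (x i) + vnorm (X i) (y i)) \<in> E" using add x y by simp
  show "vadd Z x y \<in> vcarrier Z" using x y solid[OF E le] by (simp add: X.add_closed)
  show "vnorm Z (vadd Z x y) \<le> vnorm Z x + vnorm Z y"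
    using x y N_mono[OF E le] N_triangle[of "\<lambda>i. vnorm (X i) (x i)" "\<lambda>i. vnorm (X i) (y i)"] by simp
qed

sublocale Z: normed_space_on Z by (rule normed_space_on_E_sum)

definition single :: "'i \<Rightarrow> 'a \<Rightarrow> 'i \<Rightarrow> 'a" where
  "single j v = (\<lambda>i. if i = j then v else vzero (X i))"

lemma single_in_Z: "v \<in> vcarrier (X j) \<Longrightarrow> single j v \<in> vcarrier Z"
  and norm_single: "v \<in> vcarrier (X j) \<Longrightarrow> vnorm Z (single j v) = vnorm (X j) v"
proof -
  assume v: "v \<in> vcarrier (X j)"
  have *: "(\<lambda>i. vnorm (X i) (single j v i)) = (\<lambda>i. vnorm (X j) v * indicator {j} i)"
    unfolding single_def by (auto simp: X.norm_vzero indicator_def)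
  show "single j v \<in> vcarrier Z"
    using v scale[OF indicator(1)] by (simp add: *) (simp add: single_def X.zero_closed)
  show "vnorm Z (single j v) = vnorm (X j) v"
    using N_scale[OF indicator(1)[of j], of "vnorm (X j) v"] indicator(2)[of j] X.norm_nonneg[OF v]
    by (simp add: *)
qed

lemma single_add: "v \<in> vcarrier (X j) \<Longrightarrow> w \<in> vcarrier (X j) \<Longrightarrow>
    single j (vadd (X j) v w) = vadd Z (single j v) (single j w)"
  unfolding single_def by (auto simp: X.add_zero X.zero_closed)

lemma single_scale: "single j (vscale (X j) c v) = vscale Z c (single j v)"
  unfolding single_def by (auto simp: X.scale_vzero)

lemma nonzero_E_sum: "nonzero_space Z"
proof -
  fix j :: 'i
  obtain u where "u \<in> vcarrier (X j)" "vnorm (X j) u = 1" using X.exists_unit_vector[OF nonzero] by blast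
  then have "single j u \<in> vcarrier Z" "vnorm Z (single j u) = 1"
    using single_in_Z norm_single by auto
  moreover from this have "single j u \<noteq> vzero Z" using Z.norm_vzero by (metis zero_neq_one)
  ultimately show ?thesis unfolding nonzero_space_def by blast
qed

text \<open>Replacing \<open>z j\<close> by another vector of the same norm does not change the norm of \<open>z\<close>.  So \<open>f\<close> cannot be
  larger in another direction of the summand, since it is bounded by one and equal to one at \<open>z\<close>.\<close>

lemma state_restricted_to_summand:
  assumes st: "(z, f) \<in> numerical_states Z" and v: "v \<in> vcarrier (X j)" "vnorm (X j) v = 1"
  shows "vnorm (X j) (z j) * norm (f (single j v)) \<le> norm (f (single j (z j)))"
proof -
  define r where "r = vnorm (X j) (z j)"
  have z: "z \<in> vcarrier Z" "vnorm Z z = 1" and f: "f \<in> dual_ball Z" "f z = 1"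
    using st Z.numerical_states_iff by auto
  have zj: "z j \<in> vcarrier (X j)" using z by simp
  have r0: "0 \<le> r" unfolding r_def using X.norm_nonneg[OF zj] .
  define z' where "z' = (\<lambda>i. if i = j then vzero (X i) else z i)"
  have z': "z' \<in> vcarrier Z"
  proof -
    have "(\<lambda>i. vnorm (X i) (z' i)) \<in> E"
    proof (rule solid)
      show "(\<lambda>i. vnorm (X i) (z i)) \<in> E" using z(1) by simp
      show "\<bar>vnorm (X i) (z' i)\<bar> \<le> \<bar>vnorm (X i) (z i)\<bar>" for i
        unfolding z'_def by (simp add: X.norm_vzero)
    qed
    then show ?thesis using z unfolding z'_def by (simp add: X.zero_closed)
  qed
  have zi: "z i \<in> vcarrier (X i)" for i using z(1) by simp
  have "vadd Z z' (single j (z j)) = z"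
    unfolding z'_def single_def by (simp add: X.add_zero[OF zi] X.zero_add[OF zi] fun_eq_iff)
  then have sum: "f z' + f (single j (z j)) = 1"
    using dual_ball_add[OF f(1) z' single_in_Z[OF zj]] f(2) by (simp del: E_sum_sel)
  obtain c where c: "norm c = 1"
    "norm (f z' + c * (of_real r * f (single j v))) = norm (f z') + norm (of_real r * f (single j v))"
    using exists_aligning_scalar[of "f z'" "of_real r * f (single j v)"] by blast
  let ?w = "vscale (X j) (c * of_real r) v"
  have w: "?w \<in> vcarrier (X j)" using v X.scale_closed by simp
  have "vnorm Z (vadd Z z' (single j ?w)) = vnorm Z z"
  proof -
    have "vnorm (X i) (vadd (X i) (z' i) (single j ?w i)) = vnorm (X i) (z i)" for i
    proof (cases "i = j")
      case True
      then show ?thesis using X.norm_scale[OF v(1), of "c * of_real r"] v(2) c(1) r0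
        unfolding z'_def single_def by (simp add: X.zero_add w norm_mult) (simp add: r_def)
    next
      case False
      then show ?thesis unfolding z'_def single_def by (simp add: X.add_zero zi)
    qed
    then show ?thesis by simp
  qed
  then have "norm (f (vadd Z z' (single j ?w))) \<le> 1"
    using dual_ball_le[OF f(1) Z.add_closed[OF z' single_in_Z[OF w]]] z(2) by simp
  moreover have "f (vadd Z z' (single j ?w)) = f z' + c * (of_real r * f (single j v))"
    using dual_ball_add[OF f(1) z' single_in_Z[OF w]] dual_ball_scale[OF f(1) single_in_Z[OF v(1)], of "c * of_real r"]
    by (simp only: single_scale) (simp add: mult.assoc)
  ultimately have "norm (f z') + r * norm (f (single j v)) \<le> 1"
    using c(2) r0 by (simp add: norm_mult)
  moreover have "1 \<le> norm (f z') + norm (f (single j (z j)))"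
    using norm_triangle_ineq[of "f z'" "f (single j (z j))"] unfolding sum by simp
  ultimately show ?thesis unfolding r_def by simp
qed

text \<open>The operator \<open>S\<close> on \<open>X j\<close> is extended by zero to an operator \<open>T\<close>.  A state \<open>(z, f)\<close> of the sum
  restricts to \<open>X j\<close> as a multiple of a state, at the normalized \<open>z j\<close>, by
  \<open>state_restricted_to_summand\<close>; the multiple has modulus at most one.\<close>

lemma numerical_index_E_sum_le:
  assumes nZ: "norming_functionals Z"
  shows "numerical_index Z \<le> numerical_index (X j)"
proof (rule X.numerical_index_greatest[OF nonzero])
  fix S assume S: "bounded_linear_on (X j) (X j) S" "op_norm (X j) (X j) S = 1"
  have cS: "contraction_on (X j) (X j) S" using X.contraction_onI_op_norm[OF S(1) _ summand] S(2) by simp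
  have Sc: "S x \<in> vcarrier (X j)" if "x \<in> vcarrier (X j)" for x using contraction_on_closed[OF cS that] .
  define T where "T w = single j (S (w j))" for w :: "'i \<Rightarrow> 'a"
  have cj: "w j \<in> vcarrier (X j)" if "w \<in> vcarrier Z" for w using that by simp
  have nj: "vnorm (X j) (w j) \<le> vnorm Z w" if "w \<in> vcarrier Z" for w
    using that coordinate_le[of "\<lambda>i. vnorm (X i) (w i)" j] by simp
  have T: "contraction_on Z Z T"
  proof (rule contraction_onI)
    fix x y assume x: "x \<in> vcarrier Z" and y: "y \<in> vcarrier Z"
    show "T x \<in> vcarrier Z" unfolding T_def by (intro single_in_Z Sc cj x)
    have "S (vadd (X j) (x j) (y j)) = vadd (X j) (S (x j)) (S (y j))"
      using S(1) cj[OF x] cj[OF y] unfolding bounded_linear_on_def by blast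
    then show "T (vadd Z x y) = vadd Z (T x) (T y)"
      unfolding T_def using single_add[OF Sc[OF cj[OF x]] Sc[OF cj[OF y]]] by simp
    have "S (vscale (X j) c (x j)) = vscale (X j) c (S (x j))" for c
      using S(1) cj[OF x] unfolding bounded_linear_on_def by blast
    then show "T (vscale Z c x) = vscale Z c (T x)" for c
      unfolding T_def using single_scale[of j c] by simp
    show "vnorm Z (T x) \<le> vnorm Z x"
      unfolding T_def norm_single[OF Sc[OF cj[OF x]]]
      using contraction_on_le[OF cS cj[OF x]] nj[OF x] by simp
  qed
  have op: "op_norm Z Z T = 1"
  proof (rule antisym)
    show "op_norm Z Z T \<le> 1" using contraction_on_le[OF T] by (intro Z.op_norm_least) force
    have "vnorm (X j) (S x) \<le> op_norm Z Z T" if x: "x \<in> vcarrier (X j)" "vnorm (X j) x \<le> 1" for x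
    proof -
      have "vnorm Z (T (single j x)) \<le> op_norm Z Z T"
        by (rule Z.op_norm_upper[OF contraction_on_bounded_linear[OF T] single_in_Z[OF x(1)]])
          (simp only: norm_single[OF x(1)] x(2))
      moreover have "T (single j x) = single j (S x)" unfolding T_def single_def by simp
      ultimately show ?thesis using norm_single[OF Sc[OF x(1)]] by simp
    qed
    then have "op_norm (X j) (X j) S \<le> op_norm Z Z T" by (rule X.op_norm_least)
    then show "1 \<le> op_norm Z Z T" using S(2) by simp
  qed
  have "numerical_index Z \<le> numerical_radius Z T"
    using Z.numerical_index_lower[OF nonzero_E_sum nZ contraction_on_bounded_linear[OF T] op] .
  also have "\<dots> \<le> numerical_radius (X j) S"
  proof (rule Z.numerical_radius_least[OF nonzero_E_sum nZ])
    fix z f assume st: "(z, f) \<in> numerical_states Z"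
    have z: "z \<in> vcarrier Z" "vnorm Z z = 1" and f: "f \<in> dual_ball Z" "f z = 1"
      using st Z.numerical_states_iff by auto
    define r where "r = vnorm (X j) (z j)"
    define h where "h v = f (single j v)" for v
    have r0: "0 \<le> r" unfolding r_def using X.norm_nonneg[OF cj[OF z(1)]] .
    have hs: "h (vscale (X j) c v) = c * h v" if "v \<in> vcarrier (X j)" for c v
      unfolding h_def using dual_ball_scale[OF f(1) single_in_Z[OF that]] by (simp only: single_scale)
    have ha: "h (vadd (X j) v w) = h v + h w" if "v \<in> vcarrier (X j)" "w \<in> vcarrier (X j)" for v w
      unfolding h_def single_add[OF that]
      using dual_ball_add[OF f(1) single_in_Z[OF that(1)] single_in_Z[OF that(2)]] .
    obtain u where u: "u \<in> vcarrier (X j)" "vnorm (X j) u = 1" "z j = vscale (X j) (of_real r) u"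
      using X.exists_polar_unit_vector[OF nonzero cj[OF z(1)]] unfolding r_def by blast
    have Su: "S (z j) = vscale (X j) (of_real r) (S u)"
      using S(1) u(1,3) unfolding bounded_linear_on_def by simp
    have att: "r * norm (h v) \<le> r * norm (h u) * vnorm (X j) v" if v: "v \<in> vcarrier (X j)" for v
    proof -
      obtain v' where v': "v' \<in> vcarrier (X j)" "vnorm (X j) v' = 1" "v = vscale (X j) (of_real (vnorm (X j) v)) v'"
        using X.exists_polar_unit_vector[OF nonzero v] by blast
      have "r * norm (h v') \<le> norm (h (z j))"
        using state_restricted_to_summand[OF st v'(1,2)] unfolding r_def h_def .
      also have "\<dots> = r * norm (h u)" using hs[OF u(1)] u(3) r0 by (simp add: norm_mult)
      finally have "r * norm (h v') * vnorm (X j) v \<le> r * norm (h u) * vnorm (X j) v"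
        using X.norm_nonneg[OF v] by (intro mult_right_mono)
      moreover have "h v = of_real (vnorm (X j) v) * h v'"
        using hs[OF v'(1), of "of_real (vnorm (X j) v)"] v'(3) by simp
      then have "norm (h v) = vnorm (X j) v * norm (h v')" using X.norm_nonneg[OF v] by (simp add: norm_mult)
      ultimately show ?thesis by (simp add: algebra_simps)
    qed
    have v0: "0 \<le> numerical_radius (X j) S" by (rule X.numerical_radius_nonneg[OF nonzero norming S(1)])
    have "f (T z) = of_real r * h (S u)"
      unfolding T_def using hs[OF Sc[OF u(1)]] Su by (simp add: h_def)
    then have fT: "norm (f (T z)) = r * norm (h (S u))" using r0 by (simp add: norm_mult)
    show "norm (f (T z)) \<le> numerical_radius (X j) S"
    proof (cases "r * norm (h u) = 0")
      case True
      have "r * norm (h (S u)) \<le> 0" using att[OF Sc[OF u(1)]] unfolding True by simp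
      then show ?thesis using fT v0 by simp
    next
      case False
      then have rpos: "r > 0" and hu: "h u \<noteq> 0" using r0 by auto
      have "norm (h v) \<le> norm (h u) * vnorm (X j) v" if "v \<in> vcarrier (X j)" for v
        using att[OF that] rpos by (simp add: mult.assoc)
      then have "norm (h v / h u) \<le> vnorm (X j) v" if "v \<in> vcarrier (X j)" for v
        using hu that by (simp add: norm_divide pos_divide_le_eq mult.commute)
      then have "(\<lambda>v. h v / h u) \<in> dual_ball (X j)"
        by (intro dual_ballI) (simp_all add: ha hs add_divide_distrib)
      then have "(u, \<lambda>v. h v / h u) \<in> numerical_states (X j)"
        using u hu X.numerical_states_iff by simp
      from X.numerical_radius_upper[OF S(1) this]
      have "norm (h (S u)) \<le> numerical_radius (X j) S * norm (h u)" using hu by (simp add: norm_divide field_simps)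
      then have "r * norm (h (S u)) \<le> r * (numerical_radius (X j) S * norm (h u))"
        using r0 by (rule mult_left_mono)
      also have "\<dots> = numerical_radius (X j) S * (r * norm (h u))" by simp
      also have "\<dots> \<le> numerical_radius (X j) S * 1"
      proof (rule mult_left_mono[OF _ v0])
        have "r * norm (h u) = norm (h (z j))" using hs[OF u(1)] u(3) r0 by (simp add: norm_mult)
        also have "\<dots> \<le> vnorm Z (single j (z j))"
          unfolding h_def by (rule dual_ball_le[OF f(1) single_in_Z[OF cj[OF z(1)]]])
        also have "\<dots> \<le> 1" unfolding norm_single[OF cj[OF z(1)]] using nj[OF z(1)] z(2) by simp
        finally show "r * norm (h u) \<le> 1" .
      qed
      finally show ?thesis using fT by simp
    qed
  qed
  finally show "numerical_index Z \<le> numerical_radius (X j) S" .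
qed

end

section \<open>The lower estimate\<close>

definition dentable_ball :: "(real, 'c) nvs \<Rightarrow> bool" where
  "dentable_ball X \<longleftrightarrow> (\<forall>g s d. bounded_linear_on X scalar_space g \<and> ball_slice X g s \<noteq> {} \<and> 0 < d \<longrightarrow>
     (\<exists>g' s'. bounded_linear_on X scalar_space g' \<and> ball_slice X g' s' \<noteq> {} \<and>
        ball_slice X g' s' \<subseteq> ball_slice X g s \<and>
        (\<forall>x\<in>ball_slice X g' s'. \<forall>y\<in>ball_slice X g' s'. vdist X x y \<le> d)))"

definition (in absolute_space) truncations_dense :: bool where
  "truncations_dense \<longleftrightarrow> (\<forall>a\<in>E. \<forall>\<epsilon>>0. \<exists>F. finite F \<and> N (\<lambda>i. a i - restr F a i) < \<epsilon>)"

context absolute_space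
begin

abbreviation functional :: "(('i \<Rightarrow> real) \<Rightarrow> real) \<Rightarrow> bool" where
  "functional \<equiv> bounded_linear_on C scalar_space"

abbreviation slice :: "(('i \<Rightarrow> real) \<Rightarrow> real) \<Rightarrow> real \<Rightarrow> ('i \<Rightarrow> real) set" where
  "slice \<equiv> ball_slice C"

lemma slice_iff: "x \<in> slice g s \<longleftrightarrow> x \<in> E \<and> N x \<le> 1 \<and> s < g x"
  unfolding ball_slice_def by simp

lemma vdist_C: "vdist C a b = N (\<lambda>i. a i - b i)"
  unfolding vdist_def by simp

lemma functional_add: "functional g \<Longrightarrow> a \<in> E \<Longrightarrow> b \<in> E \<Longrightarrow> g (\<lambda>i. a i + b i) = g a + g b"
  and functional_scale: "functional g \<Longrightarrow> a \<in> E \<Longrightarrow> g (\<lambda>i. c * a i) = c * g a"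
  unfolding bounded_linear_on_def by auto

lemma functional_diff: "functional g \<Longrightarrow> a \<in> E \<Longrightarrow> b \<in> E \<Longrightarrow> g (\<lambda>i. a i - b i) = g a - g b"
  using functional_add[of g a "\<lambda>i. (-1) * b i"] functional_scale[of g b "-1"] scale[of b "-1"] by simp

lemma functional_zero: "functional g \<Longrightarrow> g (\<lambda>i. 0) = 0"
  using functional_scale[of g "\<lambda>i. 0" 0] zero by simp

lemma functional_bound: "functional g \<Longrightarrow> \<exists>K>0. \<forall>a\<in>E. \<bar>g a\<bar> \<le> K * N a"
proof -
  assume "functional g"
  then obtain K where K: "\<forall>a\<in>E. \<bar>g a\<bar> \<le> K * N a" unfolding bounded_linear_on_def by auto
  have "\<bar>g a\<bar> \<le> (\<bar>K\<bar> + 1) * N a" if a: "a \<in> E" for a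
  proof -
    have "K * N a \<le> (\<bar>K\<bar> + 1) * N a" using N_nonneg[OF a] by (intro mult_right_mono) auto
    then show ?thesis using K a by fastforce
  qed
  then show ?thesis by (intro exI[of _ "\<bar>K\<bar> + 1"]) auto
qed

lemma functionalI:
  assumes "\<And>a b. a \<in> E \<Longrightarrow> b \<in> E \<Longrightarrow> g (\<lambda>i. a i + b i) = g a + g b"
    and "\<And>c a. a \<in> E \<Longrightarrow> g (\<lambda>i. c * a i) = c * g a"
    and "\<And>a. a \<in> E \<Longrightarrow> \<bar>g a\<bar> \<le> K * N a"
  shows "functional g"
proof -
  have "\<exists>K. \<forall>a\<in>E. \<bar>g a\<bar> \<le> K * N a" using assms(3) by blast
  then show ?thesis unfolding bounded_linear_on_def using assms(1,2) by simp
qed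

lemma sign_mult:
  assumes "\<forall>i. \<theta> i \<in> {-1, 1 :: real}" "a \<in> E"
  shows "(\<lambda>i. \<theta> i * a i) \<in> E \<and> N (\<lambda>i. \<theta> i * a i) = N a"
proof -
  have *: "\<bar>a i\<bar> = \<bar>\<theta> i * a i\<bar>" for i using assms(1)[rule_format, of i] by (auto simp: abs_mult)
  show ?thesis by (intro conjI sign[OF assms(2) *] N_sign[OF assms(2) *])
qed

text \<open>A functional that is nearly unimodular at all sign changes of \<open>x\<close> has to live on one coordinate
  of \<open>x\<close>.  To get one functional for all sign changes, a weak-star slice is chosen first on which the
  finitely many coordinates in \<open>F\<close> hardly vary, and is then paired with the sign changes of a small slice
  around \<open>x\<close>.\<close>

lemma concentrated_functional:
  assumes dual: "slices_in_duality C"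
    and g: "functional g" "0 \<le> s"
    and \<delta>: "0 < \<delta>" "\<delta> < 1 / 2"
    and diam: "\<And>y y'. y \<in> slice g s \<Longrightarrow> y' \<in> slice g s \<Longrightarrow> N (\<lambda>i. y i - y' i) \<le> \<delta>"
    and x: "x \<in> slice g s" and F: "finite F" "restr F x = x"
    and b: "b \<in> E" "0 \<le> t" "t < N b"
  shows "\<exists>f\<in>dual_ball C. t < f b \<and> (\<exists>i\<in>F. 1 - 2 * \<delta> \<le> \<bar>f (indicator {i}) * x i\<bar>)"
proof -
  have xE: "x \<in> E" "N x \<le> 1" "s < g x" using x by (auto simp: slice_iff)
  define d where "d = \<delta> / (real (card F) + 1)"
  have d: "d > 0" unfolding d_def using \<delta> by simp
  obtain f0 where f0: "f0 \<in> dual_ball C" "f0 b = N b"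
    using norming_functionals_real[OF normed] b(1) unfolding norming_functionals_def by auto
  let ?\<phi> = "\<lambda>i f. f (indicator {i}) :: real"
  have "\<exists>R c s' p. p \<in> dual_ball C \<and> R * p b + (\<Sum>i\<in>F. c i * ?\<phi> i p) > s' \<and>
     (\<forall>f\<in>dual_ball C. R * f b + (\<Sum>i\<in>F. c i * ?\<phi> i f) > s' \<longrightarrow> f b > t \<and> (\<forall>i\<in>F. \<bar>?\<phi> i f - ?\<phi> i p\<bar> \<le> d))"
  proof (rule subslice_with_small_oscillation[OF F(1) f0(1) _ d, where K = "max 1 (N b)"])
    show "t < f0 b" using f0 b by simp
    show "f b \<le> max 1 (N b)" if "f \<in> dual_ball C" for f using dual_le[OF that b(1)] by simp
    show "\<bar>f (indicator {i})\<bar> \<le> max 1 (N b)" if "f \<in> dual_ball C" for f i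
      using dual_le[OF that indicator(1)[of i]] indicator(2)[of i] by simp
  qed
  then obtain R c s' p where p: "p \<in> dual_ball C" "R * p b + (\<Sum>i\<in>F. c i * ?\<phi> i p) > s'"
    and slice: "\<And>f. f \<in> dual_ball C \<Longrightarrow> R * f b + (\<Sum>i\<in>F. c i * ?\<phi> i f) > s' \<Longrightarrow>
      f b > t \<and> (\<forall>i\<in>F. \<bar>?\<phi> i f - ?\<phi> i p\<bar> \<le> d)"
    by blast
  define v where "v = (\<lambda>i. R * b i + restr F c i)"
  have v: "v \<in> E" unfolding v_def by (intro add scale b restr_finite_mem F)
  have fv: "f v = R * f b + (\<Sum>i\<in>F. c i * ?\<phi> i f)" if "f \<in> dual_ball C" for f
    unfolding v_def using dual_finite_support[OF that F(1), of c]
    by (simp add: dual_add[OF that scale[OF b(1)] restr_finite_mem[OF F(1)]] dual_scale[OF that b(1)] mult.commute)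
  have "0 \<le> s'"
  proof (rule ccontr)
    assume "\<not> 0 \<le> s'"
    moreover have "(\<lambda>a. 0) \<in> dual_ball C" by (intro dual_ballI) (auto simp: N_nonneg)
    ultimately have "t < 0" using slice[of "\<lambda>a. 0"] by simp
    then show False using b(2) by simp
  qed
  have unimodular: "1 - 2 * \<delta> \<le> \<bar>\<Sum>i\<in>F. \<theta> i * (?\<phi> i p * x i)\<bar>" if \<theta>: "\<forall>i. \<theta> i \<in> {-1, 1}" for \<theta>
  proof -
    have \<theta>2: "\<theta> i * (\<theta> i * r) = r" for i r using \<theta>[rule_format, of i] by auto
    note sm = sign_mult[OF \<theta>]
    define g' where "g' a = g (\<lambda>i. \<theta> i * a i)" for a
    obtain K where K: "\<forall>a\<in>E. \<bar>g a\<bar> \<le> K * N a" using functional_bound[OF g(1)] by blast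
    have g': "functional g'"
    proof (rule functionalI)
      show "g' (\<lambda>i. a i + a' i) = g' a + g' a'" if "a \<in> E" "a' \<in> E" for a a'
        unfolding g'_def using functional_add[OF g(1)] sm[OF that(1)] sm[OF that(2)] by (simp add: distrib_left)
      show "g' (\<lambda>i. c * a i) = c * g' a" if "a \<in> E" for c a
        unfolding g'_def using functional_scale[OF g(1), of _ c] sm[OF that] by (simp add: mult.left_commute)
      show "\<bar>g' a\<bar> \<le> K * N a" if "a \<in> E" for a
        unfolding g'_def using K[rule_format, of "\<lambda>i. \<theta> i * a i"] sm[OF that] by simp
    qed
    have "(\<lambda>i. \<theta> i * x i) \<in> slice g' s"
      using sm[OF xE(1)] xE by (auto simp: slice_iff g'_def \<theta>2)
    then have "slice g' s \<noteq> {}" by blast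
    moreover have "\<exists>f\<in>dual_ball C. s' < f v" using p fv[OF p(1)] by (intro bexI[of _ p]) auto
    moreover have "v \<in> vcarrier C" using v by simp
    ultimately have "\<exists>y\<in>slice g' s. \<exists>f\<in>dual_ball C. s' < f v \<and> \<bar>f y\<bar> = 1"
      using dual[unfolded slices_in_duality_def, rule_format, of g' s s' v] g' g(2) \<open>0 \<le> s'\<close> by blast
    then obtain y f where y: "y \<in> E" "N y \<le> 1" "s < g' y"
      and f: "f \<in> dual_ball C" "s' < f v" "\<bar>f y\<bar> = 1" by (auto simp: slice_iff)
    have near: "\<bar>?\<phi> i f - ?\<phi> i p\<bar> \<le> d" if "i \<in> F" for i
      using slice[OF f(1)] f(2) fv[OF f(1)] that by simp
    define z where "z = (\<lambda>i. \<theta> i * x i)"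
    have z: "z \<in> E" unfolding z_def using sm[OF xE(1)] by simp
    have "N (\<lambda>i. \<theta> i * y i - x i) \<le> \<delta>"
      using diam[OF _ x, of "\<lambda>i. \<theta> i * y i"] sm[OF y(1)] y unfolding g'_def by (simp add: slice_iff)
    moreover have "(\<lambda>i. \<theta> i * (\<theta> i * y i - x i)) = (\<lambda>i. y i - z i)"
      unfolding z_def by (simp add: right_diff_distrib \<theta>2)
    ultimately have "N (\<lambda>i. y i - z i) \<le> \<delta>"
      using sm[OF diff[of "\<lambda>i. \<theta> i * y i" x]] sm[OF y(1)] xE(1) by simp
    then have "\<bar>f y - f z\<bar> \<le> \<delta>"
      using dual_le[OF f(1) diff[OF y(1) z]] dual_diff[OF f(1) y(1) z] by simp
    then have fz: "1 - \<delta> \<le> \<bar>f z\<bar>" using f(3) by linarith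
    have "x i = 0" if "i \<notin> F" for i using fun_cong[OF F(2), of i] that by (simp add: restr_def)
    then have rz: "restr F z = z" unfolding z_def restr_def by (simp add: fun_eq_iff)
    have "f z = (\<Sum>i\<in>F. ?\<phi> i f * z i)" using dual_finite_support[OF f(1) F(1), of z] unfolding rz .
    moreover have "\<bar>(\<Sum>i\<in>F. ?\<phi> i f * z i) - (\<Sum>i\<in>F. \<theta> i * (?\<phi> i p * x i))\<bar> \<le> (\<Sum>i\<in>F. d)"
    proof -
      have "(\<Sum>i\<in>F. ?\<phi> i f * z i) - (\<Sum>i\<in>F. \<theta> i * (?\<phi> i p * x i)) = (\<Sum>i\<in>F. (?\<phi> i f - ?\<phi> i p) * z i)"
        unfolding z_def sum_subtractf[symmetric] by (intro sum.cong) (auto simp: algebra_simps)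
      moreover have "\<bar>(?\<phi> i f - ?\<phi> i p) * z i\<bar> \<le> d" if "i \<in> F" for i
      proof -
        have "\<bar>z i\<bar> \<le> 1" using coordinate_le[OF z, of i] sm[OF xE(1)] xE(2) unfolding z_def by simp
        then have "\<bar>?\<phi> i f - ?\<phi> i p\<bar> * \<bar>z i\<bar> \<le> d * 1" using near[OF that] d by (intro mult_mono) auto
        then show ?thesis by (simp add: abs_mult)
      qed
      ultimately show ?thesis using sum_norm_le[of F "\<lambda>i. (?\<phi> i f - ?\<phi> i p) * z i" "\<lambda>i. d"] by simp
    qed
    moreover have "(\<Sum>i\<in>F. d) \<le> \<delta>" unfolding d_def using \<delta> by (simp add: field_simps)
    ultimately show ?thesis using fz by linarith
  qed
  have "\<exists>i\<in>F. 1 - 2 * \<delta> \<le> \<bar>?\<phi> i p * x i\<bar>"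
    using sign_sums_concentrate[OF F(1) _ unimodular] \<delta> by simp
  moreover have "t < p b" using slice[OF p] by simp
  ultimately show ?thesis using p(1) by blast
qed

end

context absolute_sum
begin

text \<open>For \<open>\<alpha> \<rightarrow> 0\<close> this becomes \<open>\<kappa> \<le> numerical_radius Z T\<close>.  The error \<open>\<delta> = \<alpha>\<^sup>2\<close> in the duality of the
  compressed pairs is divided by \<open>\<alpha>\<close> in \<open>numerical_radius_approximate_states\<close>, which is why it has
  to be of smaller order than the error \<open>\<alpha>\<close> in the norm of \<open>T z\<close>.\<close>

lemma numerical_radius_lower_estimate:
  assumes E: "slices_in_duality C" "dentable_ball C" "truncations_dense"
    and nZ: "norming_functionals Z"
    and T: "bounded_linear_on Z Z T" "op_norm Z Z T = 1"
    and \<kappa>: "0 \<le> \<kappa>" "\<And>i. \<kappa> < numerical_index (X i)" and \<alpha>: "0 < \<alpha>" "\<alpha> < 1 / 2"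
  shows "\<kappa> * (1 - \<alpha>) \<le> (\<alpha> + numerical_radius Z T) / (1 - \<alpha> * numerical_radius Z T) + 4 * \<alpha>"
proof -
  have cT: "contraction_on Z Z T"
    using Z.contraction_onI_op_norm[OF T(1) _ normed_space_on_E_sum] T(2) by simp
  define \<delta> where "\<delta> = \<alpha>\<^sup>2"
  have "\<alpha> * \<alpha> < 1 * (1 / 2)" using \<alpha> by (intro mult_strict_mono) auto
  then have \<delta>: "0 < \<delta>" "\<delta> < 1 / 2" unfolding \<delta>_def using \<alpha> by (auto simp: power2_eq_square)
  define s where "s = 1 - \<alpha>"
  have s: "0 < s" "s < 1" unfolding s_def using \<alpha> by auto
  obtain z0 where z0: "z0 \<in> vcarrier Z" "vnorm Z z0 \<le> 1" "s < vnorm Z (T z0)"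
    using Z.op_norm_gt[of s Z T] T(2) s by auto
  have "\<forall>i. \<exists>u. u \<in> vcarrier (X i) \<and> vnorm (X i) u = 1 \<and> z0 i = vscale (X i) (of_real (vnorm (X i) (z0 i))) u"
    using X.exists_polar_unit_vector[OF nonzero] z0(1) by (simp add: Bex_def)
  then obtain u where u: "\<And>i. u i \<in> vcarrier (X i)" "\<And>i. vnorm (X i) (u i) = 1"
    "\<And>i. z0 i = vscale (X i) (of_real (vnorm (X i) (z0 i))) (u i)"
    by metis
  \<comment> \<open>the isometric copy of \<open>E\<close> in direction \<open>u\<close>, which contains \<open>z0\<close>\<close>
  define emb where "emb a = (\<lambda>i. vscale (X i) (of_real (a i)) (u i))" for a
  have emb: "contraction_on C (real_restriction Z) emb"
  proof (rule contraction_onI)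
    have mod: "(\<lambda>i. vnorm (X i) (emb a i)) = (\<lambda>i. \<bar>a i\<bar>)" for a
      unfolding emb_def by (simp add: X.norm_scale u)
    fix a assume a: "a \<in> vcarrier C"
    then have abs: "(\<lambda>i. \<bar>a i\<bar>) \<in> E" "N (\<lambda>i. \<bar>a i\<bar>) = N a"
      using sign[of a "\<lambda>i. \<bar>a i\<bar>"] N_sign[of a "\<lambda>i. \<bar>a i\<bar>"] by auto
    show "emb a \<in> vcarrier (real_restriction Z)" using abs(1) by (simp add: mod) (simp add: emb_def X.scale_closed u)
    show "vnorm (real_restriction Z) (emb a) \<le> vnorm C a" using abs(2) by (simp add: mod)
    show "emb (vadd C a b) = vadd (real_restriction Z) (emb a) (emb b)" for b
      unfolding emb_def by (simp add: X.add_scale u)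
    show "emb (vscale C c a) = vscale (real_restriction Z) c (emb a)" for c
      unfolding emb_def by (simp add: X.scale_scale u)
  qed
  have embZ: "emb a \<in> vcarrier Z" if "a \<in> E" for a using contraction_on_closed[OF emb] that by simp
  have Tr: "contraction_on (real_restriction Z) (real_restriction Z) T"
    using cT unfolding contraction_on_def bounded_linear_on_def by (simp del: E_sum_sel)
  have "normed_space_on (real_restriction Z)"
    by (rule normed_space_on_real_restriction[OF normed_space_on_E_sum])
  then have "norming_functionals (real_restriction Z)" by (rule norming_functionals_real)
  moreover have Tz0: "T z0 \<in> vcarrier Z" by (rule contraction_on_closed[OF cT z0(1)])
  ultimately obtain \<rho> where \<rho>: "\<rho> \<in> dual_ball (real_restriction Z)" "\<rho> (T z0) = vnorm Z (T z0)"
    unfolding norming_functionals_def by (auto simp del: E_sum_sel)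
  \<comment> \<open>A slice of \<open>g\<close> consists of vectors whose images under \<open>T \<circ> emb\<close> are large.  The functional \<open>\<rho>\<close> is only
    real linear, since \<open>E\<close> is a real space.\<close>
  define g where "g a = \<rho> (T (emb a))" for a
  have g: "contraction_on C scalar_space g"
    unfolding g_def using contraction_on_comp[OF contraction_on_comp[OF emb Tr]] \<rho>(1)
    unfolding dual_ball_contraction by blast
  define x0 where "x0 = (\<lambda>i. vnorm (X i) (z0 i))"
  have x0: "x0 \<in> E" "N x0 \<le> 1" unfolding x0_def using z0 by auto
  have "emb x0 = z0" unfolding emb_def x0_def using u(3) by (simp add: fun_eq_iff)
  then have "s < g x0" unfolding g_def using \<rho>(2) z0(3) by simp
  then have "slice g s \<noteq> {}" using x0 slice_iff by blast
  then have "\<exists>g' s'. functional g' \<and> slice g' s' \<noteq> {} \<and> slice g' s' \<subseteq> slice g s \<and>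
      (\<forall>x\<in>slice g' s'. \<forall>y\<in>slice g' s'. vdist C x y \<le> \<delta>)"
    using E(2) contraction_on_bounded_linear[OF g] \<delta>(1) unfolding dentable_ball_def by blast
  then obtain g' s' where g': "functional g'" "slice g' s' \<noteq> {}" and sub: "slice g' s' \<subseteq> slice g s"
    and diam: "\<And>x y. x \<in> slice g' s' \<Longrightarrow> y \<in> slice g' s' \<Longrightarrow> N (\<lambda>i. x i - y i) \<le> \<delta>"
    unfolding vdist_C by blast
  obtain x1 where x1: "x1 \<in> E" "N x1 \<le> 1" "s' < g' x1" using g'(2) by (auto simp: slice_iff)
  have "0 \<le> s'"
  proof (rule ccontr)
    assume "\<not> 0 \<le> s'"
    then have "(\<lambda>i. 0) \<in> slice g' s'" using zero N_zero functional_zero[OF g'(1)] by (simp add: slice_iff)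
    then have "s < g (\<lambda>i. 0)" using sub slice_iff by blast
    then show False using functional_zero[OF contraction_on_bounded_linear[OF g]] s by simp
  qed
  \<comment> \<open>Slices are open, so \<open>x1\<close> may be truncated; likewise \<open>T z\<close> below.\<close>
  obtain K where K: "K > 0" "\<forall>a\<in>E. \<bar>g' a\<bar> \<le> K * N a" using functional_bound[OF g'(1)] by blast
  obtain F where F: "finite F" "N (\<lambda>i. x1 i - restr F x1 i) < (g' x1 - s') / K"
    using E(3)[unfolded truncations_dense_def, rule_format, OF x1(1), of "(g' x1 - s') / K"] x1(3) K(1) by auto
  define x where "x = restr F x1"
  have x: "x \<in> E" "N x \<le> 1" unfolding x_def using restr_mem[OF x1(1)] N_restr_le[OF x1(1), of F] x1(2) by auto
  have xF: "restr F x = x" unfolding x_def restr_def by auto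
  have "\<bar>g' x1 - g' x\<bar> < g' x1 - s'"
  proof -
    have "\<bar>g' x1 - g' x\<bar> \<le> K * N (\<lambda>i. x1 i - x i)"
      using K(2)[rule_format, OF diff[OF x1(1) x(1)]] functional_diff[OF g'(1) x1(1) x(1)] by simp
    also have "\<dots> < g' x1 - s'" using F(2) K(1) unfolding x_def by (simp add: field_simps)
    finally show ?thesis .
  qed
  then have xs: "x \<in> slice g' s'" using x by (auto simp: slice_iff)
  define z where "z = emb x"
  have z: "z \<in> vcarrier Z" unfolding z_def by (rule embZ[OF x(1)])
  have Tz: "T z \<in> vcarrier Z" by (rule contraction_on_closed[OF cT z])
  define b where "b = (\<lambda>i. vnorm (X i) (T z i))"
  have b: "b \<in> E" unfolding b_def using Tz by simp
  have Nb: "s < N b"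
  proof -
    have "s < g x" using sub xs slice_iff by blast
    also have "\<dots> \<le> vnorm Z (T z)"
      unfolding g_def z_def[symmetric] using dual_ball_le[OF \<rho>(1), of "T z"] Tz by (simp del: E_sum_sel)
    finally show ?thesis unfolding b_def by simp
  qed
  obtain G0 where G0: "finite G0" "N (\<lambda>i. b i - restr G0 b i) < N b - s"
    using E(3)[unfolded truncations_dense_def, rule_format, OF b, of "N b - s"] Nb by auto
  define G where "G = G0 \<union> F"
  have G: "finite G" "F \<subseteq> G" unfolding G_def using G0 F by auto
  have rb: "restr G b \<in> E" by (rule restr_mem[OF b])
  have "N (\<lambda>i. b i - restr G b i) \<le> N (\<lambda>i. b i - restr G0 b i)"
    by (rule N_mono[OF diff[OF b restr_mem[OF b]]]) (auto simp: restr_def G_def)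
  then have Nrb: "s < N (restr G b)" using N_triangle_diff[OF b rb] G0(2) by simp
  have "\<exists>f\<in>dual_ball C. s < f (restr G b) \<and> (\<exists>i\<in>F. 1 - 2 * \<delta> \<le> \<bar>f (indicator {i}) * x i\<bar>)"
    by (rule concentrated_functional[OF E(1) g'(1) \<open>0 \<le> s'\<close> \<delta> diam xs F(1) xF rb less_imp_le[OF s(1)] Nrb])
  then obtain f i0 where f: "f \<in> dual_ball C" "s < f (restr G b)" and i0: "i0 \<in> F"
    and conc: "1 - 2 * \<delta> \<le> \<bar>f (indicator {i0}) * x i0\<bar>" by blast
  define \<phi> where "\<phi> i = f (indicator {i})" for i
  have fb: "s < (\<Sum>i\<in>G. \<phi> i * b i)"
    using f dual_finite_support[OF f(1) G(1), of b] unfolding \<phi>_def by simp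
  have i0G: "i0 \<in> G" using i0 G by blast
  have "\<forall>i. \<exists>y h. (y, h) \<in> numerical_states (X i) \<and> h (T z i) = of_real (b i)"
    using X.exists_norming_pair[OF norming nonzero] Tz unfolding b_def by simp
  then obtain y h where yh: "\<And>i. (y i, h i) \<in> numerical_states (X i)" "\<And>i. h i (T z i) = of_real (b i)"
    by metis
  have y: "y i \<in> vcarrier (X i)" "vnorm (X i) (y i) = 1" and h: "h i \<in> dual_ball (X i)" "h i (y i) = 1" for i
    using yh(1)[of i] X.numerical_states_iff by auto
  obtain q where q: "q \<in> dual_ball (X i0)" "q (u i0) = 1"
    using X.exists_state[OF norming u(1,2)] X.numerical_states_iff by blast
  \<comment> \<open>\<open>X i0\<close> is embedded so that \<open>u i0\<close> goes to \<open>z\<close>; \<open>\<Psi>\<close> folds \<open>Z\<close> onto \<open>X i0\<close> so that \<open>h i0\<close> is pulled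
    back to \<open>\<Sum>i\<in>G. \<phi> i * h i\<close>.\<close>
  define \<Phi> where "\<Phi> \<xi> = (\<lambda>i. if i = i0 then vscale (X i) (of_real (x i)) \<xi>
    else vscale (X i) (of_real (x i) * q \<xi>) (u i))" for \<xi>
  define \<psi> where "\<psi> w = (\<Sum>i\<in>G - {i0}. of_real (\<phi> i) * h i (w i))" for w
  define \<Psi> where "\<Psi> w = vadd (X i0) (vscale (X i0) (of_real (\<phi> i0)) (w i0)) (vscale (X i0) (\<psi> w) (y i0))" for w
  have \<Phi>: "contraction_on (X i0) Z \<Phi>"
  proof (rule contraction_onI)
    fix \<xi> assume \<xi>: "\<xi> \<in> vcarrier (X i0)"
    have c: "\<Phi> \<xi> i \<in> vcarrier (X i)" for i using \<xi> u unfolding \<Phi>_def by (simp add: X.scale_closed)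
    have le: "\<bar>vnorm (X i) (\<Phi> \<xi> i)\<bar> \<le> \<bar>vnorm (X i0) \<xi> * x i\<bar>" for i
    proof -
      have "vnorm (X i) (\<Phi> \<xi> i) \<le> \<bar>x i\<bar> * vnorm (X i0) \<xi>"
        using \<xi> u dual_ball_le[OF q(1) \<xi>] unfolding \<Phi>_def by (auto simp: X.norm_scale norm_mult mult_left_mono)
      then show ?thesis using X.norm_nonneg[OF c] X.norm_nonneg[OF \<xi>] by (simp add: abs_mult mult.commute)
    qed
    have E': "(\<lambda>i. vnorm (X i0) \<xi> * x i) \<in> E" by (rule scale[OF x(1)])
    show "\<Phi> \<xi> \<in> vcarrier Z" using c solid[OF E' le] by simp
    have "N (\<lambda>i. vnorm (X i) (\<Phi> \<xi> i)) \<le> vnorm (X i0) \<xi> * N x"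
      using N_mono[OF E' le] N_scale[OF x(1)] X.norm_nonneg[OF \<xi>] by simp
    also have "\<dots> \<le> vnorm (X i0) \<xi>" using x(2) X.norm_nonneg[OF \<xi>] by (rule mult_left_le)
    finally show "vnorm Z (\<Phi> \<xi>) \<le> vnorm (X i0) \<xi>" by simp
    show "\<Phi> (vscale (X i0) c \<xi>) = vscale Z c (\<Phi> \<xi>)" for c
      using \<xi> u unfolding \<Phi>_def by (auto simp: X.scale_scale dual_ball_scale[OF q(1)] ac_simps)
    show "\<Phi> (vadd (X i0) \<xi> \<xi>') = vadd Z (\<Phi> \<xi>) (\<Phi> \<xi>')" if "\<xi>' \<in> vcarrier (X i0)" for \<xi>'
      using \<xi> that u unfolding \<Phi>_def
      by (auto simp: X.scale_add dual_ball_add[OF q(1)] distrib_left X.add_scale)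
  qed
  have \<Psi>: "contraction_on Z (X i0) \<Psi>"
  proof (rule contraction_onI)
    fix w assume w: "w \<in> vcarrier Z"
    have wi: "w i \<in> vcarrier (X i)" for i using w by simp
    show "\<Psi> w \<in> vcarrier (X i0)" unfolding \<Psi>_def using wi y by (simp add: X.add_closed X.scale_closed)
    have "norm (\<psi> w) \<le> (\<Sum>i\<in>G - {i0}. \<bar>\<phi> i\<bar> * vnorm (X i) (w i))"
      unfolding \<psi>_def using dual_ball_le[OF h(1) wi]
      by (intro sum_norm_le) (simp add: norm_mult mult_left_mono)
    moreover have "vnorm (X i0) (\<Psi> w) \<le> vnorm (X i0) (vscale (X i0) (of_real (\<phi> i0)) (w i0))
        + vnorm (X i0) (vscale (X i0) (\<psi> w) (y i0))"
      unfolding \<Psi>_def by (intro X.norm_triangle X.scale_closed wi y)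
    ultimately have "vnorm (X i0) (\<Psi> w) \<le> \<bar>\<phi> i0\<bar> * vnorm (X i0) (w i0)
        + (\<Sum>i\<in>G - {i0}. \<bar>\<phi> i\<bar> * vnorm (X i) (w i))"
      using X.norm_scale[OF wi, of i0 "of_real (\<phi> i0)"] X.norm_scale[OF y(1), of i0 "\<psi> w"] y(2)[of i0] by simp
    also have "\<dots> = (\<Sum>i\<in>G. \<bar>f (indicator {i})\<bar> * \<bar>vnorm (X i) (w i)\<bar>)"
      using G(1) i0G X.norm_nonneg[OF wi] by (simp add: sum.remove \<phi>_def)
    also have "\<dots> \<le> N (\<lambda>i. vnorm (X i) (w i))" using w by (intro dual_abs_sum_le[OF f(1) G(1)]) simp
    finally show "vnorm (X i0) (\<Psi> w) \<le> vnorm Z w" by simp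
    have "\<psi> (vscale Z c w) = c * \<psi> w" for c
      unfolding \<psi>_def sum_distrib_left using dual_ball_scale[OF h(1) wi] by (simp add: mult.left_commute)
    then show "\<Psi> (vscale Z c w) = vscale (X i0) c (\<Psi> w)" for c
      unfolding \<Psi>_def using wi y
      by (simp add: X.scale_add X.scale_scale X.scale_closed mult.commute del: E_sum_sel) (simp add: X.scale_scale mult.commute)
    fix w' assume w': "w' \<in> vcarrier Z"
    then have wi': "w' i \<in> vcarrier (X i)" for i by simp
    have "\<psi> (vadd Z w w') = \<psi> w + \<psi> w'"
      unfolding \<psi>_def sum.distrib[symmetric] using dual_ball_add[OF h(1) wi wi'] by (simp add: distrib_left)
    then show "\<Psi> (vadd Z w w') = vadd (X i0) (\<Psi> w) (\<Psi> w')"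
      unfolding \<Psi>_def using wi wi' y
      by (simp add: X.scale_add X.add_scale X.add_interchange X.scale_closed)
  qed
  have h\<Psi>: "k (\<Psi> w) = of_real (\<phi> i0) * k (w i0) + \<psi> w * k (y i0)"
    if k: "k \<in> dual_ball (X i0)" and w: "w \<in> vcarrier Z" for k w
    unfolding \<Psi>_def using w y
    by (simp add: dual_ball_add[OF k] dual_ball_scale[OF k] X.scale_closed)
  define S where "S \<xi> = \<Psi> (T (\<Phi> \<xi>))" for \<xi>
  have S: "contraction_on (X i0) (X i0) S"
    unfolding S_def by (intro contraction_on_comp[OF contraction_on_comp[OF \<Phi> cT] \<Psi>])
  have "\<Phi> (u i0) = z" unfolding \<Phi>_def z_def emb_def using q(2) by auto
  then have "h i0 (S (u i0)) = of_real (\<phi> i0) * of_real (b i0) + \<psi> (T z)"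
    unfolding S_def using h\<Psi>[OF h(1) Tz] yh(2) h(2) by simp
  also have "\<dots> = of_real (\<Sum>i\<in>G. \<phi> i * b i)"
    unfolding \<psi>_def using G(1) i0G yh(2) by (simp add: sum.remove)
  finally have "s < norm (h i0 (S (u i0)))" using fb s(1) by (simp only: norm_of_real)
  also have "\<dots> \<le> vnorm (X i0) (S (u i0))" by (rule dual_ball_le[OF h(1) contraction_on_closed[OF S u(1)]])
  also have "\<dots> \<le> op_norm (X i0) (X i0) S"
    using X.op_norm_upper[OF contraction_on_bounded_linear[OF S] u(1)] u(2) by simp
  finally have opS: "s < op_norm (X i0) (X i0) S" .
  obtain \<xi> k where st: "(\<xi>, k) \<in> numerical_states (X i0)" "\<kappa> * op_norm (X i0) (X i0) S < norm (k (S \<xi>))"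
    using X.numerical_index_attained[OF nonzero norming contraction_on_bounded_linear[OF S] _ \<kappa>(2)] opS s by auto
  have \<xi>: "\<xi> \<in> vcarrier (X i0)" "vnorm (X i0) \<xi> = 1" and k: "k \<in> dual_ball (X i0)" "k \<xi> = 1"
    using st(1) X.numerical_states_iff by auto
  define t where "t = \<phi> i0 * x i0"
  have t: "1 - 2 * \<delta> \<le> \<bar>t\<bar>" using conc unfolding t_def \<phi>_def .
  have sum: "(\<Sum>i\<in>G. \<bar>\<phi> i\<bar> * \<bar>x i\<bar>) \<le> 1"
    using dual_abs_sum_le[OF f(1) G(1) x(1)] x(2) unfolding \<phi>_def by simp
  then have rest: "\<bar>t\<bar> + (\<Sum>i\<in>G - {i0}. \<bar>\<phi> i\<bar> * \<bar>x i\<bar>) \<le> 1"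
    using G(1) i0G by (simp add: sum.remove t_def abs_mult)
  have "0 \<le> (\<Sum>i\<in>G - {i0}. \<bar>\<phi> i\<bar> * \<bar>x i\<bar>)" by (intro sum_nonneg) simp
  then have t1: "\<bar>t\<bar> \<le> 1" using rest by simp
  define l where "l = (\<lambda>w. of_real (sgn t) * k (\<Psi> w))"
  have l: "l \<in> dual_ball Z"
  proof -
    have kk: "(\<lambda>w. k (\<Psi> w)) \<in> dual_ball Z"
      using contraction_on_comp[OF \<Psi>] k(1) unfolding dual_ball_contraction by blast
    have "\<bar>sgn t\<bar> \<le> 1" by (simp add: abs_sgn_eq)
    then have "norm (l w) \<le> vnorm Z w" if "w \<in> vcarrier Z" for w
      unfolding l_def norm_mult norm_of_real
      by (rule order_trans[OF mult_left_le_one_le[OF norm_ge_zero abs_ge_zero] dual_ball_le[OF kk that]])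
    then show ?thesis
      by (intro dual_ballI)
        (simp_all only: l_def dual_ball_add[OF kk] dual_ball_scale[OF kk] distrib_left mult.left_commute)
  qed
  have \<Phi>\<xi>: "\<Phi> \<xi> \<in> vcarrier Z" "vnorm Z (\<Phi> \<xi>) \<le> 1"
    using contraction_on_closed[OF \<Phi> \<xi>(1)] contraction_on_le[OF \<Phi> \<xi>(1)] \<xi>(2) by auto
  have "norm (l (\<Phi> \<xi>) - 1) \<le> 4 * \<delta>"
  proof -
    have "norm (\<psi> (\<Phi> \<xi>)) \<le> (\<Sum>i\<in>G - {i0}. \<bar>\<phi> i\<bar> * \<bar>x i\<bar>)"
      unfolding \<psi>_def
    proof (rule sum_norm_le)
      fix i assume "i \<in> G - {i0}"
      then have "h i (\<Phi> \<xi> i) = of_real (x i) * q \<xi> * h i (u i)"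
        unfolding \<Phi>_def using dual_ball_scale[OF h(1) u(1)] by simp
      moreover have "norm (q \<xi>) \<le> 1" using dual_ball_le[OF q(1) \<xi>(1)] \<xi>(2) by simp
      moreover have "norm (h i (u i)) \<le> 1" using dual_ball_le[OF h(1) u(1)] u(2) by simp
      ultimately have "norm (h i (\<Phi> \<xi> i)) \<le> \<bar>x i\<bar>"
        by (simp add: norm_mult mult.assoc mult_left_le mult_le_one)
      then show "norm (of_real (\<phi> i) * h i (\<Phi> \<xi> i)) \<le> \<bar>\<phi> i\<bar> * \<bar>x i\<bar>"
        by (simp add: norm_mult mult_left_mono)
    qed
    moreover have "norm (k (y i0)) \<le> 1" using dual_ball_le[OF k(1) y(1)] y(2)[of i0] by simp
    ultimately have "norm (\<psi> (\<Phi> \<xi>) * k (y i0)) \<le> 2 * \<delta>"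
      using rest t mult_left_le[of "norm (k (y i0))" "norm (\<psi> (\<Phi> \<xi>))"] by (simp add: norm_mult)
    moreover have "k (\<Psi> (\<Phi> \<xi>)) = of_real t + \<psi> (\<Phi> \<xi>) * k (y i0)"
      unfolding h\<Psi>[OF k(1) \<Phi>\<xi>(1)] t_def using k(2) dual_ball_scale[OF k(1) \<xi>(1)] by (simp add: \<Phi>_def)
    then have "l (\<Phi> \<xi>) - 1 = of_real (\<bar>t\<bar> - 1) + of_real (sgn t) * (\<psi> (\<Phi> \<xi>) * k (y i0))"
      unfolding l_def by (simp add: algebra_simps abs_sgn flip: of_real_mult)
    then have "norm (l (\<Phi> \<xi>) - 1) \<le> norm (of_real (\<bar>t\<bar> - 1) :: 'k) + norm (of_real (sgn t) * (\<psi> (\<Phi> \<xi>) * k (y i0)))"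
      by (simp only: norm_triangle_ineq)
    moreover have "norm (of_real (\<bar>t\<bar> - 1) :: 'k) \<le> 2 * \<delta>" unfolding norm_of_real using t t1 by simp
    moreover have "norm (of_real (sgn t) * (\<psi> (\<Phi> \<xi>) * k (y i0))) \<le> norm (\<psi> (\<Phi> \<xi>) * k (y i0))"
      by (simp add: norm_mult abs_sgn_eq)
    ultimately show ?thesis by linarith
  qed
  from Z.numerical_radius_approximate_states[OF nonzero_E_sum nZ T(1) _ \<Phi>\<xi> l this \<alpha>(1)]
  have "norm (l (T (\<Phi> \<xi>))) \<le> (\<alpha> + numerical_radius Z T) / (1 - \<alpha> * numerical_radius Z T) + 4 * \<delta> / \<alpha>"
    using T(2) \<alpha> by simp
  moreover have "4 * \<delta> / \<alpha> = 4 * \<alpha>" unfolding \<delta>_def using \<alpha> by (simp add: power2_eq_square)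
  moreover have "norm (l (T (\<Phi> \<xi>))) = norm (k (S \<xi>))"
    unfolding l_def S_def using t \<delta> by (auto simp: norm_mult sgn_if)
  moreover have "\<kappa> * (1 - \<alpha>) \<le> \<kappa> * op_norm (X i0) (X i0) S"
    using opS \<kappa>(1) unfolding s_def by (intro mult_left_mono) auto
  ultimately show ?thesis using st(2) by linarith
qed

theorem numerical_index_E_sum:
  assumes E: "slices_in_duality C" "dentable_ball C" "truncations_dense"
    and nZ: "norming_functionals Z"
  shows "numerical_index Z = (INF i. numerical_index (X i))"
proof (rule antisym)
  show "numerical_index Z \<le> (INF i. numerical_index (X i))"
    by (rule cINF_greatest) (auto intro: numerical_index_E_sum_le[OF nZ])
  have bdd: "bdd_below (range (\<lambda>i. numerical_index (X i)))"
    using X.numerical_index_nonneg[OF nonzero norming] by (intro bdd_belowI2)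
  show "(INF i. numerical_index (X i)) \<le> numerical_index Z"
  proof (rule Z.numerical_index_greatest[OF nonzero_E_sum])
    fix T assume T: "bounded_linear_on Z Z T" "op_norm Z Z T = 1"
    define v where "v = numerical_radius Z T"
    have v0: "0 \<le> v" unfolding v_def by (rule Z.numerical_radius_nonneg[OF nonzero_E_sum nZ T(1)])
    have "\<kappa> \<le> v" if \<kappa>: "\<kappa> < (INF i. numerical_index (X i))" for \<kappa>
    proof (cases "0 \<le> \<kappa>")
      case False
      then show ?thesis using v0 by simp
    next
      case True
      have \<kappa>i: "\<kappa> < numerical_index (X i)" for i using \<kappa> cINF_lower[OF bdd, of i] by simp
      have "((\<lambda>\<alpha>. \<kappa> * (1 - \<alpha>)) \<longlongrightarrow> \<kappa> * (1 - 0)) (at_right 0)" by (intro tendsto_intros)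
      moreover have "((\<lambda>\<alpha>. (\<alpha> + v) / (1 - \<alpha> * v) + 4 * \<alpha>) \<longlongrightarrow> (0 + v) / (1 - 0 * v) + 4 * 0) (at_right 0)"
        by (intro tendsto_intros) auto
      moreover have "\<forall>\<^sub>F \<alpha> in at_right 0. \<kappa> * (1 - \<alpha>) \<le> (\<alpha> + v) / (1 - \<alpha> * v) + 4 * \<alpha>"
        unfolding eventually_at_right_field v_def
        using numerical_radius_lower_estimate[OF E nZ T True \<kappa>i] by (intro exI[of _ "1 / 2"]) auto
      ultimately have "\<kappa> * (1 - 0) \<le> (0 + v) / (1 - 0 * v) + 4 * 0"
        by (intro tendsto_le[of "at_right (0::real)"]) auto
      then show ?thesis by simp
    qed
    then show "(INF i. numerical_index (X i)) \<le> numerical_radius Z T"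
      unfolding v_def by (rule dense_le)
  qed
qed

end

section \<open>Dentability\<close>

lemma (in absolute_space) subslice_with_small_coordinates:
  assumes g: "functional g" and x: "x \<in> slice g s" and J: "finite J" and d: "0 < d"
  shows "\<exists>g' s'. functional g' \<and> slice g' s' \<noteq> {} \<and> slice g' s' \<subseteq> slice g s \<and>
    (\<forall>y\<in>slice g' s'. \<forall>z\<in>slice g' s'. \<forall>i\<in>J. \<bar>y i - z i\<bar> \<le> d)"
proof -
  obtain K where K: "K > 0" "\<forall>a\<in>E. \<bar>g a\<bar> \<le> K * N a" using functional_bound[OF g] by blast
  define B where "B = {x \<in> E. N x \<le> 1}"
  have gK: "\<bar>g a\<bar> \<le> K" if "a \<in> B" for a
  proof -
    have a: "a \<in> E" "N a \<le> 1" using that unfolding B_def by auto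
    have "K * N a \<le> K" using mult_left_le[of "N a" K] a(2) K(1) by simp
    then show ?thesis using K(2)[rule_format, OF a(1)] by linarith
  qed
  have "\<exists>R c s' p. p \<in> B \<and> R * g p + (\<Sum>i\<in>J. c i * p i) > s' \<and>
     (\<forall>x\<in>B. R * g x + (\<Sum>i\<in>J. c i * x i) > s' \<longrightarrow> g x > s \<and> (\<forall>i\<in>J. \<bar>x i - p i\<bar> \<le> d / 2))"
  proof (rule subslice_with_small_oscillation[where w = x and \<phi> = "\<lambda>i x. x i" and K = "max K 1"])
    show "finite J" "0 < d / 2" "s < g x" "x \<in> B" using J d x by (auto simp: slice_iff B_def)
    show "g a \<le> max K 1" if "a \<in> B" for a using gK[OF that] by simp
    show "\<bar>a i\<bar> \<le> max K 1" if "a \<in> B" for a i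
      using coordinate_le[of a i] that unfolding B_def max_def by auto
  qed
  then obtain R c s' p where p: "p \<in> B" "R * g p + (\<Sum>i\<in>J. c i * p i) > s'"
    and sub: "\<And>x. x \<in> B \<Longrightarrow> R * g x + (\<Sum>i\<in>J. c i * x i) > s' \<Longrightarrow> g x > s \<and> (\<forall>i\<in>J. \<bar>x i - p i\<bar> \<le> d / 2)"
    by blast
  define g' where "g' x = R * g x + (\<Sum>i\<in>J. c i * x i)" for x
  have "functional g'"
  proof (rule functionalI)
    show "g' (\<lambda>i. a i + b i) = g' a + g' b" if "a \<in> E" "b \<in> E" for a b
      unfolding g'_def using functional_add[OF g that] by (simp add: distrib_left sum.distrib)
    show "g' (\<lambda>i. t * a i) = t * g' a" if "a \<in> E" for a t
      unfolding g'_def using functional_scale[OF g that] by (simp add: distrib_left sum_distrib_left mult.left_commute)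
    show "\<bar>g' a\<bar> \<le> (\<bar>R\<bar> * K + (\<Sum>i\<in>J. \<bar>c i\<bar>)) * N a" if a: "a \<in> E" for a
    proof -
      have "\<bar>R * g a\<bar> \<le> \<bar>R\<bar> * (K * N a)" using K a by (simp add: abs_mult mult_left_mono)
      moreover have "\<bar>\<Sum>i\<in>J. c i * a i\<bar> \<le> (\<Sum>i\<in>J. \<bar>c i\<bar> * N a)"
        by (rule order_trans[OF sum_abs sum_mono]) (simp add: abs_mult mult_left_mono coordinate_le[OF a])
      moreover have "(\<bar>R\<bar> * K + (\<Sum>i\<in>J. \<bar>c i\<bar>)) * N a = \<bar>R\<bar> * K * N a + (\<Sum>i\<in>J. \<bar>c i\<bar> * N a)"
        by (simp only: distrib_right sum_distrib_right)
      ultimately show ?thesis unfolding g'_def by (simp only: mult.assoc)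
    qed
  qed
  moreover have "p \<in> slice g' s'" using p unfolding B_def g'_def slice_iff by auto
  moreover have *: "y \<in> slice g s \<and> (\<forall>i\<in>J. \<bar>y i - p i\<bar> \<le> d / 2)" if "y \<in> slice g' s'" for y
    using sub[of y] that unfolding slice_iff B_def g'_def by auto
  moreover have "\<bar>y i - z i\<bar> \<le> d" if "y \<in> slice g' s'" "z \<in> slice g' s'" "i \<in> J" for y z i
  proof -
    have "\<bar>y i - p i\<bar> \<le> d / 2" "\<bar>z i - p i\<bar> \<le> d / 2" using * that by auto
    then show ?thesis by linarith
  qed
  ultimately show ?thesis by (intro exI[of _ g'] exI[of _ s']) blast
qed

lemma (in absolute_space) dentable_ball_finite:
  assumes fin: "finite (UNIV :: 'i set)"
  shows "dentable_ball C"
  unfolding dentable_ball_def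
proof (intro allI impI, elim conjE)
  fix g s and d :: real assume g: "functional g" and ne: "slice g s \<noteq> {}" and d: "0 < d"
  define r where "r = d / (real (card (UNIV :: 'i set)) + 1)"
  have r: "r > 0" unfolding r_def using d by simp
  obtain x where "x \<in> slice g s" using ne by blast
  from subslice_with_small_coordinates[OF g this fin r]
  obtain g' s' where g': "functional g'" "slice g' s' \<noteq> {}" "slice g' s' \<subseteq> slice g s"
    and sub: "\<And>y z i. y \<in> slice g' s' \<Longrightarrow> z \<in> slice g' s' \<Longrightarrow> \<bar>y i - z i\<bar> \<le> r"
    by blast
  have "vdist C y z \<le> d" if "y \<in> slice g' s'" "z \<in> slice g' s'" for y z
  proof -
    have "restr UNIV (\<lambda>i. y i - z i) = (\<lambda>i. y i - z i)" unfolding restr_def by simp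
    then have "N (\<lambda>i. y i - z i) \<le> (\<Sum>i\<in>UNIV. \<bar>y i - z i\<bar>)"
      using finite_support[OF fin, of "\<lambda>i. y i - z i"] by simp
    also have "\<dots> \<le> (\<Sum>i\<in>(UNIV::'i set). r)" by (intro sum_mono sub that)
    also have "\<dots> \<le> d" unfolding r_def using d by (simp add: field_simps)
    finally show ?thesis by (simp add: vdist_C)
  qed
  then show "\<exists>g' s'. functional g' \<and> slice g' s' \<noteq> {} \<and> slice g' s' \<subseteq> slice g s \<and>
      (\<forall>x\<in>slice g' s'. \<forall>y\<in>slice g' s'. vdist C x y \<le> d)"
    using g' by blast
qed

lemma (in absolute_space) truncations_dense_finite:
  assumes fin: "finite (UNIV :: 'i set)"
  shows "truncations_dense"
  unfolding truncations_dense_def using fin N_zero by (auto intro!: exI[of _ UNIV] simp: restr_def)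

locale sequence_space = absolute_space E N
  for E :: "(nat \<Rightarrow> real) set" and N :: "(nat \<Rightarrow> real) \<Rightarrow> real" +
  assumes truncation_tendsto: "a \<in> E \<Longrightarrow> (\<lambda>n. N (\<lambda>i. a i - restr {..<n} a i)) \<longlonglongrightarrow> 0"

lemma (in sequence_space) truncations_dense: "truncations_dense"
  unfolding truncations_dense_def
proof (intro ballI allI impI)
  fix a and \<epsilon> :: real assume "a \<in> E" "\<epsilon> > 0"
  then have "\<forall>\<^sub>F n in sequentially. N (\<lambda>i. a i - restr {..<n} a i) < \<epsilon>"
    using truncation_tendsto order_tendstoD(2) by blast
  then obtain n where "N (\<lambda>i. a i - restr {..<n} a i) < \<epsilon>" using eventually_happens'[OF sequentially_bot] by blast
  then show "\<exists>F. finite F \<and> N (\<lambda>i. a i - restr F a i) < \<epsilon>" by (intro exI[of _ "{..<n}"]) simp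
qed

locale boundedly_complete_space = sequence_space E N
  for E :: "(nat \<Rightarrow> real) set" and N :: "(nat \<Rightarrow> real) \<Rightarrow> real" +
  assumes boundedly_complete: "(\<And>n. N (restr {..<n} a) \<le> K) \<Longrightarrow> a \<in> E"
    and separable: "\<exists>p. range p \<subseteq> E \<and> (\<forall>a\<in>E. \<forall>\<epsilon>>0. \<exists>k::nat. N (\<lambda>i. a i - p k i) < \<epsilon>)"
begin

text \<open>A point \<open>q\<close> of large distance to \<open>p\<close> is taken from the slice of \<open>g\<close> at a level close to the supremum \<open>M\<close>, and
  a functional \<open>h\<close> of norm at most one that depends on finitely many coordinates and separates \<open>q\<close> from \<open>p\<close>.
  In the slice of \<open>g + \<kappa> h\<close> at the level \<open>M - \<kappa> d / 4 + \<kappa> h q\<close> the inequality \<open>g \<le> M\<close> leaves \<open>h\<close> no room to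
  drop below \<open>h q - d / 4\<close>, so its points stay away from \<open>p\<close>.  The choice of \<open>\<kappa>\<close> keeps it inside the slice of
  \<open>g\<close> at the level \<open>s\<close>.  That the distance is bounded below after truncation makes the bound stable
  under coordinatewise limits.\<close>

lemma slice_away_from_point:
  assumes g: "functional g" and ne: "slice g s \<noteq> {}" and d: "0 < d"
    and big: "\<And>s'. s \<le> s' \<Longrightarrow> slice g s' \<noteq> {} \<Longrightarrow> \<exists>x\<in>slice g s'. \<exists>y\<in>slice g s'. d < N (\<lambda>i. x i - y i)"
    and p: "p \<in> E"
  shows "\<exists>g' s' m. functional g' \<and> slice g' s' \<noteq> {} \<and> slice g' s' \<subseteq> slice g s \<and>
    (\<forall>x\<in>slice g' s'. d / 4 < N (restr {..<m} (\<lambda>i. x i - p i)))"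
proof -
  define B where "B = {x \<in> E. N x \<le> 1}"
  have BE: "x \<in> E" if "x \<in> B" for x using that unfolding B_def by simp
  obtain K where K: "K > 0" "\<forall>a\<in>E. \<bar>g a\<bar> \<le> K * N a" using functional_bound[OF g] by blast
  have gK: "\<bar>g a\<bar> \<le> K" if "a \<in> B" for a
  proof -
    have a: "a \<in> E" "N a \<le> 1" using that unfolding B_def by auto
    have "K * N a \<le> K" using mult_left_le[of "N a" K] a(2) K(1) by simp
    then show ?thesis using K(2)[rule_format, OF a(1)] by linarith
  qed
  define M where "M = Sup (g ` B)"
  have bdd: "bdd_above (g ` B)" using gK by (intro bdd_aboveI2[of _ _ K]) fastforce
  have neB: "g ` B \<noteq> {}" using ne unfolding B_def by (auto simp: slice_iff)
  have gM: "g a \<le> M" if "a \<in> B" for a unfolding M_def using that bdd by (intro cSup_upper) auto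
  have M: "\<exists>x\<in>B. r < g x" if "r < M" for r
    using less_cSup_iff[OF neB bdd, of r] that unfolding M_def by auto
  obtain x0 where "x0 \<in> slice g s" using ne by blast
  then have "x0 \<in> B" "s < g x0" unfolding B_def slice_iff by auto
  then have sM: "s < M" using gM[of x0] by linarith
  define \<kappa> where "\<kappa> = (M - s) / (2 + d / 4)"
  have "\<kappa> * (2 + d / 4) = M - s" unfolding \<kappa>_def using d by simp
  then have "\<kappa> * d / 4 + 2 * \<kappa> = M - s" by (simp add: distrib_left)
  moreover have "\<kappa> > 0" unfolding \<kappa>_def using sM d by (simp add: add_pos_pos)
  ultimately have \<kappa>: "\<kappa> > 0" "\<kappa> * d / 4 + 2 * \<kappa> = M - s" by auto
  have "M - \<kappa> * d / 4 < M" using \<kappa> d by simp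
  then have "slice g (M - \<kappa> * d / 4) \<noteq> {}" using M[of "M - \<kappa> * d / 4"] unfolding B_def by (auto simp: slice_iff)
  moreover have "s \<le> M - \<kappa> * d / 4" using \<kappa> by linarith
  ultimately obtain x y where xy: "x \<in> E" "y \<in> E" "N x \<le> 1" "N y \<le> 1" "M - \<kappa> * d / 4 < g x"
    "M - \<kappa> * d / 4 < g y" "d < N (\<lambda>i. x i - y i)" using big[of "M - \<kappa> * d / 4"] by (auto simp: slice_iff)
  have "N (\<lambda>i. x i - y i) \<le> N (\<lambda>i. x i - p i) + N (\<lambda>i. y i - p i)"
    using N_triangle[OF diff[OF xy(1) p] diff[OF p xy(2)]] N_diff_commute[OF p xy(2)] by simp
  then have "d / 2 < N (\<lambda>i. x i - p i) \<or> d / 2 < N (\<lambda>i. y i - p i)" using xy(7) by linarith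
  then obtain q where q: "q \<in> E" "N q \<le> 1" "M - \<kappa> * d / 4 < g q" "d / 2 < N (\<lambda>i. q i - p i)"
    using xy by blast
  have qp: "(\<lambda>i. q i - p i) \<in> E" by (rule diff[OF q(1) p])
  have "\<forall>\<^sub>F n in sequentially. N (\<lambda>i. (q i - p i) - restr {..<n} (\<lambda>i. q i - p i) i) < N (\<lambda>i. q i - p i) - d / 2"
    using truncation_tendsto[OF qp] q(4) by (intro order_tendstoD(2)) auto
  then obtain m where m: "N (\<lambda>i. (q i - p i) - restr {..<m} (\<lambda>i. q i - p i) i) < N (\<lambda>i. q i - p i) - d / 2"
    using eventually_happens'[OF sequentially_bot] by blast
  have Nm: "d / 2 < N (restr {..<m} (\<lambda>i. q i - p i))"
    using m N_triangle_diff[OF qp restr_mem[OF qp], of "{..<m}"] by simp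
  obtain h0 where h0: "h0 \<in> dual_ball C" "h0 (restr {..<m} (\<lambda>i. q i - p i)) = N (restr {..<m} (\<lambda>i. q i - p i))"
    using norming_functionals_real[OF normed] restr_mem[OF qp, of "{..<m}"] unfolding norming_functionals_def by auto
  define h where "h a = h0 (restr {..<m} a)" for a
  have hadd: "h (\<lambda>i. a i + b i) = h a + h b" if "a \<in> E" "b \<in> E" for a b
  proof -
    have "restr {..<m} (\<lambda>i. a i + b i) = (\<lambda>i. restr {..<m} a i + restr {..<m} b i)" by (auto simp: restr_def)
    then show ?thesis unfolding h_def using dual_add[OF h0(1) restr_mem[OF that(1)] restr_mem[OF that(2)]] by simp
  qed
  have hscale: "h (\<lambda>i. t * a i) = t * h a" if "a \<in> E" for a t
  proof -
    have "restr {..<m} (\<lambda>i. t * a i) = (\<lambda>i. t * restr {..<m} a i)" by (auto simp: restr_def)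
    then show ?thesis unfolding h_def using dual_scale[OF h0(1) restr_mem[OF that]] by simp
  qed
  have hdiff: "h (\<lambda>i. a i - b i) = h a - h b" if "a \<in> E" "b \<in> E" for a b
    using hadd[OF that(1) scale[OF that(2)], of "-1"] hscale[OF that(2), of "-1"] by simp
  have hle: "\<bar>h a\<bar> \<le> N (restr {..<m} a)" if "a \<in> E" for a
    unfolding h_def by (rule dual_le[OF h0(1) restr_mem[OF that]])
  have hle': "\<bar>h a\<bar> \<le> N a" if "a \<in> E" for a
    using hle[OF that] N_restr_le[OF that, of "{..<m}"] by linarith
  define G where "G a = g a + \<kappa> * h a" for a
  define S where "S = M - \<kappa> * d / 4 + \<kappa> * h q"
  have Gq: "S < G q" unfolding S_def G_def using q(3) by simp
  have inside: "s < g a \<and> d / 4 < N (restr {..<m} (\<lambda>i. a i - p i))" if a: "a \<in> B" "S < G a" for a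
  proof
    have aE: "a \<in> E" using a unfolding B_def by simp
    have "\<kappa> * h q - \<kappa> * d / 4 < \<kappa> * h a" using gM[OF a(1)] a(2) unfolding S_def G_def by linarith
    then have "\<kappa> * (h q - d / 4) < \<kappa> * h a" by (simp add: right_diff_distrib)
    then have "h q - d / 4 < h a" using \<kappa>(1) by (simp only: mult_less_cancel_left_pos)
    moreover have "d / 2 < h q - h p"
      using Nm h0(2) hdiff[OF q(1) p] unfolding h_def by simp
    ultimately have "d / 4 < h (\<lambda>i. a i - p i)" using hdiff[OF aE p] by simp
    then show "d / 4 < N (restr {..<m} (\<lambda>i. a i - p i))" using hle[OF diff[OF aE p]] by linarith
    have "\<bar>h q\<bar> \<le> 1" "\<bar>h a\<bar> \<le> 1" using hle'[OF q(1)] q(2) hle'[OF aE] a(1) unfolding B_def by auto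
    then have "\<kappa> * h a \<le> \<kappa> * 1" "\<kappa> * (- 1) \<le> \<kappa> * h q" using \<kappa>(1) by (intro mult_left_mono; simp)+
    then show "s < g a" using a(2) \<kappa>(2) unfolding S_def G_def by linarith
  qed
  have "functional G"
  proof (rule functionalI)
    show "G (\<lambda>i. a i + b i) = G a + G b" if "a \<in> E" "b \<in> E" for a b
      unfolding G_def using functional_add[OF g that] hadd[OF that] by (simp add: distrib_left)
    show "G (\<lambda>i. t * a i) = t * G a" if "a \<in> E" for a t
      unfolding G_def using functional_scale[OF g that] hscale[OF that] by (simp add: distrib_left)
    show "\<bar>G a\<bar> \<le> (K + \<kappa>) * N a" if a: "a \<in> E" for a
    proof -
      have "\<bar>\<kappa> * h a\<bar> \<le> \<kappa> * N a" using hle'[OF a] \<kappa>(1) by (simp add: abs_mult)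
      then show ?thesis
        using K(2)[rule_format, OF a] abs_triangle_ineq[of "g a" "\<kappa> * h a"] unfolding G_def by (simp add: distrib_right)
    qed
  qed
  moreover have "q \<in> slice G S" using q Gq by (simp add: slice_iff)
  moreover have "a \<in> slice g s \<and> d / 4 < N (restr {..<m} (\<lambda>i. a i - p i))" if "a \<in> slice G S" for a
    using inside[of a] that unfolding slice_iff B_def by auto
  ultimately show ?thesis by (intro exI[of _ G] exI[of _ S] exI[of _ m]) blast
qed

lemma N_restr_le_limit:
  assumes a: "\<And>n. a n \<in> E" and b: "\<And>n. N (restr {..<m} (a n)) \<le> K" and lim: "\<And>i. (\<lambda>n. a n i) \<longlonglongrightarrow> l i"
  shows "N (restr {..<m} l) \<le> K"
proof -
  have "N (restr {..<m} l) \<le> K + (\<Sum>i<m. \<bar>l i - a n i\<bar>)" for n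
  proof -
    have "(\<lambda>i. restr {..<m} l i - restr {..<m} (a n) i) = restr {..<m} (\<lambda>i. l i - a n i)"
      by (auto simp: restr_def)
    then show ?thesis
      using N_triangle_diff[OF restr_finite_mem restr_finite_mem, of "{..<m}" "{..<m}" l "a n"]
        finite_support[of "{..<m}" "\<lambda>i. l i - a n i"] b[of n] by simp
  qed
  moreover have "(\<lambda>n. K + (\<Sum>i<m. \<bar>l i - a n i\<bar>)) \<longlonglongrightarrow> K + (\<Sum>i<m. \<bar>l i - l i\<bar>)"
    by (intro tendsto_intros lim)
  ultimately show ?thesis using LIMSEQ_le_const by fastforce
qed

text \<open>If no slice inside a given slice were small, one could, for each member \<open>p k\<close> of a dense sequence in
  turn, pass to a smaller slice that keeps away from \<open>p k\<close>, and on which the first \<open>k\<close> coordinates vary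
  little.  Points of these slices converge coordinatewise.  By bounded completeness the limit belongs to \<open>E\<close>, but
  it keeps away from the whole dense sequence.\<close>

lemma dentable_ball: "dentable_ball C"
proof (rule ccontr)
  assume "\<not> dentable_ball C"
  then obtain g0 s0 d where g0: "functional g0" "slice g0 s0 \<noteq> {}" "0 < d"
    and none: "\<not> (\<exists>g' s'. functional g' \<and> slice g' s' \<noteq> {} \<and> slice g' s' \<subseteq> slice g0 s0 \<and>
        (\<forall>x\<in>slice g' s'. \<forall>y\<in>slice g' s'. N (\<lambda>i. x i - y i) \<le> d))"
    unfolding dentable_ball_def vdist_C by blast
  have big0: "\<exists>x\<in>slice g' s'. \<exists>y\<in>slice g' s'. d < N (\<lambda>i. x i - y i)"
    if "functional g'" "slice g' s' \<noteq> {}" "slice g' s' \<subseteq> slice g0 s0" for g' s'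
    using none that by (meson not_le)
  obtain p where p: "\<And>k. p k \<in> E" "\<And>a \<epsilon>. a \<in> E \<Longrightarrow> \<epsilon> > 0 \<Longrightarrow> \<exists>k::nat. N (\<lambda>i. a i - p k i) < \<epsilon>"
    using separable by blast
  define P where "P S \<longleftrightarrow> (\<exists>g s. functional g \<and> S = slice g s) \<and> S \<noteq> {} \<and> S \<subseteq> slice g0 s0" for S
  define Q where "Q k S S' \<longleftrightarrow> S' \<subseteq> S \<and> (\<exists>m. \<forall>x\<in>S'. d / 4 < N (restr {..<m} (\<lambda>i. x i - p k i))) \<and>
      (\<forall>x\<in>S'. \<forall>y\<in>S'. \<forall>i\<in>{..<k}. \<bar>x i - y i\<bar> \<le> 1 / (real k + 1))" for k S S'
  have "\<exists>S. \<forall>k. P (S k) \<and> Q k (S k) (S (Suc k))"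
  proof (rule dependent_nat_choice)
    have "P (slice g0 s0)" unfolding P_def using g0(1,2) by auto
    then show "\<exists>S. P S" ..
    fix S k assume "P S"
    then obtain g s where g: "functional g" "S = slice g s" "S \<noteq> {}" "S \<subseteq> slice g0 s0"
      unfolding P_def by blast
    have ne: "slice g s \<noteq> {}" using g(2,3) by simp
    have big: "\<exists>x\<in>slice g s'. \<exists>y\<in>slice g s'. d < N (\<lambda>i. x i - y i)" if "s \<le> s'" "slice g s' \<noteq> {}" for s'
    proof (rule big0[OF g(1) that(2)])
      have "slice g s' \<subseteq> slice g s" using that(1) by (auto simp: slice_iff)
      then show "slice g s' \<subseteq> slice g0 s0" using g(2,4) by blast
    qed
    have "\<exists>g' s' m. functional g' \<and> slice g' s' \<noteq> {} \<and> slice g' s' \<subseteq> slice g s \<and>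
        (\<forall>x\<in>slice g' s'. d / 4 < N (restr {..<m} (\<lambda>i. x i - p k i)))"
      by (rule slice_away_from_point[OF g(1) ne g0(3) _ p(1)]) (rule big)
    then obtain g1 s1 m q where g1: "functional g1" "q \<in> slice g1 s1" "slice g1 s1 \<subseteq> slice g s"
      "\<forall>x\<in>slice g1 s1. d / 4 < N (restr {..<m} (\<lambda>i. x i - p k i))"
      by blast
    obtain g' s' where g': "functional g'" "slice g' s' \<noteq> {}" "slice g' s' \<subseteq> slice g1 s1"
      "\<forall>y\<in>slice g' s'. \<forall>z\<in>slice g' s'. \<forall>i\<in>{..<k}. \<bar>y i - z i\<bar> \<le> 1 / (real k + 1)"
      using subslice_with_small_coordinates[OF g1(1,2) finite_lessThan, of "1 / (real k + 1)" k] by auto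
    have sub: "slice g' s' \<subseteq> S" using g'(3) g1(3) unfolding g(2) by (rule subset_trans)
    have "P (slice g' s')"
      unfolding P_def using g'(1,2) subset_trans[OF sub g(4)] by blast
    moreover have "Q k S (slice g' s')"
      unfolding Q_def using sub g'(3,4) g1(4) by (intro conjI exI[of _ m]) blast+
    ultimately show "\<exists>S'. P S' \<and> Q k S S'" by blast
  qed
  then obtain S where S: "\<And>k. P (S k)" "\<And>k. Q k (S k) (S (Suc k))" by blast
  have "\<forall>k. \<exists>x. x \<in> S k" using S(1) unfolding P_def by blast
  then obtain q where q: "\<And>k. q k \<in> S k" by metis
  have dec: "S (Suc k) \<subseteq> S k" for k using S(2) unfolding Q_def by blast
  have dec': "q j \<in> S k" if "k \<le> j" for j k
    using lift_Suc_antimono_le[of S k j] dec that q by blast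
  have qE: "q k \<in> E" "N (q k) \<le> 1" for k using q[of k] S(1)[of k] unfolding P_def by (auto simp: slice_iff)
  have "Cauchy (\<lambda>k. q k i)" for i
  proof (rule metric_CauchyI)
    fix \<epsilon> :: real assume "\<epsilon> > 0"
    then obtain n where "1 / real (Suc n) < \<epsilon>" by (rule nat_approx_posE)
    then have n: "1 / (real n + 1) < \<epsilon>" by (simp add: add.commute)
    define k where "k = max n (Suc i)"
    have k: "1 / (real k + 1) \<le> 1 / (real n + 1)" "i < k" unfolding k_def by (auto simp: field_simps)
    have "dist (q a i) (q b i) < \<epsilon>" if "a \<ge> Suc k" "b \<ge> Suc k" for a b
    proof -
      have "q a \<in> S (Suc k)" "q b \<in> S (Suc k)" using dec' that by auto
      then have "\<bar>q a i - q b i\<bar> \<le> 1 / (real k + 1)" using S(2)[of k] k(2) unfolding Q_def by auto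
      then show ?thesis using k(1) n by (simp add: dist_real_def)
    qed
    then show "\<exists>M. \<forall>m\<ge>M. \<forall>n\<ge>M. dist (q m i) (q n i) < \<epsilon>" by blast
  qed
  then have "\<forall>i. \<exists>l. (\<lambda>k. q k i) \<longlonglongrightarrow> l" using Cauchy_convergent_iff convergent_def by blast
  then obtain l where l: "\<And>i. (\<lambda>k. q k i) \<longlonglongrightarrow> l i" by metis
  have "N (restr {..<m} (q k)) \<le> 1" for m k using N_restr_le[OF qE(1), of "{..<m}" k] qE(2)[of k] by linarith
  then have "N (restr {..<m} l) \<le> 1" for m by (rule N_restr_le_limit[OF qE(1) _ l])
  then have lE: "l \<in> E" by (rule boundedly_complete)
  obtain k where k: "N (\<lambda>i. l i - p k i) < d / 4" using p(2)[OF lE, of "d / 4"] g0(3) by auto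
  obtain m where m: "\<And>x. x \<in> S (Suc k) \<Longrightarrow> d / 4 < N (restr {..<m} (\<lambda>i. x i - p k i))"
    using S(2)[of k] unfolding Q_def by blast
  have "d / 4 \<le> N (restr {..<m} (\<lambda>i. l i - p k i))"
  proof -
    have "d / 4 \<le> N (restr {..<m} (\<lambda>i. l i - p k i)) + (\<Sum>i<m. \<bar>q (Suc (k + n)) i - l i\<bar>)" for n
    proof -
      let ?q = "q (Suc (k + n))"
      have "d / 4 < N (restr {..<m} (\<lambda>i. ?q i - p k i))" by (intro m dec') simp
      moreover have "restr {..<m} (\<lambda>i. ?q i - p k i) =
          (\<lambda>i. restr {..<m} (\<lambda>i. l i - p k i) i + restr {..<m} (\<lambda>i. ?q i - l i) i)"
        by (auto simp: restr_def)
      ultimately show ?thesis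
        using N_triangle[OF restr_finite_mem restr_finite_mem, of "{..<m}" "{..<m}" "\<lambda>i. l i - p k i" "\<lambda>i. ?q i - l i"]
          finite_support[of "{..<m}" "\<lambda>i. ?q i - l i"] by simp
    qed
    moreover have "(\<lambda>n. N (restr {..<m} (\<lambda>i. l i - p k i)) + (\<Sum>i<m. \<bar>q (Suc (k + n)) i - l i\<bar>))
        \<longlonglongrightarrow> N (restr {..<m} (\<lambda>i. l i - p k i)) + (\<Sum>i<m. \<bar>l i - l i\<bar>)"
    proof (intro tendsto_intros)
      show "(\<lambda>n. q (Suc (k + n)) i) \<longlonglongrightarrow> l i" for i
        using LIMSEQ_ignore_initial_segment[OF l[of i], of "Suc k"] by (simp add: add.commute)
    qed
    ultimately show ?thesis using LIMSEQ_le_const by fastforce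
  qed
  also have "\<dots> \<le> N (\<lambda>i. l i - p k i)" by (rule N_restr_le[OF diff[OF lE p(1)]])
  finally show False using k by simp
qed

end

section \<open>Unconditional bases and the Radon-Nikodym property\<close>

locale unconditional_basis =
  fixes e :: "nat \<Rightarrow> 'e::banach"
  assumes basis: "one_unconditional_basis e" and normalized: "norm (e j) = 1"
begin

definition synth :: "(nat \<Rightarrow> real) \<Rightarrow> 'e" where "synth a = (\<Sum>n. a n *\<^sub>R e n)"

definition coeffs :: "'e \<Rightarrow> nat \<Rightarrow> real" where "coeffs x = (THE a. (\<lambda>n. a n *\<^sub>R e n) sums x)"

abbreviation "E \<equiv> coeff_space e"
abbreviation "N \<equiv> coeff_norm e"

lemma schauder: "\<exists>!a. (\<lambda>n. a n *\<^sub>R e n) sums x"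
  using basis unfolding one_unconditional_basis_def schauder_basis_def by blast

lemma coeffs_sums: "(\<lambda>n. coeffs x n *\<^sub>R e n) sums x"
  unfolding coeffs_def using schauder[of x] by (rule theI')

lemma coeffs_unique: "(\<lambda>n. a n *\<^sub>R e n) sums x \<Longrightarrow> coeffs x = a"
  using schauder[of x] coeffs_sums[of x] by blast

lemma coeffs_in_E: "coeffs x \<in> E"
  unfolding coeff_space_def using coeffs_sums sums_summable by blast

lemma synth_sums: "a \<in> E \<Longrightarrow> (\<lambda>n. a n *\<^sub>R e n) sums synth a"
  unfolding coeff_space_def synth_def using summable_sums by blast

lemma coeffs_synth: "a \<in> E \<Longrightarrow> coeffs (synth a) = a"
  by (rule coeffs_unique[OF synth_sums])

lemma synth_coeffs: "synth (coeffs x) = x"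
  unfolding synth_def using coeffs_sums sums_unique by metis

lemma N_synth: "N a = norm (synth a)"
  unfolding coeff_norm_def synth_def ..

lemma E_add: "a \<in> E \<Longrightarrow> b \<in> E \<Longrightarrow> (\<lambda>n. a n + b n) \<in> E"
  and synth_add: "a \<in> E \<Longrightarrow> b \<in> E \<Longrightarrow> synth (\<lambda>n. a n + b n) = synth a + synth b"
proof -
  assume ab: "a \<in> E" "b \<in> E"
  then have s: "(\<lambda>n. (a n + b n) *\<^sub>R e n) sums (synth a + synth b)"
    using sums_add[OF synth_sums[OF ab(1)] synth_sums[OF ab(2)]] by (simp add: scaleR_left_distrib)
  show "(\<lambda>n. a n + b n) \<in> E" unfolding coeff_space_def using s sums_summable by auto
  show "synth (\<lambda>n. a n + b n) = synth a + synth b" unfolding synth_def[of "\<lambda>n. a n + b n"] using s by (rule sums_unique[symmetric])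
qed

lemma E_scale: "a \<in> E \<Longrightarrow> (\<lambda>n. c * a n) \<in> E"
  and synth_scale: "a \<in> E \<Longrightarrow> synth (\<lambda>n. c * a n) = c *\<^sub>R synth a"
proof -
  assume a: "a \<in> E"
  then have s: "(\<lambda>n. (c * a n) *\<^sub>R e n) sums (c *\<^sub>R synth a)"
    using sums_scaleR_right[OF synth_sums[OF a], of c] by simp
  show "(\<lambda>n. c * a n) \<in> E" unfolding coeff_space_def using s sums_summable by auto
  show "synth (\<lambda>n. c * a n) = c *\<^sub>R synth a" unfolding synth_def[of "\<lambda>n. c * a n"] using s by (rule sums_unique[symmetric])
qed

lemma E_zero: "(\<lambda>n. 0) \<in> E" and synth_zero: "synth (\<lambda>n. 0) = 0"
  unfolding coeff_space_def synth_def by auto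

lemma synth_finite:
  assumes "finite F"
  shows "restr F a \<in> E" "synth (restr F a) = (\<Sum>i\<in>F. a i *\<^sub>R e i)"
proof -
  have "(\<lambda>n. restr F a n *\<^sub>R e n) = (\<lambda>n. if n \<in> F then a n *\<^sub>R e n else 0)" by (auto simp: restr_def)
  then have s: "(\<lambda>n. restr F a n *\<^sub>R e n) sums (\<Sum>i\<in>F. a i *\<^sub>R e i)"
    using sums_If_finite_set[OF assms, of "\<lambda>n. a n *\<^sub>R e n"] by simp
  show "restr F a \<in> E" unfolding coeff_space_def using s sums_summable by auto
  show "synth (restr F a) = (\<Sum>i\<in>F. a i *\<^sub>R e i)" unfolding synth_def using s by (rule sums_unique[symmetric])
qed

lemma sign_change:
  assumes a: "a \<in> E" and ab: "\<And>i. \<bar>a i\<bar> = \<bar>b i\<bar>"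
  shows "b \<in> E \<and> N b = N a"
proof -
  define \<theta> where "\<theta> n = (if a n = b n then 1 else - 1 :: real)" for n
  have b: "\<theta> n * a n = b n" for n using ab[of n] unfolding \<theta>_def by auto
  have "\<forall>n. \<theta> n \<in> {-1, 1}" unfolding \<theta>_def by auto
  then obtain y where y: "(\<lambda>n. (\<theta> n * a n) *\<^sub>R e n) sums y" "norm y = norm (synth a)"
    using basis synth_sums[OF a] unfolding one_unconditional_basis_def by blast
  then have y: "(\<lambda>n. b n *\<^sub>R e n) sums y" "norm y = norm (synth a)" unfolding b by auto
  have "synth b = y" unfolding synth_def using y(1) by (rule sums_unique[symmetric])
  moreover have "b \<in> E" unfolding coeff_space_def using y(1) sums_summable by blast
  ultimately show ?thesis using y(2) by (simp add: N_synth)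
qed

lemma synth_diff: "a \<in> E \<Longrightarrow> b \<in> E \<Longrightarrow> synth (\<lambda>n. a n - b n) = synth a - synth b"
  using synth_add[of a "\<lambda>n. (-1) * b n"] synth_scale[of b "-1"] E_scale[of b "-1"] by simp

lemma absolute_space_coeff: "absolute_space E N"
proof
  show "vzero (coord_space E N) \<in> vcarrier (coord_space E N)" using E_zero by simp
  fix x assume x: "x \<in> vcarrier (coord_space E N)"
  show "vscale (coord_space E N) c x \<in> vcarrier (coord_space E N)" for c using x E_scale by simp
  show "vnorm (coord_space E N) x = 0 \<longleftrightarrow> x = vzero (coord_space E N)"
    using x coeffs_synth[of x] coeffs_synth[OF E_zero] synth_zero by (auto simp: N_synth)
  show "vnorm (coord_space E N) (vscale (coord_space E N) c x) = norm c * vnorm (coord_space E N) x" for c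
    using x by (simp add: N_synth synth_scale)
  fix y assume y: "y \<in> vcarrier (coord_space E N)"
  show "vadd (coord_space E N) x y \<in> vcarrier (coord_space E N)" using x y E_add by simp
  show "vnorm (coord_space E N) (vadd (coord_space E N) x y) \<le> vnorm (coord_space E N) x + vnorm (coord_space E N) y"
    using x y by (simp add: N_synth synth_add norm_triangle_ineq)
next
  fix i
  have i: "(indicator {i} :: nat \<Rightarrow> real) = restr {i} (\<lambda>_. 1)" by (auto simp: restr_def indicator_def)
  show "(indicator {i} :: nat \<Rightarrow> real) \<in> E" "N (indicator {i}) = 1"
    unfolding i N_synth using synth_finite[of "{i}" "\<lambda>_. 1"] normalized by auto
next
  fix \<sigma> :: "nat \<Rightarrow> nat \<Rightarrow> real"
  assume \<sigma>: "\<And>k. \<sigma> k \<in> E"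
    and c: "\<And>\<epsilon>. \<epsilon> > 0 \<Longrightarrow> \<exists>n0. \<forall>n\<ge>n0. \<forall>m\<ge>n0. N (\<lambda>i. \<sigma> n i - \<sigma> m i) < \<epsilon>"
  have "Cauchy (\<lambda>k. synth (\<sigma> k))"
    unfolding Cauchy_def dist_norm using c by (simp add: N_synth synth_diff[OF \<sigma> \<sigma>])
  then obtain x where x: "(\<lambda>k. synth (\<sigma> k)) \<longlonglongrightarrow> x" using Cauchy_convergent_iff convergent_def by blast
  have "(\<lambda>k. N (\<lambda>i. \<sigma> k i - coeffs x i)) = (\<lambda>k. norm (synth (\<sigma> k) - x))"
    by (simp add: N_synth synth_diff[OF \<sigma> coeffs_in_E] synth_coeffs)
  moreover have "(\<lambda>k. norm (synth (\<sigma> k) - x)) \<longlonglongrightarrow> 0" using x by (simp add: LIM_zero tendsto_norm_zero)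
  ultimately have "(\<lambda>k. N (\<lambda>i. \<sigma> k i - coeffs x i)) \<longlonglongrightarrow> 0" by simp
  then show "\<exists>a\<in>E. (\<lambda>k. N (\<lambda>i. \<sigma> k i - a i)) \<longlonglongrightarrow> 0"
    by (intro bexI[of _ "coeffs x"] coeffs_in_E)
next
  fix a b :: "nat \<Rightarrow> real" assume "a \<in> E" "\<And>i. \<bar>a i\<bar> = \<bar>b i\<bar>"
  from sign_change[OF this] show "b \<in> E" "N b = N a" by auto
qed (simp_all add: algebra_simps)

sublocale sequence_space E N
proof -
  interpret absolute_space E N by (rule absolute_space_coeff)
  show "sequence_space E N"
  proof
    fix a assume a: "a \<in> E"
    have "(\<lambda>n. synth a - (\<Sum>i<n. a i *\<^sub>R e i)) \<longlonglongrightarrow> synth a - synth a"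
      using synth_sums[OF a] unfolding sums_def by (intro tendsto_intros)
    then have "(\<lambda>n. norm (synth a - (\<Sum>i<n. a i *\<^sub>R e i))) \<longlonglongrightarrow> 0" by (simp add: tendsto_norm_zero)
    moreover have "N (\<lambda>i. a i - restr {..<n} a i) = norm (synth a - (\<Sum>i<n. a i *\<^sub>R e i))" for n
      unfolding N_synth using synth_diff[OF a synth_finite(1)] synth_finite(2) by simp
    ultimately show "(\<lambda>n. N (\<lambda>i. a i - restr {..<n} a i)) \<longlonglongrightarrow> 0" by simp
  qed
qed

lemma coeffs_add: "coeffs (x + y) = (\<lambda>n. coeffs x n + coeffs y n)"
  using coeffs_synth[OF E_add[OF coeffs_in_E coeffs_in_E]] synth_add[OF coeffs_in_E coeffs_in_E]
  by (simp add: synth_coeffs)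

lemma coeffs_scale: "coeffs (c *\<^sub>R x) = (\<lambda>n. c * coeffs x n)"
  using coeffs_synth[OF E_scale[OF coeffs_in_E]] synth_scale[OF coeffs_in_E] by (metis synth_coeffs)

lemma bounded_linear_coeff: "bounded_linear (\<lambda>x. coeffs x i)"
proof (rule bounded_linear_intro[where K = 1])
  show "norm (coeffs x i) \<le> norm x * 1" for x
    using coordinate_le[OF coeffs_in_E, of x i] by (simp add: N_synth synth_coeffs)
qed (simp_all add: coeffs_add coeffs_scale)

lemma slices_in_duality_coeff:
  assumes n: "numerical_index (type_space :: (real, 'e) nvs) = 1"
  shows "slices_in_duality C"
  unfolding slices_in_duality_def
proof (intro allI impI, elim conjE bexE)
  fix g v s s' f0
  assume g: "functional g" and s: "0 \<le> s" "0 \<le> (s'::real)"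
    and ne: "slice g s \<noteq> {}" and v: "v \<in> vcarrier C" and f0: "f0 \<in> dual_ball C" "s' < f0 v"
  obtain x0 where x0: "x0 \<in> E" "N x0 \<le> 1" "s < g x0" using ne by (auto simp: slice_iff)
  let ?T = "type_space :: (real, 'e) nvs"
  have T [simp]: "vcarrier ?T = UNIV" "vadd ?T = (+)" "vzero ?T = 0" "vscale ?T = scaleR" "vnorm ?T = norm"
    unfolding type_space_def by auto
  have nT: "normed_space_on ?T"
    by unfold_locales (auto simp: algebra_simps norm_triangle_ineq)
  have "e 0 \<noteq> 0" using normalized[of 0] by auto
  then have nz: "nonzero_space ?T" unfolding nonzero_space_def by auto
  have gT: "bounded_linear_on ?T scalar_space (\<lambda>x. g (coeffs x))"
  proof -
    obtain K where "\<forall>a\<in>E. \<bar>g a\<bar> \<le> K * N a" using functional_bound[OF g] by blast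
    then have "\<bar>g (coeffs x)\<bar> \<le> K * norm x" for x
      using coeffs_in_E[of x] by (auto simp: N_synth[of "coeffs x"] synth_coeffs)
    then have "\<exists>K. \<forall>x. \<bar>g (coeffs x)\<bar> \<le> K * norm x" by blast
    then show ?thesis
      unfolding bounded_linear_on_def
      by (simp add: coeffs_add coeffs_scale functional_add[OF g] functional_scale[OF g] coeffs_in_E)
  qed
  have fT: "(\<lambda>x. f0 (coeffs x)) \<in> dual_ball ?T"
  proof (rule dual_ballI)
    show "norm (f0 (coeffs x)) \<le> vnorm ?T x" for x
      using dual_le[OF f0(1) coeffs_in_E, of x] by (simp add: N_synth synth_coeffs)
  qed (simp_all add: coeffs_add coeffs_scale dual_add[OF f0(1)] dual_scale[OF f0(1)] coeffs_in_E)
  have "synth x0 \<in> ball_slice ?T (\<lambda>x. g (coeffs x)) s"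
    unfolding ball_slice_def using x0 by (simp add: coeffs_synth N_synth)
  then have "ball_slice ?T (\<lambda>x. g (coeffs x)) s \<noteq> {}" by blast
  moreover have "s' < f0 (coeffs (synth v))" using v f0 by (simp add: coeffs_synth)
  then have "\<exists>f\<in>dual_ball ?T. s' < f (synth v)" using fT by (intro bexI[of _ "\<lambda>x. f0 (coeffs x)"])
  ultimately have "\<exists>x\<in>ball_slice ?T (\<lambda>x. g (coeffs x)) s. \<exists>f\<in>dual_ball ?T. s' < f (synth v) \<and> \<bar>f x\<bar> = 1"
    using numerical_index_1_slices_in_duality[OF nT nz n, unfolded slices_in_duality_def, rule_format,
        of "\<lambda>x. g (coeffs x)" s s' "synth v"] gT s by simp
  then obtain x f where x: "norm x \<le> 1" "s < g (coeffs x)"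
    and f: "f \<in> dual_ball ?T" "s' < f (synth v)" "\<bar>f x\<bar> = 1"
    unfolding ball_slice_def by auto
  have "(\<lambda>a. f (synth a)) \<in> dual_ball C"
  proof (rule dual_ballI)
    show "norm (f (synth a)) \<le> vnorm C a" for a
      using dual_ball_le[OF f(1), of "synth a"] by (simp add: N_synth)
    show "f (synth (vadd C a b)) = f (synth a) + f (synth b)" if "a \<in> vcarrier C" "b \<in> vcarrier C" for a b
      using that dual_ball_add[OF f(1), of "synth a" "synth b"] by (simp add: synth_add)
    show "f (synth (vscale C c a)) = c * f (synth a)" if "a \<in> vcarrier C" for a c
      using that dual_ball_scale[OF f(1), of "synth a" c] by (simp add: synth_scale)
  qed
  moreover have "coeffs x \<in> slice g s" using x coeffs_in_E by (simp add: slice_iff N_synth synth_coeffs)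
  moreover have "s' < f (synth v) \<and> \<bar>f (synth (coeffs x))\<bar> = 1" using f(2,3) by (simp add: synth_coeffs)
  ultimately show "\<exists>x\<in>slice g s. \<exists>f\<in>dual_ball C. s' < f v \<and> \<bar>f x\<bar> = 1"
    by (intro bexI[of _ "coeffs x"] bexI[of _ "\<lambda>a. f (synth a)"])
qed

end

lemma (in unconditional_basis) separable_coeff:
  assumes "\<exists>D :: 'e set. countable D \<and> closure D = UNIV"
  shows "\<exists>p. range p \<subseteq> E \<and> (\<forall>a\<in>E. \<forall>\<epsilon>>0. \<exists>k::nat. N (\<lambda>i. a i - p k i) < \<epsilon>)"
proof -
  obtain D :: "'e set" where D: "countable D" "closure D = UNIV" using assms by blast
  then have "D \<noteq> {}" by auto
  have "\<exists>k. N (\<lambda>i. a i - coeffs (from_nat_into D k) i) < \<epsilon>" if a: "a \<in> E" and \<epsilon>: "\<epsilon> > 0" for a \<epsilon>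
  proof -
    obtain y where y: "y \<in> D" "dist y (synth a) < \<epsilon>" using D(2) \<epsilon> closure_approachable by blast
    obtain k where "from_nat_into D k = y" using from_nat_into_surj[OF D(1) y(1)] by blast
    moreover have "N (\<lambda>i. a i - coeffs y i) = norm (synth a - y)"
      unfolding N_synth synth_diff[OF a coeffs_in_E] synth_coeffs ..
    ultimately show ?thesis using y(2) by (intro exI[of _ k]) (simp add: dist_norm norm_minus_commute)
  qed
  then show ?thesis using coeffs_in_E by (intro exI[of _ "\<lambda>k. coeffs (from_nat_into D k)"]) auto
qed

section \<open>Bounded completeness from the Radon-Nikodym property\<close>

text \<open>By Bessel's inequality the squares of these integrals are summable.\<close>

lemma bessel_tendsto_0:
  fixes \<phi> :: "nat \<Rightarrow> 'w \<Rightarrow> real"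
  assumes M: "finite_measure M"
    and meas: "\<And>i. \<phi> i \<in> borel_measurable M" and bound: "\<And>i x. \<bar>\<phi> i x\<bar> \<le> 1"
    and orth: "\<And>i j. i \<noteq> j \<Longrightarrow> (\<integral>x. \<phi> i x * \<phi> j x \<partial>M) = 0" and one: "measure M (space M) \<le> 1"
    and A: "A \<in> sets M"
  shows "(\<lambda>i. \<integral>x. indicator A x * \<phi> i x \<partial>M) \<longlonglongrightarrow> 0"
proof -
  interpret finite_measure M by fact
  note [measurable] = meas A
  define c where "c i = (\<integral>x. indicator A x * \<phi> i x \<partial>M)" for i
  have int1 [simp]: "integrable M (\<lambda>x. indicator A x * \<phi> i x)" for i
    by (rule integrable_const_bound[of _ 1]) (auto simp: indicator_def bound)
  have int2 [simp]: "integrable M (\<lambda>x. \<phi> i x * \<phi> j x)" for i j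
    by (rule integrable_const_bound[of _ 1]) (auto simp: abs_mult intro!: mult_le_one bound)
  have intA: "integrable M (indicator A :: 'w \<Rightarrow> real)"
    using A emeasure_finite[of A] by (intro integrable_real_indicator) (simp_all add: less_top[symmetric])
  have sq: "(\<integral>x. \<phi> i x * \<phi> i x \<partial>M) \<le> 1" for i
  proof -
    have "\<phi> i x * \<phi> i x \<le> 1" for x
      using mult_le_one[OF bound abs_ge_zero bound, of i x i x] by simp
    then have "(\<integral>x. \<phi> i x * \<phi> i x \<partial>M) \<le> (\<integral>x. 1 \<partial>M)" by (intro integral_mono) auto
    then show ?thesis using one by simp
  qed
  have "(\<Sum>i<n. (c i)\<^sup>2) \<le> measure M A" for n
  proof -
    have eq: "(indicator A x - (\<Sum>i<n. c i * \<phi> i x))\<^sup>2 = indicator A x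
        - 2 * (\<Sum>i<n. c i * (indicator A x * \<phi> i x))
        + (\<Sum>i<n. \<Sum>j<n. c i * c j * (\<phi> i x * \<phi> j x))" for x
      unfolding power2_diff power2_eq_square[of "\<Sum>i<n. c i * \<phi> i x"] sum_product
      by (auto simp: indicator_def sum_distrib_left algebra_simps)
    have "0 \<le> (\<integral>x. (indicator A x - (\<Sum>i<n. c i * \<phi> i x))\<^sup>2 \<partial>M)" by simp
    also have "\<dots> = measure M A - 2 * (\<Sum>i<n. c i * c i) + (\<Sum>i<n. \<Sum>j<n. c i * c j * (\<integral>x. \<phi> i x * \<phi> j x \<partial>M))"
      unfolding eq using sets.sets_into_space[OF A] by (simp add: intA Int_absorb2 flip: c_def)
    also have "(\<Sum>i<n. \<Sum>j<n. c i * c j * (\<integral>x. \<phi> i x * \<phi> j x \<partial>M))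
        = (\<Sum>i<n. \<Sum>j<n. if j = i then c i * c i * (\<integral>x. \<phi> i x * \<phi> i x \<partial>M) else 0)"
      by (intro sum.cong refl) (auto simp: orth)
    also have "\<dots> = (\<Sum>i<n. c i * c i * (\<integral>x. \<phi> i x * \<phi> i x \<partial>M))"
      by (simp add: sum.delta)
    also have "\<dots> \<le> (\<Sum>i<n. c i * c i * 1)"
      by (intro sum_mono mult_left_mono sq) simp
    finally show ?thesis by (simp add: power2_eq_square)
  qed
  then have "summable (\<lambda>i. (c i)\<^sup>2)" by (intro summableI_nonneg_bounded) auto
  then have "(\<lambda>i. (c i)\<^sup>2) \<longlonglongrightarrow> 0" by (rule summable_LIMSEQ_zero)
  then have "(\<lambda>i. sqrt ((c i)\<^sup>2)) \<longlonglongrightarrow> sqrt 0" by (rule tendsto_real_sqrt)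
  then have "c \<longlonglongrightarrow> 0" by (simp add: tendsto_rabs_zero_iff)
  then show ?thesis unfolding c_def .
qed

context sequence_space
begin

text \<open>Bounded partial sums suffice for multiplication with a null sequence, since a block of the product is small
  as soon as the multipliers are.\<close>

lemma null_multiple:
  assumes K: "\<And>n. N (restr {..<n} a) \<le> K" and \<gamma>: "\<gamma> \<longlonglongrightarrow> 0"
  shows "(\<lambda>i. a i * \<gamma> i) \<in> E"
    and "(\<And>i. \<bar>\<gamma> i\<bar> \<le> \<eta>) \<Longrightarrow> N (\<lambda>i. a i * \<gamma> i) \<le> \<eta> * K"
proof -
  have block: "N (restr {n..<m} (\<lambda>i. a i * \<gamma> i)) \<le> \<eta> * K" if \<eta>: "\<And>i. n \<le> i \<Longrightarrow> \<bar>\<gamma> i\<bar> \<le> \<eta>" for n m \<eta>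
  proof -
    have \<eta>0: "0 \<le> \<eta>" using \<eta>[of n] by linarith
    have "N (restr {n..<m} (\<lambda>i. a i * \<gamma> i)) \<le> N (\<lambda>i. \<eta> * restr {..<m} a i)"
    proof (rule N_mono[OF scale[OF restr_finite_mem]])
      show "\<bar>restr {n..<m} (\<lambda>i. a i * \<gamma> i) i\<bar> \<le> \<bar>\<eta> * restr {..<m} a i\<bar>" for i
        using \<eta>[of i] \<eta>0 mult_right_mono[of "\<bar>\<gamma> i\<bar>" \<eta> "\<bar>a i\<bar>"]
        by (auto simp: restr_def abs_mult mult.commute)
    qed simp
    also have "\<dots> = \<eta> * N (restr {..<m} a)" using N_scale[OF restr_finite_mem, of "{..<m}" \<eta> a] \<eta>0 by simp
    also have "\<dots> \<le> \<eta> * K" using K \<eta>0 by (rule mult_left_mono)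
    finally show ?thesis .
  qed
  have K0: "0 \<le> K" using K[of 0] N_nonneg[OF restr_finite_mem[of "{..<0}" a]] by simp
  let ?\<sigma> = "\<lambda>n. restr {..<n} (\<lambda>i. a i * \<gamma> i)"
  have \<sigma>E: "?\<sigma> n \<in> E" for n by (rule restr_finite_mem) simp
  have diff_block: "(\<lambda>i. ?\<sigma> m i - ?\<sigma> n i) = restr {n..<m} (\<lambda>i. a i * \<gamma> i)" if "n \<le> m" for n m
    using that by (auto simp: restr_def)
  have "\<exists>n0. \<forall>n\<ge>n0. \<forall>m\<ge>n0. N (\<lambda>i. ?\<sigma> n i - ?\<sigma> m i) < \<epsilon>" if \<epsilon>: "\<epsilon> > 0" for \<epsilon>
  proof -
    define \<eta> where "\<eta> = \<epsilon> / (K + 1)"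
    have "\<eta> > 0" unfolding \<eta>_def using \<epsilon> K0 by simp
    then obtain n0 where n0: "\<And>i. n0 \<le> i \<Longrightarrow> \<bar>\<gamma> i\<bar> < \<eta>" using LIMSEQ_D[OF \<gamma>, of \<eta>] by auto
    have "\<eta> * K < \<epsilon>" unfolding \<eta>_def using \<epsilon> K0 by (simp add: field_simps)
    moreover have "N (\<lambda>i. ?\<sigma> n i - ?\<sigma> m i) \<le> \<eta> * K" if "n0 \<le> m" "m \<le> n" for n m
      unfolding diff_block[OF that(2)] using n0 that by (intro block) (meson less_imp_le order_trans)
    ultimately have 1: "N (\<lambda>i. ?\<sigma> n i - ?\<sigma> m i) < \<epsilon>" if "n0 \<le> m" "m \<le> n" for n m
      using that order.strict_trans1 by blast
    have "N (\<lambda>i. ?\<sigma> n i - ?\<sigma> m i) < \<epsilon>" if "n0 \<le> m" "n0 \<le> n" for n m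
      using 1[of m n] 1[of n m] that N_diff_commute[OF \<sigma>E \<sigma>E, of n m] by (cases "m \<le> n") auto
    then show ?thesis by blast
  qed
  from complete_limit[OF \<sigma>E this] obtain b where b: "b \<in> E" "(\<lambda>k. N (\<lambda>i. ?\<sigma> k i - b i)) \<longlonglongrightarrow> 0" by blast
  have "b i = a i * \<gamma> i" for i
  proof (rule LIMSEQ_unique)
    have "(\<lambda>k. ?\<sigma> k i - b i) \<longlonglongrightarrow> 0"
      using coordinate_le[OF diff[OF \<sigma>E b(1)], where i = i] by (intro Lim_null_comparison[OF _ b(2)]) auto
    then show "(\<lambda>k. ?\<sigma> k i) \<longlonglongrightarrow> b i" by (simp add: LIM_zero_iff)
    have "\<forall>\<^sub>F k in sequentially. ?\<sigma> k i = a i * \<gamma> i"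
      by (rule eventually_sequentiallyI[of "Suc i"]) (auto simp: restr_def)
    then show "(\<lambda>k. ?\<sigma> k i) \<longlonglongrightarrow> a i * \<gamma> i" by (rule tendsto_eventually)
  qed
  then have ba: "b = (\<lambda>i. a i * \<gamma> i)" by auto
  show E: "(\<lambda>i. a i * \<gamma> i) \<in> E" using b(1) unfolding ba .
  show "N (\<lambda>i. a i * \<gamma> i) \<le> \<eta> * K" if \<eta>: "\<And>i. \<bar>\<gamma> i\<bar> \<le> \<eta>"
  proof -
    have "N (\<lambda>i. a i * \<gamma> i) \<le> \<eta> * K + N (\<lambda>i. a i * \<gamma> i - ?\<sigma> n i)" for n
      using N_triangle_diff[OF E \<sigma>E, of n] block[of 0 \<eta> n] \<eta> by (simp add: lessThan_atLeast0)
    moreover have "(\<lambda>n. \<eta> * K + N (\<lambda>i. a i * \<gamma> i - ?\<sigma> n i)) \<longlonglongrightarrow> \<eta> * K + 0"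
      by (intro tendsto_intros truncation_tendsto E)
    ultimately show ?thesis using LIMSEQ_le_const by fastforce
  qed
qed

end

text \<open>The coefficients \<open>a i \<cdot> \<integral>\<^sub>A \<phi> i\<close> form a null multiple of \<open>a\<close>, hence belong to the space, and they define a
  vector measure \<open>G\<close> with \<open>\<parallel>G A\<parallel> \<le> K \<cdot> measure M A\<close>.  This bound gives countable additivity and bounded
  variation.  Comparing coefficients, the density of \<open>G\<close> has the coefficients \<open>a i \<cdot> \<phi> i t\<close> at almost every \<open>t\<close>.\<close>

lemma radon_nikodym_coefficients:
  fixes e :: "nat \<Rightarrow> 'e::{banach, second_countable_topology}" and M :: "real measure"
  assumes ub: "unconditional_basis e" and rnp: "radon_nikodym_property TYPE('e)"
    and K: "\<And>n. coeff_norm e (restr {..<n} a) \<le> K"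
    and M: "finite_measure M"
    and meas: "\<And>i. \<phi> i \<in> borel_measurable M" and bound: "\<And>i x. \<bar>\<phi> i x\<bar> \<le> 1"
    and null: "\<And>A. A \<in> sets M \<Longrightarrow> (\<lambda>i. \<integral>x. indicator A x * \<phi> i x \<partial>M) \<longlonglongrightarrow> 0"
  shows "AE t in M. (\<lambda>i. a i * \<phi> i t) \<in> coeff_space e"
proof -
  interpret unconditional_basis e by fact
  interpret M: finite_measure M by fact
  note [measurable] = meas
  have K0: "0 \<le> K" using K[of 0] N_nonneg[OF restr_finite_mem[of "{..<0}" a]] by simp
  define c where "c A i = (\<integral>x. indicator A x * \<phi> i x \<partial>M)" for A i
  have int\<phi>: "integrable M (\<phi> i)" for i
    by (rule M.integrable_const_bound[of _ 1]) (auto simp: bound)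
  have int [simp]: "integrable M (\<lambda>x. indicator A x * \<phi> i x)" if [measurable]: "A \<in> sets M" for A i
    by (rule M.integrable_const_bound[of _ 1]) (auto simp: indicator_def bound)
  have cE: "(\<lambda>i. a i * c A i) \<in> E" if "A \<in> sets M" for A
    unfolding c_def by (rule null_multiple(1)[OF K null[OF that]])
  define G where "G A = synth (\<lambda>i. a i * c A i)" for A
  have weighted: "\<bar>\<integral>x. w x * \<phi> i x \<partial>M\<bar> \<le> (\<integral>x. w x \<partial>M)"
    if w: "integrable M w" "\<And>x. 0 \<le> w x" for w i
  proof -
    have wm [measurable]: "w \<in> borel_measurable M" using w(1) by simp
    have "integrable M (\<lambda>x. w x * \<phi> i x)"
      using w bound by (intro Bochner_Integration.integrable_bound[OF w(1)]) (auto simp: abs_mult mult_left_le)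
    then have "\<bar>\<integral>x. w x * \<phi> i x \<partial>M\<bar> \<le> (\<integral>x. \<bar>w x * \<phi> i x\<bar> \<partial>M)" by simp
    also have "\<dots> \<le> (\<integral>x. w x \<partial>M)"
    proof (rule integral_mono)
      show "integrable M (\<lambda>x. \<bar>w x * \<phi> i x\<bar>)" using \<open>integrable M (\<lambda>x. w x * \<phi> i x)\<close> by (rule integrable_abs)
    qed (use w bound in \<open>auto simp: abs_mult mult_left_le\<close>)
    finally show ?thesis .
  qed
  have Gle: "norm (G A) \<le> measure M A * K" if A: "A \<in> sets M" for A
  proof -
    have "\<bar>c A i\<bar> \<le> measure M A" for i
      using weighted[of "indicator A" i] A M.emeasure_finite[of A] unfolding c_def by (simp add: less_top[symmetric])
    then have "N (\<lambda>i. a i * c A i) \<le> measure M A * K"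
      unfolding c_def by (rule null_multiple(2)[OF K null[OF A]])
    then show ?thesis unfolding G_def N_synth .
  qed
  have vm: "vector_measure M G"
    unfolding vector_measure_def
  proof (intro allI impI, elim conjE)
    fix A :: "nat \<Rightarrow> real set" assume A: "range A \<subseteq> sets M" "disjoint_family A"
    define U where "U = (\<Union>n. A n)"
    have As [measurable]: "A n \<in> sets M" for n using A by auto
    have Us [measurable]: "U \<in> sets M" unfolding U_def by auto
    define w where "w m x = (indicator U x - (\<Sum>n<m. indicator (A n) x) :: real)" for m x
    have w0: "0 \<le> w m x" for m x
    proof -
      have "(\<Sum>n<m. indicator (A n) x :: real) = indicator (\<Union>n<m. A n) x"
        using A(2) by (intro indicator_UN_disjoint[symmetric]) (auto simp: disjoint_family_on_def)
      also have "\<dots> \<le> indicator U x" unfolding U_def by (intro indicator_leI) auto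
      finally show ?thesis unfolding w_def by simp
    qed
    have fin: "emeasure M B < \<infinity>" for B using M.emeasure_finite[of B] by (simp add: less_top[symmetric])
    have wi: "integrable M (w m)" for m
      unfolding w_def using fin by (intro Bochner_Integration.integrable_diff Bochner_Integration.integrable_sum integrable_real_indicator) auto
    have wint: "(\<integral>x. w m x \<partial>M) = measure M U - (\<Sum>n<m. measure M (A n))" for m
    proof -
      have "(\<integral>x. w m x \<partial>M) = (\<integral>x. indicator U x \<partial>M) - (\<integral>x. (\<Sum>n<m. indicator (A n) x) \<partial>M)"
        unfolding w_def using fin
        by (intro Bochner_Integration.integral_diff Bochner_Integration.integrable_sum integrable_real_indicator) auto
      also have "(\<integral>x. (\<Sum>n<m. indicator (A n) x :: real) \<partial>M) = (\<Sum>n<m. \<integral>x. indicator (A n) x \<partial>M)"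
        using fin by (intro Bochner_Integration.integral_sum integrable_real_indicator) auto
      finally show ?thesis using sets.sets_into_space[OF Us] sets.sets_into_space[OF As] by (simp add: Int_absorb2)
    qed
    have cw: "c U i - (\<Sum>n<m. c (A n) i) = (\<integral>x. w m x * \<phi> i x \<partial>M)" for i m
    proof -
      have "(\<integral>x. w m x * \<phi> i x \<partial>M) = (\<integral>x. indicator U x * \<phi> i x - (\<Sum>n<m. indicator (A n) x * \<phi> i x) \<partial>M)"
        unfolding w_def by (simp only: left_diff_distrib sum_distrib_right)
      also have "\<dots> = (\<integral>x. indicator U x * \<phi> i x \<partial>M) - (\<integral>x. (\<Sum>n<m. indicator (A n) x * \<phi> i x) \<partial>M)"
        by (intro Bochner_Integration.integral_diff Bochner_Integration.integrable_sum int As Us)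
      also have "(\<integral>x. (\<Sum>n<m. indicator (A n) x * \<phi> i x) \<partial>M) = (\<Sum>n<m. \<integral>x. indicator (A n) x * \<phi> i x \<partial>M)"
        by (intro Bochner_Integration.integral_sum int As)
      finally show ?thesis unfolding c_def by simp
    qed
    define D where "D m i = a i * (c U i - (\<Sum>n<m. c (A n) i))" for m i
    have D0: "D 0 = (\<lambda>i. a i * c U i)" unfolding D_def by simp
    have DS: "D (Suc m) = (\<lambda>i. D m i - a i * c (A m) i)" for m
      unfolding D_def by (simp add: algebra_simps)
    have split: "D m \<in> E \<and> synth (D m) = G U - (\<Sum>n<m. G (A n))" for m
    proof (induction m)
      case 0
      then show ?case unfolding D0 G_def using cE[OF Us] by simp
    next
      case (Suc m)
      note DE = conjunct1[OF Suc]
      have "synth (D (Suc m)) = synth (D m) - G (A m)" unfolding DS G_def by (rule synth_diff[OF DE cE[OF As]])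
      moreover have "D (Suc m) \<in> E" unfolding DS by (rule diff[OF DE cE[OF As]])
      ultimately show ?case using conjunct2[OF Suc] by simp
    qed
    have "norm (G U - (\<Sum>n<m. G (A n))) \<le> (measure M U - (\<Sum>n<m. measure M (A n))) * K" for m
    proof -
      have "(\<lambda>i. c U i - (\<Sum>n<m. c (A n) i)) \<longlonglongrightarrow> 0 - (\<Sum>n<m. 0)"
        unfolding c_def by (rule tendsto_diff[OF null[OF Us] tendsto_sum[OF null[OF As]]])
      then have lim: "(\<lambda>i. c U i - (\<Sum>n<m. c (A n) i)) \<longlonglongrightarrow> 0" by simp
      have "\<bar>c U i - (\<Sum>n<m. c (A n) i)\<bar> \<le> measure M U - (\<Sum>n<m. measure M (A n))" for i
        unfolding cw wint[symmetric] by (rule weighted[OF wi w0])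
      then have "N (D m) \<le> (measure M U - (\<Sum>n<m. measure M (A n))) * K"
        unfolding D_def by (rule null_multiple(2)[OF K lim])
      then show ?thesis using split[of m] by (simp add: N_synth)
    qed
    then have bound: "\<forall>\<^sub>F m in sequentially. norm (G U - (\<Sum>n<m. G (A n))) \<le> (measure M U - (\<Sum>n<m. measure M (A n))) * K"
      by (simp add: always_eventually)
    have "(\<lambda>m. \<Sum>n<m. measure M (A n)) \<longlonglongrightarrow> measure M U"
      using M.finite_measure_UNION[OF A] unfolding sums_def U_def .
    from tendsto_mult[OF tendsto_diff[OF tendsto_const[of "measure M U"] this] tendsto_const[of K]]
    have "(\<lambda>m. (measure M U - (\<Sum>n<m. measure M (A n))) * K) \<longlonglongrightarrow> 0" by simp
    with bound have "(\<lambda>m. G U - (\<Sum>n<m. G (A n))) \<longlonglongrightarrow> 0" by (rule Lim_null_comparison)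
    from tendsto_diff[OF tendsto_const[of "G U"] this]
    show "(\<lambda>n. G (A n)) sums G (\<Union>n. A n)" unfolding sums_def U_def by simp
  qed
  have bv: "bounded_variation M G"
    unfolding bounded_variation_def
  proof (intro exI allI impI, elim conjE)
    fix P assume P: "finite P" "P \<subseteq> sets M" "disjoint P"
    have "(\<Sum>A\<in>P. norm (G A)) \<le> (\<Sum>A\<in>P. measure M A * K)" using P by (intro sum_mono Gle) auto
    also have "\<dots> = measure M (\<Union>A\<in>P. A) * K"
      unfolding sum_distrib_right[symmetric]
      using P by (subst M.finite_measure_finite_Union) (auto simp: disjoint_family_on_def disjoint_def)
    also have "\<dots> \<le> measure M (space M) * K" using K0 by (intro mult_right_mono M.bounded_measure)
    finally show "(\<Sum>A\<in>P. norm (G A)) \<le> measure M (space M) * K" .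
  qed
  have nl: "\<forall>A\<in>null_sets M. G A = 0"
  proof
    fix A assume A: "A \<in> null_sets M"
    then have "measure M A = 0" by (simp add: measure_eq_0_null_sets)
    then show "G A = 0" using Gle[OF null_setsD2[OF A]] by simp
  qed
  have "\<exists>g. integrable M g \<and> (\<forall>A\<in>sets M. G A = set_lebesgue_integral M A g)"
    by (rule rnp[unfolded radon_nikodym_property_def, THEN spec, THEN spec, THEN mp]) (intro conjI M vm bv nl)
  then obtain g where g: "integrable M g" "\<And>A. A \<in> sets M \<Longrightarrow> G A = set_lebesgue_integral M A g"
    by blast
  have "AE t in M. coeffs (g t) i = a i * \<phi> i t" for i
  proof (rule M.density_unique_banach)
    show "integrable M (\<lambda>t. coeffs (g t) i)" by (rule integrable_bounded_linear[OF bounded_linear_coeff g(1)])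
    show "integrable M (\<lambda>t. a i * \<phi> i t)" using int\<phi> by simp
    fix A assume A: "A \<in> sets M"
    have gA: "integrable M (\<lambda>x. indicator A x *\<^sub>R g x)" using g(1) A by (intro integrable_mult_indicator)
    have "set_lebesgue_integral M A (\<lambda>t. coeffs (g t) i) = (\<integral>x. coeffs (indicator A x *\<^sub>R g x) i \<partial>M)"
      unfolding set_lebesgue_integral_def by (simp add: coeffs_scale)
    also have "\<dots> = coeffs (G A) i"
      using integral_bounded_linear[OF bounded_linear_coeff gA, of i] g(2)[OF A] unfolding set_lebesgue_integral_def by simp
    also have "\<dots> = a i * c A i" unfolding G_def coeffs_synth[OF cE[OF A]] ..
    also have "\<dots> = set_lebesgue_integral M A (\<lambda>t. a i * \<phi> i t)"
      unfolding c_def set_lebesgue_integral_def by (simp add: mult.left_commute)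
    finally show "set_lebesgue_integral M A (\<lambda>t. coeffs (g t) i) = set_lebesgue_integral M A (\<lambda>t. a i * \<phi> i t)" .
  qed
  then have "AE t in M. \<forall>i. coeffs (g t) i = a i * \<phi> i t" by (simp add: AE_all_countable)
  then show ?thesis
  proof (rule AE_mp, intro AE_I2 impI)
    fix t assume "\<forall>i. coeffs (g t) i = a i * \<phi> i t"
    then have "coeffs (g t) = (\<lambda>i. a i * \<phi> i t)" by auto
    then show "(\<lambda>i. a i * \<phi> i t) \<in> E" using coeffs_in_E[of "g t"] by simp
  qed
qed

abbreviation unit_interval :: "real measure" where
  "unit_interval \<equiv> restrict_space lborel {0..1}"

lemma integral_cos_unit_interval:
  assumes "k \<noteq> 0"
  shows "integrable unit_interval (\<lambda>t. cos (2 * pi * of_int k * t))"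
    and "(\<integral>t. cos (2 * pi * of_int k * t) \<partial>unit_interval) = 0"
proof -
  define F where "F t = sin (2 * pi * of_int k * t) / (2 * pi * of_int k)" for t
  have "(F has_vector_derivative cos (2 * pi * of_int k * t)) (at t within {0..1})" for t
    unfolding F_def has_real_derivative_iff_has_vector_derivative[symmetric]
    using assms by (auto intro!: derivative_eq_intros)
  moreover have "continuous_on {0..1} (\<lambda>t. cos (2 * pi * of_int k * t))" by (intro continuous_intros)
  ultimately have "has_bochner_integral lborel (\<lambda>t. indicator {0..1} t *\<^sub>R cos (2 * pi * of_int k * t)) (F 1 - F 0)"
    by (intro has_bochner_integral_FTC_Icc) auto
  moreover have "F 1 - F 0 = 0"
    unfolding F_def using sin_int_2pin[of k] by (simp add: mult.commute mult.left_commute)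
  ultimately have *: "has_bochner_integral lborel (\<lambda>t. indicator {0..1} t *\<^sub>R cos (2 * pi * of_int k * t)) 0" by simp
  show "integrable unit_interval (\<lambda>t. cos (2 * pi * of_int k * t))"
    using * by (subst integrable_restrict_space) (auto simp: has_bochner_integral_iff)
  show "(\<integral>t. cos (2 * pi * of_int k * t) \<partial>unit_interval) = 0"
    using * by (subst integral_restrict_space) (auto simp: has_bochner_integral_iff)
qed

text \<open>The lemma \<open>radon_nikodym_coefficients\<close> is applied to cosines and to sines, because both are needed for a bound from below:
  \<open>\<bar>a i\<bar>\<close> is at most \<open>\<bar>a i cos (2 \<pi> i t)\<bar> + \<bar>a i sin (2 \<pi> i t)\<bar>\<close>, and \<open>E\<close> is solid.\<close>

lemma boundedly_complete_coeff:
  fixes e :: "nat \<Rightarrow> 'e::{banach, second_countable_topology}"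
  assumes ub: "unconditional_basis e" and rnp: "radon_nikodym_property TYPE('e)"
    and K: "\<And>n. coeff_norm e (restr {..<n} a) \<le> K"
  shows "a \<in> coeff_space e"
proof -
  interpret unconditional_basis e by fact
  let ?M = unit_interval
  have em: "emeasure ?M (space ?M) = 1" by (simp add: space_restrict_space emeasure_restrict_space)
  have M: "finite_measure ?M" by (rule finite_measureI) (unfold em, simp)
  have one: "measure ?M (space ?M) \<le> 1" unfolding measure_def em by simp
  define C where "C i t = cos (2 * pi * of_int (int i) * t)" for i t
  define S where "S i t = sin (2 * pi * of_int (int i) * t)" for i t
  have [measurable]: "C i \<in> borel_measurable ?M" "S i \<in> borel_measurable ?M" for i
    unfolding C_def S_def by (auto intro!: measurable_restrict_space1)
  have prod: "C i t * C j t = (cos (2 * pi * of_int (int i - int j) * t) + cos (2 * pi * of_int (int i + int j) * t)) / 2"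
    "S i t * S j t = (cos (2 * pi * of_int (int i - int j) * t) - cos (2 * pi * of_int (int i + int j) * t)) / 2" for i j t
    unfolding C_def S_def cos_times_cos sin_times_sin by (simp_all add: algebra_simps)
  have orth: "(\<integral>t. C i t * C j t \<partial>?M) = 0" "(\<integral>t. S i t * S j t \<partial>?M) = 0" if ij: "i \<noteq> j" for i j
  proof -
    have k: "int i - int j \<noteq> 0" "int i + int j \<noteq> 0" using ij by auto
    show "(\<integral>t. C i t * C j t \<partial>?M) = 0" "(\<integral>t. S i t * S j t \<partial>?M) = 0"
      unfolding prod using integral_cos_unit_interval[OF k(1)] integral_cos_unit_interval[OF k(2)] by simp_all
  qed
  have b: "\<bar>C i t\<bar> \<le> 1" "\<bar>S i t\<bar> \<le> 1" for i t unfolding C_def S_def by auto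
  have "AE t in ?M. (\<lambda>i. a i * C i t) \<in> E"
    by (rule radon_nikodym_coefficients[OF ub rnp K M _ b(1)])
      (auto intro!: bessel_tendsto_0[OF M] b orth one)
  moreover have "AE t in ?M. (\<lambda>i. a i * S i t) \<in> E"
    by (rule radon_nikodym_coefficients[OF ub rnp K M _ b(2)])
      (auto intro!: bessel_tendsto_0[OF M] b orth one)
  ultimately have "AE t in ?M. (\<lambda>i. a i * C i t) \<in> E \<and> (\<lambda>i. a i * S i t) \<in> E" by simp
  moreover have "ae_filter ?M \<noteq> bot" unfolding ae_filter_eq_bot_iff em by simp
  ultimately obtain t where t: "(\<lambda>i. a i * C i t) \<in> E" "(\<lambda>i. a i * S i t) \<in> E"
    using eventually_happens' by blast
  have "(\<lambda>i. \<bar>a i * C i t\<bar>) \<in> E" "(\<lambda>i. \<bar>a i * S i t\<bar>) \<in> E"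
    using sign[OF t(1)] sign[OF t(2)] by simp_all
  then have sum: "(\<lambda>i. \<bar>a i * C i t\<bar> + \<bar>a i * S i t\<bar>) \<in> E" by (rule E_add)
  show "a \<in> E"
  proof (rule solid[OF sum])
    fix i
    have "1 \<le> \<bar>C i t\<bar> + \<bar>S i t\<bar>"
    proof -
      have "1 = \<bar>C i t\<bar> * \<bar>C i t\<bar> + \<bar>S i t\<bar> * \<bar>S i t\<bar>"
        unfolding C_def S_def by (simp flip: power2_eq_square)
      also have "\<dots> \<le> \<bar>C i t\<bar> * 1 + \<bar>S i t\<bar> * 1" by (intro add_mono mult_left_mono b) auto
      finally show ?thesis by simp
    qed
    then have "\<bar>a i\<bar> * 1 \<le> \<bar>a i\<bar> * (\<bar>C i t\<bar> + \<bar>S i t\<bar>)" by (intro mult_left_mono) auto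
    then show "\<bar>a i\<bar> \<le> \<bar>\<bar>a i * C i t\<bar> + \<bar>a i * S i t\<bar>\<bar>" by (simp add: abs_mult distrib_left)
  qed
qed

section \<open>The numerical index of absolute sums\<close>

lemma numerical_index_finite_absolute_sum:
  fixes X :: "'m::finite \<Rightarrow> ('k::real_normed_field, 'a) nvs"
  assumes N: "absolute_norm UNIV N" "numerical_index (coord_space UNIV N) = 1"
    and X: "\<And>i. banach_space_on (X i)" "\<And>i. nonzero_space (X i)"
    and hahn_banach: "\<And>Y :: ('k, 'a) nvs. normed_space_on Y \<Longrightarrow> norming_functionals Y"
      "\<And>Y :: ('k, 'm \<Rightarrow> 'a) nvs. normed_space_on Y \<Longrightarrow> norming_functionals Y"
  shows "numerical_index (E_sum UNIV N X) = Min (range (\<lambda>i. numerical_index (X i)))"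
proof -
  have Xn: "normed_space_on (X i)" for i using X(1) unfolding banach_space_on_def by blast
  interpret absolute_space UNIV N by (rule absolute_space_UNIV[OF N(1)])
  interpret absolute_sum UNIV N X
    by (intro absolute_sum.intro absolute_space_axioms absolute_sum_axioms.intro Xn X(2) hahn_banach(1))
  have nz: "nonzero_space (coord_space UNIV N)"
    unfolding nonzero_space_def coord_space_sel by (metis UNIV_I singletonD zero_neq_one)
  have "numerical_index Z = (INF i. numerical_index (X i))"
    by (rule numerical_index_E_sum[OF numerical_index_1_slices_in_duality[OF normed nz N(2)] dentable_ball_finite truncations_dense_finite
          hahn_banach(2)[OF normed_space_on_E_sum]]) simp_all
  then show ?thesis by (simp add: cInf_eq_Min)
qed

lemma numerical_index_unconditional_sum:
  fixes e :: "nat \<Rightarrow> 'e::{banach, second_countable_topology}" and X :: "nat \<Rightarrow> ('k::real_normed_field, 'a) nvs"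
  assumes e: "one_unconditional_basis e" "\<And>j. norm (e j) = 1"
    and E: "radon_nikodym_property TYPE('e)" "numerical_index (type_space :: (real, 'e) nvs) = 1"
    and X: "\<And>i. banach_space_on (X i)" "\<And>i. nonzero_space (X i)"
    and hahn_banach: "\<And>Y :: ('k, 'a) nvs. normed_space_on Y \<Longrightarrow> norming_functionals Y"
      "\<And>Y :: ('k, nat \<Rightarrow> 'a) nvs. normed_space_on Y \<Longrightarrow> norming_functionals Y"
  shows "numerical_index (E_sum (coeff_space e) (coeff_norm e) X) = (INF j. numerical_index (X j))"
proof -
  have ub: "unconditional_basis e" using e by unfold_locales auto
  interpret unconditional_basis e by (rule ub)
  have Xn: "normed_space_on (X i)" for i using X(1) unfolding banach_space_on_def by blast
  obtain D :: "'e set" where "countable D" "\<And>U. open U \<Longrightarrow> U \<noteq> {} \<Longrightarrow> \<exists>d\<in>D. d \<in> U"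
    using countable_dense_exists by blast
  then have dense: "\<exists>D :: 'e set. countable D \<and> closure D = UNIV"
    by (intro exI[of _ D]) (auto simp: closure_iff_nhds_not_empty, blast)
  interpret boundedly_complete_space E N
    by unfold_locales (rule boundedly_complete_coeff[OF ub E(1)], assumption, rule separable_coeff[OF dense])
  interpret absolute_sum E N X
    by (intro absolute_sum.intro absolute_space_axioms absolute_sum_axioms.intro Xn X(2) hahn_banach(1))
  show ?thesis
    by (rule numerical_index_E_sum[OF slices_in_duality_coeff[OF E(2)] dentable_ball truncations_dense
          hahn_banach(2)[OF normed_space_on_E_sum]])
qed

theorem corollary2p10:
  fixes N :: "('m::finite \<Rightarrow> real) \<Rightarrow> real"
    and e :: "nat \<Rightarrow> 'e::{banach, second_countable_topology}"
  shows
    "(absolute_norm UNIV N \<and> numerical_index (coord_space UNIV N) = 1 \<longrightarrow>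
        (\<forall>X :: 'm \<Rightarrow> (real, 'a) nvs.
           (\<forall>i. banach_space_on (X i) \<and> nonzero_space (X i)) \<longrightarrow>
           numerical_index (E_sum UNIV N X) = Min (range (\<lambda>i. numerical_index (X i)))) \<and>
        (\<forall>X :: 'm \<Rightarrow> (complex, 'b) nvs.
           (\<forall>i. banach_space_on (X i) \<and> nonzero_space (X i)) \<longrightarrow>
           numerical_index (E_sum UNIV N X) = Min (range (\<lambda>i. numerical_index (X i)))))
     \<and>
     (one_unconditional_basis e \<and> (\<forall>j. norm (e j) = 1) \<and>
      radon_nikodym_property TYPE('e) \<and> numerical_index (type_space :: (real, 'e) nvs) = 1 \<longrightarrow>
        (\<forall>X :: nat \<Rightarrow> (real, 'a) nvs.
           (\<forall>j. banach_space_on (X j) \<and> nonzero_space (X j)) \<longrightarrow>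
           numerical_index (E_sum (coeff_space e) (coeff_norm e) X)
             = (INF j. numerical_index (X j))) \<and>
        (\<forall>X :: nat \<Rightarrow> (complex, 'b) nvs.
           (\<forall>j. banach_space_on (X j) \<and> nonzero_space (X j)) \<longrightarrow>
           numerical_index (E_sum (coeff_space e) (coeff_norm e) X)
             = (INF j. numerical_index (X j))))"
proof (intro conjI impI allI; elim conjE)
  assume N: "absolute_norm UNIV N" "numerical_index (coord_space UNIV N) = 1"
  show "numerical_index (E_sum UNIV N X) = Min (range (\<lambda>i. numerical_index (X i)))"
    if "\<forall>i. banach_space_on (X i) \<and> nonzero_space (X i)" for X :: "'m \<Rightarrow> (real, 'a) nvs"
    by (rule numerical_index_finite_absolute_sum[OF N])
      (simp_all add: that norming_functionals_real)
  show "numerical_index (E_sum UNIV N X) = Min (range (\<lambda>i. numerical_index (X i)))"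
    if "\<forall>i. banach_space_on (X i) \<and> nonzero_space (X i)" for X :: "'m \<Rightarrow> (complex, 'b) nvs"
    by (rule numerical_index_finite_absolute_sum[OF N])
      (simp_all add: that norming_functionals_complex)
next
  assume "one_unconditional_basis e" "\<forall>j. norm (e j) = 1"
    "radon_nikodym_property TYPE('e)" "numerical_index (type_space :: (real, 'e) nvs) = 1"
  note e = this(1) this(2)[rule_format] this(3,4)
  show "numerical_index (E_sum (coeff_space e) (coeff_norm e) X) = (INF j. numerical_index (X j))"
    if "\<forall>j. banach_space_on (X j) \<and> nonzero_space (X j)" for X :: "nat \<Rightarrow> (real, 'a) nvs"
    by (rule numerical_index_unconditional_sum[OF e])
      (simp_all add: that norming_functionals_real)
  show "numerical_index (E_sum (coeff_space e) (coeff_norm e) X) = (INF j. numerical_index (X j))"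
    if "\<forall>j. banach_space_on (X j) \<and> nonzero_space (X j)" for X :: "nat \<Rightarrow> (complex, 'b) nvs"
    by (rule numerical_index_unconditional_sum[OF e])
      (simp_all add: that norming_functionals_complex)
qed

end
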